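(* Let $\mathcal{X}$ be a complete separable metric space and let $Q \in \mathcal{P}(\mathcal{X})$ satisfy $Q(\{x\}) = 0$ for all $x \in \mathcal{X}$. Let $P \in \mathcal{P}_2(\mathbb{R}^d)$ have a strictly positive density $p$ on $\mathbb{R}^d$. Let $\mathfrak{T} \subseteq \prod_{i=1}^d L^2(Q)$ be a subset containing an element $T$ for which $T_\# Q = P$, and let $(\mathcal{T}_n)_{n\in\mathbb{N}}$ be a sequence of sets with $\mathcal{T}_n \subseteq \mathfrak{T}$ for all $n$, $\mathcal{T}_n \subseteq \mathcal{T}_m$ for $n \leq m$, and such that $\mathcal{T}_\infty := \lim_{n\to\infty}\mathcal{T}_n = \bigcup_{n \in \mathbb{N}} \mathcal{T}_n$ is dense in $\mathfrak{T}$. Further suppose that $P$ is distantly dissipative, with $\nabla \log p$ Lipschitz and $\mathbb{E}_{X\sim P}[\|\nabla \log p(X)\|^2] < \infty$. Suppose that $T_n \in \mathcal{T}_n$ satisfies $$\mathcal{D}_{\mathrm{S}}(P,(T_n)_\#Q) - \inf_{T\in\mathcal{T}_n} \mathcal{D}_{\mathrm{S}}(P,T_\#Q) \rightarrow 0 \quad \text{as } n \rightarrow \infty,$$ where $\mathcal{D}_{\mathrm{S}}$ is the kernel Stein discrepancy based on the inverse multi-quadric kernel with parameters $c>0$, $\ell>0$, $\beta\in(-1,0)$. Then $(T_n)_\#Q \Rightarrow P$ as $n \to \infty$.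
   Context: All spaces carry their Borel $\sigma$-algebras; $\mathcal{P}(\mathcal{X})$ is the set of probability measures on $\mathcal{X}$; $\mathcal{P}_2(\mathbb{R}^d)$ is the set of $P \in \mathcal{P}(\mathbb{R}^d)$ with $\int \|x\|^2 \,\mathrm{d}P(x) < \infty$. $T_\#Q$ is the pushforward of $Q$ through $T$, and $\Rightarrow$ denotes weak convergence of measures. $L^2(Q)$ is the Hilbert space of real-valued measurable functions on $\mathcal{X}$ that are square-integrable with respect to $Q$; the product $\prod_{i=1}^d L^2(Q)$ (viewed as a space of maps $T=(T_1,\dots,T_d):\mathcal{X}\to\mathbb{R}^d$) has squared norm $\sum_{i=1}^d \|T_i\|_{L^2(Q)}^2$, and density is with respect to this norm. Distantly dissipative: with $s_p := \nabla \log p$, $P$ is distantly dissipative if $\liminf_{r\rightarrow\infty}\kappa(r) > 0$, where $$\kappa(r) := r^{-2}\inf_{\|x-y\|=r} \left(-\langle s_p(x)-s_p(y), x-y\rangle\right).$$ Kernel Stein discrepancy: let $k(x,y) := \left(c^2 + \left\|\frac{x-y}{\ell}\right\|^2\right)^\beta$ for some fixed $c>0$, $\ell>0$, $\beta\in(-1,0)$, with reproducing kernel Hilbert space $\mathcal{H}_k$ of functions on $\mathbb{R}^d$. Let $\mathcal{F}$ be the closed unit ball of the product Hilbert space $\prod_{i=1}^d \mathcal{H}_k$ (with squared norm $\sum_i\|f_i\|_{\mathcal{H}_k}^2$), and for $f\in\mathcal{F}$ let $\mathcal{A}_P f := f\cdot\nabla\log p + \nabla\cdot f$. Then $\mathcal{D}_{\mathrm{S}}(P,P')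 := \sup_{f\in\mathcal{F}} |\mathbb{E}_{Y\sim P'}[(\mathcal{A}_Pf)(Y)]|$. *)

theory Defs
  imports "HOL-Probability.Probability"
begin

section \<open>Square-integrable functions\<close>

text \<open>Elements of the \<open>L\<^sup>2\<close> spaces are represented by functions rather than by classes modulo
  null sets; accordingly \<open>L2_norm\<close> is only a seminorm on \<open>L2_space\<close>.\<close>

definition L2_space :: "'a measure \<Rightarrow> ('a \<Rightarrow> real) set" where
  "L2_space Q = {f \<in> borel_measurable Q. integrable Q (\<lambda>x. (f x)\<^sup>2)}"

definition L2_norm :: "'a measure \<Rightarrow> ('a \<Rightarrow> real) \<Rightarrow> real" where
  "L2_norm Q f = sqrt (\<integral>x. (f x)\<^sup>2 \<partial>Q)"

definition L2_prod_space :: "'a measure \<Rightarrow> ('a \<Rightarrow> real ^ 'd) set" where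
  "L2_prod_space Q = {T. \<forall>i. (\<lambda>x. T x $ i) \<in> L2_space Q}"

definition L2_prod_norm :: "'a measure \<Rightarrow> ('a \<Rightarrow> real ^ 'd) \<Rightarrow> real" where
  "L2_prod_norm Q T = sqrt (\<Sum>i\<in>UNIV. (L2_norm Q (\<lambda>x. T x $ i))\<^sup>2)"

definition L2_prod_dense_in ::
    "'a measure \<Rightarrow> ('a \<Rightarrow> real ^ 'd) set \<Rightarrow> ('a \<Rightarrow> real ^ 'd) set \<Rightarrow> bool" where
  "L2_prod_dense_in Q A B \<longleftrightarrow>
     A \<subseteq> B \<and> (\<forall>T\<in>B. \<forall>\<epsilon>>0. \<exists>S\<in>A. L2_prod_norm Q (\<lambda>x. T x - S x) < \<epsilon>)"

section \<open>Weak convergence\<close>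

definition weakly_converges ::
    "(nat \<Rightarrow> 'b::topological_space measure) \<Rightarrow> 'b measure \<Rightarrow> bool" where
  "weakly_converges M N \<longleftrightarrow>
     (\<forall>f :: 'b \<Rightarrow> real. continuous_on UNIV f \<longrightarrow> bounded (range f) \<longrightarrow>
        (\<lambda>n. \<integral>x. f x \<partial>M n) \<longlonglongrightarrow> (\<integral>x. f x \<partial>N))"

section \<open>Gradient, divergence, score and dissipativity\<close>

definition grad :: "('b::real_inner \<Rightarrow> real) \<Rightarrow> 'b \<Rightarrow> 'b" where
  "grad f x = (THE D. GDERIV f x :> D)"

definition divergence :: "(real ^ 'd \<Rightarrow> real ^ 'd) \<Rightarrow> real ^ 'd \<Rightarrow> real" where
  "divergence f x = (\<Sum>i\<in>UNIV. deriv (\<lambda>t. f (x + t *\<^sub>R axis i 1) $ i) 0)"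

definition score :: "(real ^ 'd \<Rightarrow> real) \<Rightarrow> real ^ 'd \<Rightarrow> real ^ 'd" where
  "score p = grad (\<lambda>x. ln (p x))"

text \<open>The infimum and the limit inferior are taken in the extended reals, so that no boundedness
  side conditions are needed for them to have their usual meaning.\<close>

definition dissipativity_rate :: "(real ^ 'd \<Rightarrow> real) \<Rightarrow> real \<Rightarrow> ereal" where
  "dissipativity_rate p r =
     ereal (1 / r\<^sup>2) *
       (INF (x, y)\<in>{(x, y). norm (x - y) = r}. ereal (- ((score p x - score p y) \<bullet> (x - y))))"

definition distantly_dissipative :: "(real ^ 'd \<Rightarrow> real) \<Rightarrow> bool" where
  "distantly_dissipative p \<longleftrightarrow> Liminf at_top (dissipativity_rate p) > 0"

section \<open>Reproducing kernel Hilbert spaces\<close>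

text \<open>\<open>rkhs k H ip\<close> says that the set of functions \<open>H\<close> with inner product \<open>ip\<close> is a Hilbert
  space (under pointwise operations) with reproducing kernel \<open>k\<close>. By the Moore--Aronszajn
  theorem a positive semidefinite kernel determines \<open>H\<close>, and \<open>ip\<close> on \<open>H\<close>, uniquely; the values of
  \<open>ip\<close> outside \<open>H\<close> are left unspecified.\<close>

locale rkhs =
  fixes k :: "'b \<Rightarrow> 'b \<Rightarrow> real"
    and H :: "('b \<Rightarrow> real) set"
    and ip :: "('b \<Rightarrow> real) \<Rightarrow> ('b \<Rightarrow> real) \<Rightarrow> real"
  assumes zero_mem: "(\<lambda>x. 0) \<in> H"
    and add_mem: "\<And>f g. f \<in> H \<Longrightarrow> g \<in> H \<Longrightarrow> (\<lambda>x. f x + g x) \<in> H"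
    and scale_mem: "\<And>a f. f \<in> H \<Longrightarrow> (\<lambda>x. a * f x) \<in> H"
    and ip_commute: "\<And>f g. f \<in> H \<Longrightarrow> g \<in> H \<Longrightarrow> ip f g = ip g f"
    and ip_add_left:
      "\<And>f g h. f \<in> H \<Longrightarrow> g \<in> H \<Longrightarrow> h \<in> H \<Longrightarrow> ip (\<lambda>x. f x + g x) h = ip f h + ip g h"
    and ip_scale_left: "\<And>a f g. f \<in> H \<Longrightarrow> g \<in> H \<Longrightarrow> ip (\<lambda>x. a * f x) g = a * ip f g"
    and ip_nonneg: "\<And>f. f \<in> H \<Longrightarrow> 0 \<le> ip f f"
    and ip_definite: "\<And>f. f \<in> H \<Longrightarrow> ip f f = 0 \<Longrightarrow> f = (\<lambda>x. 0)"
    and complete: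
      "\<And>F. (\<And>n::nat. F n \<in> H) \<Longrightarrow>
         (\<forall>\<epsilon>>0. \<exists>N. \<forall>m\<ge>N. \<forall>n\<ge>N.
            sqrt (ip (\<lambda>x. F m x - F n x) (\<lambda>x. F m x - F n x)) < \<epsilon>) \<Longrightarrow>
         (\<exists>f\<in>H. (\<lambda>n. sqrt (ip (\<lambda>x. F n x - f x) (\<lambda>x. F n x - f x))) \<longlonglongrightarrow> 0)"
    and kernel_mem: "\<And>y. (\<lambda>x. k x y) \<in> H"
    and reproducing: "\<And>f y. f \<in> H \<Longrightarrow> ip f (\<lambda>x. k x y) = f y"

definition rkhs_prod_unit_ball ::
    "('b \<Rightarrow> real) set \<Rightarrow> (('b \<Rightarrow> real) \<Rightarrow> ('b \<Rightarrow> real) \<Rightarrow> real) \<Rightarrow> ('b \<Rightarrow> real ^ 'd) set" where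
  "rkhs_prod_unit_ball H ip =
     {f. (\<forall>i. (\<lambda>x. f x $ i) \<in> H) \<and> (\<Sum>i\<in>UNIV. ip (\<lambda>x. f x $ i) (\<lambda>x. f x $ i)) \<le> 1}"

definition imq_kernel :: "real \<Rightarrow> real \<Rightarrow> real \<Rightarrow> real ^ 'd \<Rightarrow> real ^ 'd \<Rightarrow> real" where
  "imq_kernel c l \<beta> x y = (c\<^sup>2 + (norm ((x - y) /\<^sub>R l))\<^sup>2) powr \<beta>"

section \<open>Kernel Stein discrepancy\<close>

text \<open>The target distribution enters through its Lebesgue density \<open>p\<close>.\<close>

definition stein_op ::
    "(real ^ 'd \<Rightarrow> real) \<Rightarrow> (real ^ 'd \<Rightarrow> real ^ 'd) \<Rightarrow> real ^ 'd \<Rightarrow> real" where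
  "stein_op p f x = f x \<bullet> score p x + divergence f x"

text \<open>The space \<open>H\<close> with inner product \<open>ip\<close> is meant to be the reproducing kernel Hilbert space of
  the underlying kernel. The supremum is taken in the extended reals. The Bochner integral is \<open>0\<close>
  by convention for non-integrable functions; this never happens if, for instance, the score is
  Lipschitz, the kernel is the inverse multi-quadric and \<open>P'\<close> is a probability measure with finite
  first moment.\<close>

definition kernel_stein_discrepancy ::
    "(real ^ 'd \<Rightarrow> real) set \<Rightarrow> ((real ^ 'd \<Rightarrow> real) \<Rightarrow> (real ^ 'd \<Rightarrow> real) \<Rightarrow> real) \<Rightarrow>
     (real ^ 'd \<Rightarrow> real) \<Rightarrow> (real ^ 'd) measure \<Rightarrow> ereal" where
  "kernel_stein_discrepancy H ip p P' =
     (SUP f\<in>rkhs_prod_unit_ball H ip. ereal \<bar>\<integral>y. stein_op p f y \<partial>P'\<bar>)"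

end

theory Submission
  imports Defs
begin

text \<open>The density of \<open>\<Union>n. \<T> n\<close> and the Stein identity show that the discrepancies of the laws
  \<open>\<mu> n\<close> of \<open>T n\<close> tend to zero, so the Stein operator of every vector field with components in
  \<open>H\<close> has integrals against \<open>\<mu> n\<close> tending to zero. That this forces weak convergence is shown
  without solving the Stein equation. The kernel is a mixture of Gaussians \<open>exp (- s * (norm (x - y))\<^sup>2)\<close>, and each
  of these is an \<open>L\<^sup>2\<close> inner product of two Gaussians of twice the precision; hence \<open>H\<close> contains every
  integral of these features against a square-integrable coefficient. Two families of members suffice.
  The fields \<open>- x / (a + (norm x)\<^sup>2)\<close> give tightness: by dissipativity their Stein operator is at
  least of order \<open>- 1 / a\<close> everywhere and bounded below by a positive constant outside a ball. Convolutions with mixtures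
  of narrow Gaussians approximate \<open>\<psi> / p\<close> for compactly supported \<open>\<psi>\<close>, which yields
  that the integral of \<open>\<partial>\<psi> / p\<close> against \<open>\<mu> n\<close> tends to zero. So in the limit \<open>\<mu> n / p\<close> is translation
  invariant, that is, a multiple of Lebesgue measure, and tightness fixes the multiple.\<close>

section \<open>Reproducing kernel Hilbert spaces\<close>

text \<open>The discrepancies make Stein integrals vanish in the limit only for fields with
  components in \<open>H\<close>, and \<open>H\<close> is known solely through the axioms of
  \<open>rkhs\<close>. So everything hinges on membership criteria, and \<open>mem_of_bound\<close>
  is the source of all of them: a function lies in \<open>H\<close> once finite combinations of its
  values are dominated by the quadratic form of the kernel. The analytic obstacle is that the score
  may grow linearly while no moment bound uniform in \<open>n\<close> is at hand, so the Stein
  operator of a test field must be approximated uniformly on the whole space. The Lipschitz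
  condition provides this: shifting the argument of the score by \<open>v\<close> costs at most
  \<open>score_Lip * norm v\<close>, and arbitrarily large precisions carry mass in the mixture, so
  mollifiers with small first moment exist. The other end of the mixture, \<open>s\<close> near 0,
  supplies fields that decay only like \<open>1 / norm x\<close>, slowly enough to balance the
  growth of the score; this is where \<open>\<beta> > -1\<close> enters. Far out \<open>p\<close>
  may be arbitrarily small, so division by \<open>p\<close> takes place on compact sets only, after
  a cut-off that tightness justifies.\<close>

context rkhs
begin

lemma ip_add_right: "f \<in> H \<Longrightarrow> g \<in> H \<Longrightarrow> h \<in> H \<Longrightarrow> ip h (\<lambda>x. f x + g x) = ip h f + ip h g"
  using ip_add_left[of f g h] ip_commute add_mem by (metis (no_types, lifting))

lemma ip_scale_right: "f \<in> H \<Longrightarrow> g \<in> H \<Longrightarrow> ip g (\<lambda>x. a * f x) = a * ip g f"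
  using ip_scale_left[of f g a] ip_commute scale_mem by (metis (no_types, lifting))

lemma diff_mem: "f \<in> H \<Longrightarrow> g \<in> H \<Longrightarrow> (\<lambda>x. f x - g x) \<in> H"
  using add_mem[of f "\<lambda>x. (-1) * g x"] scale_mem[of g "-1"] by simp

lemma ip_comb:
  assumes "f \<in> H" "g \<in> H"
  shows "ip (\<lambda>x. a * f x + b * g x) (\<lambda>x. a * f x + b * g x) =
    a\<^sup>2 * ip f f + 2 * a * b * ip f g + b\<^sup>2 * ip g g"
proof -
  have m: "(\<lambda>x. a * f x) \<in> H" "(\<lambda>x. b * g x) \<in> H" using scale_mem assms by auto
  show ?thesis
    using m assms
    by (simp add: ip_add_left ip_add_right add_mem ip_scale_left ip_scale_right ip_commute[of g f]
        power2_eq_square algebra_simps)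
qed

lemma Cauchy_Schwarz_ip:
  assumes "f \<in> H" "g \<in> H"
  shows "(ip f g)\<^sup>2 \<le> ip f f * ip g g"
proof (cases "ip g g = 0")
  case True
  then have "g = (\<lambda>x. 0)" using ip_definite assms by blast
  then have "ip f g = 0" using ip_scale_right[OF assms(2,1), of 0] by simp
  with True show ?thesis by simp
next
  case False
  with ip_nonneg[OF assms(2)] have pos: "ip g g > 0" by simp
  have "0 \<le> ip (\<lambda>x. ip g g * f x + (- ip f g) * g x) (\<lambda>x. ip g g * f x + (- ip f g) * g x)"
    using assms by (intro ip_nonneg add_mem scale_mem)
  also have "\<dots> = ip g g * (ip f f * ip g g - (ip f g)\<^sup>2)"
    unfolding ip_comb[OF assms] by (simp add: power2_eq_square algebra_simps)
  finally show ?thesis using pos by (simp add: zero_le_mult_iff)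
qed

text \<open>Coefficients come as a list, so addition is concatenation and points may repeat; the
  difference of two difference quotients lists its base point twice.\<close>

definition comb :: "('b \<times> real) list \<Rightarrow> 'b \<Rightarrow> real" where
  "comb xs = (\<lambda>x. \<Sum>(y, a)\<leftarrow>xs. a * k x y)"

lemma comb_simps: "comb [] = (\<lambda>x. 0)" "comb (z # xs) = (\<lambda>x. snd z * k x (fst z) + comb xs x)"
  "comb (xs @ ys) = (\<lambda>x. comb xs x + comb ys x)"
  by (auto simp: comb_def case_prod_beta)

lemma comb_scale: "comb (map (\<lambda>(y, a). (y, s * a)) xs) = (\<lambda>x. s * comb xs x)"
  by (induction xs) (auto simp: comb_simps algebra_simps)

lemma comb_mem: "comb xs \<in> H"
  by (induction xs) (auto simp: comb_simps zero_mem intro!: add_mem scale_mem kernel_mem)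

lemma ip_with_comb: "f \<in> H \<Longrightarrow> ip f (comb xs) = (\<Sum>(y, a)\<leftarrow>xs. a * f y)"
proof (induction xs)
  case Nil
  then show ?case using ip_scale_right[OF zero_mem, of f 0] by (simp add: comb_simps)
next
  case (Cons z xs)
  then show ?case
    by (simp add: comb_simps ip_add_right scale_mem kernel_mem comb_mem ip_scale_right reproducing case_prod_beta)
qed

lemma ip_comb_comb:
  "ip (comb xs) (comb xs) = (\<Sum>(y, a)\<leftarrow>xs. a * (\<Sum>(z, b)\<leftarrow>xs. b * k y z))"
  unfolding ip_with_comb[OF comb_mem] by (simp add: comb_def)

text \<open>All pointwise estimates on \<open>H\<close> are instances: a combination of point
  evaluations is represented by \<open>comb xs\<close>, and the double sum is the squared norm of
  that representer, computable from the kernel alone.\<close>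

lemma sum_list_bound:
  assumes "f \<in> H"
  shows "(\<Sum>(y, a)\<leftarrow>xs. a * f y)\<^sup>2 \<le> ip f f * (\<Sum>(y, a)\<leftarrow>xs. a * (\<Sum>(z, b)\<leftarrow>xs. b * k y z))"
  using Cauchy_Schwarz_ip[OF assms comb_mem, of xs] unfolding ip_with_comb[OF assms] ip_comb_comb .

lemma eval_bound:
  assumes "f \<in> H"
  shows "(f x)\<^sup>2 \<le> ip f f * k x x"
  using sum_list_bound[OF assms, of "[(x, 1)]"] by simp

text \<open>The functional \<open>f \<mapsto> ip f f - 2 l f\<close>, where \<open>l\<close> maps \<open>comb xs\<close> to the corresponding
  combination of values of \<open>h\<close>, is minimised over the finite combinations of kernel functions; its
  minimiser reproduces \<open>h\<close>.\<close>

lemma mem_of_bound: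
  assumes bnd: "\<And>xs. (\<Sum>(y, a)\<leftarrow>xs. a * h y)\<^sup>2 \<le> B\<^sup>2 * (\<Sum>(y, a)\<leftarrow>xs. a * (\<Sum>(z, b)\<leftarrow>xs. b * k y z))"
    and B: "B \<ge> 0"
  shows "h \<in> H"
proof -
  define l where "l xs = (\<Sum>(y, a)\<leftarrow>xs. a * h y)" for xs
  define N where "N xs = ip (comb xs) (comb xs)" for xs
  define J where "J xs = N xs - 2 * l xs" for xs
  have N0: "N xs \<ge> 0" for xs by (simp add: N_def ip_nonneg comb_mem)
  have lN: "(l xs)\<^sup>2 \<le> B\<^sup>2 * N xs" for xs
    using bnd[of xs] by (simp add: l_def N_def ip_comb_comb)
  have l_le: "\<bar>l xs\<bar> \<le> B * sqrt (N xs)" for xs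
    using real_sqrt_le_mono[OF lN[of xs]] B by (simp add: real_sqrt_mult)
  have J_lb: "J xs \<ge> - B\<^sup>2" for xs
  proof -
    have "0 \<le> (sqrt (N xs) - B)\<^sup>2" by simp
    also have "\<dots> = N xs - 2 * (B * sqrt (N xs)) + B\<^sup>2" using N0 by (simp add: power2_diff)
    finally show ?thesis using l_le[of xs] by (simp add: J_def)
  qed
  define m where "m = Inf (range J)"
  have bdd: "bdd_below (range J)" using J_lb by (meson bdd_belowI2)
  have m_le: "m \<le> J xs" for xs unfolding m_def by (rule cInf_lower) (auto simp: bdd)
  have "\<exists>xs. J xs < m + 1 / real (Suc n)" for n
    using cInf_lessD[of "range J" "m + 1 / real (Suc n)"] by (auto simp: m_def)
  then obtain X0 where X0: "\<And>n. J (X0 n) < m + 1 / real (Suc n)" by metis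
  define X where "X n = (if J (X0 n) \<le> 0 then X0 n else [])" for n
  have J_Nil: "J [] = 0"
    using ip_scale_right[OF zero_mem zero_mem, of 0] by (simp add: J_def N_def l_def comb_simps)
  have X: "J (X n) < m + 1 / real (Suc n)" "J (X n) \<le> 0" for n
    using X0[of n] J_Nil by (auto simp: X_def)
  define F where "F n = comb (X n)" for n
  have FH: "F n \<in> H" for n by (simp add: F_def comb_mem)
  \<comment> \<open>Parallelogram law: for the midpoint \<open>M\<close> the left-hand side equals
    \<open>2 * J (X i) + 2 * J (X j) - 4 * J M\<close>, and \<open>J M\<close> is at least the
    infimum \<open>m\<close>.\<close>
  have par: "ip (\<lambda>x. F i x - F j x) (\<lambda>x. F i x - F j x) \<le> 2 / real (Suc i) + 2 / real (Suc j)" for i j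
  proof -
    define M where "M = map (\<lambda>(y, a). (y, (1/2) * a)) (X i @ X j)"
    have cM: "comb M = (\<lambda>x. (1/2) * F i x + (1/2) * F j x)"
      unfolding M_def comb_scale comb_simps F_def by (simp add: algebra_simps)
    have lsc: "l (map (\<lambda>(y, a). (y, (1/2) * a)) ys) = l ys / 2" for ys
      by (induction ys) (auto simp: l_def case_prod_beta)
    have lap: "l (X i @ X j) = l (X i) + l (X j)" by (simp add: l_def)
    have lM: "l M = (l (X i) + l (X j)) / 2"
      unfolding M_def lsc lap ..
    have "m \<le> J M" by (rule m_le)
    also have "J M = ip (F i) (F i) / 4 + ip (F i) (F j) / 2 + ip (F j) (F j) / 4 - (l (X i) + l (X j))"
      unfolding J_def N_def cM ip_comb[OF FH FH] lM by (simp add: power2_eq_square field_simps)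
    finally have 1: "m \<le> ip (F i) (F i) / 4 + ip (F i) (F j) / 2 + ip (F j) (F j) / 4 - (l (X i) + l (X j))" .
    have 2: "ip (\<lambda>x. F i x - F j x) (\<lambda>x. F i x - F j x) = ip (F i) (F i) - 2 * ip (F i) (F j) + ip (F j) (F j)"
      using ip_comb[OF FH FH, of 1 i "-1" j] by simp
    have 3: "ip (F i) (F i) - 2 * l (X i) < m + 1 / real (Suc i)" "ip (F j) (F j) - 2 * l (X j) < m + 1 / real (Suc j)"
      using X(1)[of i] X(1)[of j] by (auto simp: J_def N_def F_def)
    have 4: "2 / real (Suc n) = 2 * (1 / real (Suc n))" for n by simp
    show ?thesis unfolding 2 4 using 1 3 by linarith
  qed
  have "\<forall>\<epsilon>>0. \<exists>M. \<forall>i\<ge>M. \<forall>j\<ge>M. sqrt (ip (\<lambda>x. F i x - F j x) (\<lambda>x. F i x - F j x)) < \<epsilon>"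
  proof (intro allI impI)
    fix \<epsilon> :: real assume e: "\<epsilon> > 0"
    obtain M :: nat where M: "4 / \<epsilon>\<^sup>2 < real M" using reals_Archimedean2 by blast
    have "sqrt (ip (\<lambda>x. F i x - F j x) (\<lambda>x. F i x - F j x)) < \<epsilon>" if "i \<ge> M" "j \<ge> M" for i j
    proof -
      have *: "2 / real (Suc n) < \<epsilon>\<^sup>2 / 2" if "n \<ge> M" for n
      proof -
        have "4 / \<epsilon>\<^sup>2 < real (Suc n)" using M that by linarith
        then show ?thesis using e by (simp add: field_simps)
      qed
      have "ip (\<lambda>x. F i x - F j x) (\<lambda>x. F i x - F j x) < \<epsilon>\<^sup>2"
        using par[of i j] *[OF that(1)] *[OF that(2)] by linarith
      then show ?thesis using e real_sqrt_less_mono by fastforce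
    qed
    then show "\<exists>M. \<forall>i\<ge>M. \<forall>j\<ge>M. sqrt (ip (\<lambda>x. F i x - F j x) (\<lambda>x. F i x - F j x)) < \<epsilon>" by blast
  qed
  from complete[OF FH this] obtain f where f: "f \<in> H"
    and lim: "(\<lambda>n. sqrt (ip (\<lambda>x. F n x - f x) (\<lambda>x. F n x - f x))) \<longlonglongrightarrow> 0" by blast
  have Fnf: "(\<lambda>n. F n x) \<longlonglongrightarrow> f x" for x
  proof -
    have "\<bar>F n x - f x\<bar> \<le> sqrt (ip (\<lambda>x. F n x - f x) (\<lambda>x. F n x - f x)) * sqrt (k x x)" for n
      using real_sqrt_le_mono[OF eval_bound[OF diff_mem[OF FH f], of n x]] by (simp add: real_sqrt_mult)
    then have "(\<lambda>n. F n x - f x) \<longlonglongrightarrow> 0"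
      by (intro Lim_null_comparison[OF _ tendsto_mult_left_zero[OF lim, of "sqrt (k x x)"]]) auto
    then show ?thesis by (simp add: LIM_zero_iff)
  qed
  have Fnh: "(\<lambda>n. F n x) \<longlonglongrightarrow> h x" for x
  proof -
    \<comment> \<open>First variation in the direction of the kernel section at \<open>x\<close>:
      prepending \<open>(x, s)\<close> changes \<open>J\<close> by a quadratic in \<open>s\<close>
      whose linear coefficient is twice the defect \<open>F n x - h x\<close>.\<close>
    have var: "m \<le> J (X n) + 2 * s * (F n x - h x) + s\<^sup>2 * k x x" for s n
    proof -
      have "m \<le> J ((x, s) # X n)" by (rule m_le)
      have "comb ((x, s) # X n) = (\<lambda>y. s * k y x + 1 * F n y)" by (simp add: comb_simps F_def)
      moreover have "ip (\<lambda>y. k y x) (F n) = F n x"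
        using ip_commute[OF kernel_mem FH] reproducing[OF FH] by metis
      ultimately have "N ((x, s) # X n) = s\<^sup>2 * k x x + 2 * s * F n x + N (X n)"
        unfolding N_def using ip_comb[OF kernel_mem FH, of s x 1 n] reproducing[OF kernel_mem, of x x]
        by (simp add: F_def)
      then have "J ((x, s) # X n) = J (X n) + 2 * s * (F n x - h x) + s\<^sup>2 * k x x"
        by (simp add: J_def l_def algebra_simps)
      then show ?thesis using \<open>m \<le> J ((x, s) # X n)\<close> by simp
    qed
    have kx: "k x x \<ge> 0" using ip_nonneg[OF kernel_mem] reproducing[OF kernel_mem] by metis
    have sq: "(F n x - h x)\<^sup>2 \<le> (k x x + 1) * (1 / real (Suc n))" for n
    proof -
      define D where "D = F n x - h x"
      \<comment> \<open>Near-optimal step in the quadratic; \<open>k x x + 1\<close> replaces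
        \<open>k x x\<close>, which may vanish.\<close>
      define s where "s = - D / (k x x + 1)"
      have sK: "s * (k x x + 1) = - D" using kx by (simp add: s_def)
      have "s\<^sup>2 * (k x x + 1) = s * (s * (k x x + 1))" by (simp add: power2_eq_square)
      also have "\<dots> = - (s * D)" unfolding sK by simp
      finally have s2: "s\<^sup>2 * (k x x + 1) = - (s * D)" .
      have "s\<^sup>2 * k x x \<le> s\<^sup>2 * (k x x + 1)" by (simp add: mult_left_mono)
      moreover have "m \<le> J (X n) + 2 * s * D + s\<^sup>2 * k x x" using var[of n s] by (simp add: D_def)
      ultimately have "- (s * D) \<le> 1 / real (Suc n)" using s2 X(1)[of n] by linarith
      then have "D\<^sup>2 / (k x x + 1) \<le> 1 / real (Suc n)" by (simp add: s_def power2_eq_square)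
      then show ?thesis using kx by (simp add: D_def divide_le_eq mult.commute)
    qed
    have "(\<lambda>n. (k x x + 1) * (1 / real (Suc n))) \<longlonglongrightarrow> (k x x + 1) * 0"
      by (intro tendsto_mult tendsto_const) (use LIMSEQ_inverse_real_of_nat in \<open>simp add: inverse_eq_divide\<close>)
    then have K0: "(\<lambda>n. (k x x + 1) * (1 / real (Suc n))) \<longlonglongrightarrow> 0" by (simp only: mult_zero_right)
    have "\<forall>\<^sub>F n in sequentially. norm ((F n x - h x)\<^sup>2) \<le> (k x x + 1) * (1 / real (Suc n))"
      unfolding real_norm_def abs_power2 by (intro always_eventually allI sq)
    then have "(\<lambda>n. (F n x - h x)\<^sup>2) \<longlonglongrightarrow> 0"
      by (rule Lim_null_comparison[OF _ K0])
    then have "(\<lambda>n. F n x - h x) \<longlonglongrightarrow> 0"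
      using tendsto_real_sqrt[of "\<lambda>n. (F n x - h x)\<^sup>2" 0 sequentially]
      by (simp add: tendsto_rabs_zero_iff)
    then show ?thesis by (simp add: LIM_zero_iff)
  qed
  \<comment> \<open>Norm convergence identifies the pointwise limit as \<open>f\<close>,
    near-minimality identifies it as \<open>h\<close>.\<close>
  have "f = h" using LIMSEQ_unique[OF Fnf Fnh] by blast
  then show ?thesis using f by simp
qed

end

section \<open>Regularity of members of the space\<close>

text \<open>The kernel as a function of a signed distance: being even and smooth on the whole line,
  it can be evaluated at \<open>t - s\<close> along a coordinate axis and expanded at 0.\<close>

definition imq_profile :: "real \<Rightarrow> real \<Rightarrow> real \<Rightarrow> real \<Rightarrow> real" where
  "imq_profile c l \<beta> t = (c\<^sup>2 + (t / l)\<^sup>2) powr \<beta>"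

lemma imq_kernel_eq_profile:
  "l > 0 \<Longrightarrow> imq_kernel c l \<beta> x y = imq_profile c l \<beta> (norm (x - y))"
  by (simp add: imq_kernel_def imq_profile_def divide_inverse mult.commute)

lemma imq_profile_even: "imq_profile c l \<beta> (- t) = imq_profile c l \<beta> t"
  by (simp add: imq_profile_def)

lemma imq_profile_abs: "imq_profile c l \<beta> \<bar>t\<bar> = imq_profile c l \<beta> t"
  using imq_profile_even[of c l \<beta> t] by (cases "t \<ge> 0") auto

text \<open>The derivative is \<open>t\<close> times a smooth function of the square of
  \<open>t\<close>. So it vanishes linearly at 0, and after removal of the Taylor term
  \<open>B * t\<^sup>2\<close> it is of third order. The mean value inequality on the interval of
  radius \<open>\<bar>t\<bar> + \<bar>s\<bar>\<close> gives both bounds; the factor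
  \<open>\<bar>t - s\<bar>\<close> is kept to cancel a denominator later.\<close>

lemma imq_profile_expansion:
  fixes c l \<beta> :: real
  assumes "c > 0" "l > 0" "\<beta> < 0"
  obtains C B where "C > 0"
    "\<And>t s. \<bar>imq_profile c l \<beta> t - imq_profile c l \<beta> s\<bar> \<le> C * (\<bar>t\<bar> + \<bar>s\<bar>) * \<bar>t - s\<bar>"
    "\<And>t s. \<bar>(imq_profile c l \<beta> t - B * t\<^sup>2) - (imq_profile c l \<beta> s - B * s\<^sup>2)\<bar> \<le> C * (\<bar>t\<bar> + \<bar>s\<bar>) ^ 3 * \<bar>t - s\<bar>"
proof -
  define \<kappa> where "\<kappa> = imq_profile c l \<beta>"
  define \<psi> where "\<psi> v = (c\<^sup>2 + v) powr (\<beta> - 1)" for v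
  define M1 where "M1 = (c\<^sup>2) powr (\<beta> - 1)"
  define M2 where "M2 = \<bar>\<beta> - 1\<bar> * (c\<^sup>2) powr (\<beta> - 2)"
  define C1 where "C1 = 2 * \<bar>\<beta>\<bar> * M1 / l\<^sup>2"
  define C2 where "C2 = 2 * \<bar>\<beta>\<bar> * M2 / l ^ 4"
  define B where "B = \<beta> * \<psi> 0 / l\<^sup>2"
  have M: "M1 \<ge> 0" "M2 \<ge> 0" by (simp_all add: M1_def M2_def)
  then have pos: "C1 \<ge> 0" "C2 \<ge> 0"
    unfolding C1_def C2_def by (intro divide_nonneg_nonneg mult_nonneg_nonneg; simp)+
  have cpos: "c\<^sup>2 > 0" using assms by simp
  have \<psi>_le: "\<bar>\<psi> v\<bar> \<le> M1" if "v \<ge> 0" for v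
    using that assms cpos by (auto simp: \<psi>_def M1_def intro!: powr_mono2')
  have \<psi>_diff: "\<bar>\<psi> v - \<psi> 0\<bar> \<le> M2 * v" if "v \<ge> 0" for v
  proof -
    have "norm (\<psi> v - \<psi> 0) \<le> M2 * norm (v - 0)"
    proof (rule field_differentiable_bound[of "{0..}" \<psi> "\<lambda>u. (\<beta> - 1) * (c\<^sup>2 + u) powr (\<beta> - 2)"])
      fix u :: real assume u: "u \<in> {0..}"
      then have "c\<^sup>2 + u > 0" using cpos by (intro add_pos_nonneg) auto
      then show "(\<psi> has_field_derivative (\<beta> - 1) * (c\<^sup>2 + u) powr (\<beta> - 2)) (at u within {0..})"
        unfolding \<psi>_def[abs_def] by (auto intro!: derivative_eq_intros)
      show "norm ((\<beta> - 1) * (c\<^sup>2 + u) powr (\<beta> - 2)) \<le> M2"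
        using u cpos assms by (auto simp: M2_def abs_mult intro!: mult_left_mono powr_mono2')
    qed (use that in auto)
    then show ?thesis using that by simp
  qed
  have \<kappa>': "(\<kappa> has_field_derivative (2 * t / l\<^sup>2) * (\<beta> * \<psi> ((t / l)\<^sup>2))) (at t within S)" for t S
  proof -
    have "c\<^sup>2 + (t / l)\<^sup>2 > 0" using cpos by (simp add: add_pos_nonneg)
    then show ?thesis
      unfolding \<kappa>_def imq_profile_def[abs_def] \<psi>_def using assms
      by (auto intro!: derivative_eq_intros simp: power2_eq_square field_simps)
  qed
  have 1: "\<bar>\<kappa> t - \<kappa> s\<bar> \<le> C1 * (\<bar>t\<bar> + \<bar>s\<bar>) * \<bar>t - s\<bar>" for t s
  proof -
    have "norm (\<kappa> t - \<kappa> s) \<le> (C1 * (\<bar>t\<bar> + \<bar>s\<bar>)) * norm (t - s)"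
    proof (rule field_differentiable_bound[OF _ \<kappa>', of "{- (\<bar>t\<bar> + \<bar>s\<bar>)..\<bar>t\<bar> + \<bar>s\<bar>}"])
      fix u assume u: "u \<in> {- (\<bar>t\<bar> + \<bar>s\<bar>)..\<bar>t\<bar> + \<bar>s\<bar>}"
      have "norm ((2 * u / l\<^sup>2) * (\<beta> * \<psi> ((u / l)\<^sup>2))) = (2 * \<bar>\<beta>\<bar> / l\<^sup>2) * (\<bar>u\<bar> * \<bar>\<psi> ((u / l)\<^sup>2)\<bar>)"
        by (simp add: abs_mult)
      also have "\<dots> \<le> (2 * \<bar>\<beta>\<bar> / l\<^sup>2) * ((\<bar>t\<bar> + \<bar>s\<bar>) * M1)"
        using u \<psi>_le[of "(u / l)\<^sup>2"] by (intro mult_left_mono mult_mono) auto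
      also have "\<dots> = C1 * (\<bar>t\<bar> + \<bar>s\<bar>)" by (simp add: C1_def)
      finally show "norm ((2 * u / l\<^sup>2) * (\<beta> * \<psi> ((u / l)\<^sup>2))) \<le> C1 * (\<bar>t\<bar> + \<bar>s\<bar>)" .
    qed auto
    then show ?thesis by simp
  qed
  have 2: "\<bar>(\<kappa> t - B * t\<^sup>2) - (\<kappa> s - B * s\<^sup>2)\<bar> \<le> C2 * (\<bar>t\<bar> + \<bar>s\<bar>) ^ 3 * \<bar>t - s\<bar>" for t s
  proof -
    have "norm ((\<kappa> t - B * t\<^sup>2) - (\<kappa> s - B * s\<^sup>2)) \<le> (C2 * (\<bar>t\<bar> + \<bar>s\<bar>) ^ 3) * norm (t - s)"
    proof (rule field_differentiable_bound[of "{- (\<bar>t\<bar> + \<bar>s\<bar>)..\<bar>t\<bar> + \<bar>s\<bar>}" "\<lambda>t. \<kappa> t - B * t\<^sup>2"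
          "\<lambda>u. (2 * u / l\<^sup>2) * (\<beta> * (\<psi> ((u / l)\<^sup>2) - \<psi> 0))"])
      fix u assume u: "u \<in> {- (\<bar>t\<bar> + \<bar>s\<bar>)..\<bar>t\<bar> + \<bar>s\<bar>}"
      show "((\<lambda>t. \<kappa> t - B * t\<^sup>2) has_field_derivative (2 * u / l\<^sup>2) * (\<beta> * (\<psi> ((u / l)\<^sup>2) - \<psi> 0)))
          (at u within {- (\<bar>t\<bar> + \<bar>s\<bar>)..\<bar>t\<bar> + \<bar>s\<bar>})"
        by (rule derivative_eq_intros \<kappa>' refl)+ (simp add: B_def algebra_simps diff_divide_distrib)
      have "norm ((2 * u / l\<^sup>2) * (\<beta> * (\<psi> ((u / l)\<^sup>2) - \<psi> 0))) = (2 * \<bar>\<beta>\<bar> / l\<^sup>2) * (\<bar>u\<bar> * \<bar>\<psi> ((u / l)\<^sup>2) - \<psi> 0\<bar>)"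
        by (simp add: abs_mult)
      also have "\<dots> \<le> (2 * \<bar>\<beta>\<bar> / l\<^sup>2) * (\<bar>u\<bar> * (M2 * (u / l)\<^sup>2))"
        using \<psi>_diff[of "(u / l)\<^sup>2"] by (intro mult_left_mono) auto
      also have "\<dots> = C2 * \<bar>u\<bar> ^ 3"
      proof -
        have "\<bar>u\<bar> ^ 3 = \<bar>u\<bar> * u\<^sup>2" by (simp add: power3_eq_cube power2_eq_square)
        then show ?thesis by (simp add: C2_def power_divide power4_eq_xxxx power2_eq_square mult_ac)
      qed
      also have "\<dots> \<le> C2 * (\<bar>t\<bar> + \<bar>s\<bar>) ^ 3"
        using u pos by (intro mult_left_mono power_mono) auto
      finally show "norm ((2 * u / l\<^sup>2) * (\<beta> * (\<psi> ((u / l)\<^sup>2) - \<psi> 0))) \<le> C2 * (\<bar>t\<bar> + \<bar>s\<bar>) ^ 3" .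
    qed auto
    then show ?thesis by simp
  qed
  define C where "C = max C1 C2 + 1"
  show ?thesis
  proof (rule that[of C B])
    show "C > 0" using pos by (simp add: C_def)
    show "\<bar>imq_profile c l \<beta> t - imq_profile c l \<beta> s\<bar> \<le> C * (\<bar>t\<bar> + \<bar>s\<bar>) * \<bar>t - s\<bar>" for t s
      by (rule order_trans[OF 1[unfolded \<kappa>_def]]) (auto simp: C_def intro!: mult_right_mono)
    show "\<bar>(imq_profile c l \<beta> t - B * t\<^sup>2) - (imq_profile c l \<beta> s - B * s\<^sup>2)\<bar> \<le> C * (\<bar>t\<bar> + \<bar>s\<bar>) ^ 3 * \<bar>t - s\<bar>" for t s
      by (rule order_trans[OF 2[unfolded \<kappa>_def]]) (auto simp: C_def intro!: mult_right_mono)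
  qed
qed

text \<open>The left-hand side is the squared norm of the difference of the difference quotients of the
  kernel section with steps \<open>t\<close> and \<open>s\<close>.\<close>

lemma imq_profile_quotient_bound:
  fixes c l \<beta> :: real
  assumes "c > 0" "l > 0" "\<beta> < 0"
  obtains K where "K \<ge> 0" "\<And>s t. s \<noteq> 0 \<Longrightarrow> \<bar>s\<bar> \<le> \<bar>t\<bar> \<Longrightarrow>
     2 * (imq_profile c l \<beta> 0 - imq_profile c l \<beta> t) / t\<^sup>2
     + 2 * (imq_profile c l \<beta> 0 - imq_profile c l \<beta> s) / s\<^sup>2
     - 2 * (imq_profile c l \<beta> (t - s) - imq_profile c l \<beta> t - imq_profile c l \<beta> s + imq_profile c l \<beta> 0) / (t * s)
     \<le> K * t\<^sup>2"
proof -
  obtain C B where C: "C > 0" and CB: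
    "\<And>t s. \<bar>(imq_profile c l \<beta> t - B * t\<^sup>2) - (imq_profile c l \<beta> s - B * s\<^sup>2)\<bar> \<le> C * (\<bar>t\<bar> + \<bar>s\<bar>) ^ 3 * \<bar>t - s\<bar>"
    using imq_profile_expansion[OF assms] by metis
  define R where "R t = imq_profile c l \<beta> t - B * t\<^sup>2 - imq_profile c l \<beta> 0" for t
  have R: "\<bar>R t - R s\<bar> \<le> C * (\<bar>t\<bar> + \<bar>s\<bar>) ^ 3 * \<bar>t - s\<bar>" for t s
    using CB[of t s] by (simp add: R_def)
  have R0: "\<bar>R t\<bar> \<le> C * \<bar>t\<bar> ^ 3 * \<bar>t\<bar>" for t using R[of t 0] by (simp add: R_def)
  have \<kappa>: "imq_profile c l \<beta> t = imq_profile c l \<beta> 0 + B * t\<^sup>2 + R t" for t by (simp add: R_def)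
  show ?thesis
  proof (rule that[of "60 * C"])
    fix s t :: real assume s: "s \<noteq> 0" and st: "\<bar>s\<bar> \<le> \<bar>t\<bar>"
    then have t: "t \<noteq> 0" by auto
    have a: "\<bar>R t / t\<^sup>2\<bar> \<le> C * t\<^sup>2" if "t \<noteq> 0" for t
    proof -
      have "\<bar>R t / t\<^sup>2\<bar> \<le> (C * \<bar>t\<bar> ^ 3 * \<bar>t\<bar>) / t\<^sup>2" using R0[of t] by (simp add: divide_right_mono)
      also have "\<dots> = C * t\<^sup>2" using that by (simp add: power3_eq_cube power2_eq_square field_simps)
      finally show ?thesis .
    qed
    have s2: "s\<^sup>2 \<le> t\<^sup>2" using st by (rule abs_le_square_iff[THEN iffD1])
    then have b: "\<bar>R s / s\<^sup>2\<bar> \<le> C * t\<^sup>2"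
      by (rule order_trans[OF a[OF s] mult_left_mono]) (use C in auto)
    have d: "\<bar>R s / (t * s)\<bar> \<le> C * t\<^sup>2"
    proof -
      have "\<bar>R s / (t * s)\<bar> \<le> (C * \<bar>s\<bar> ^ 3 * \<bar>s\<bar>) / (\<bar>t\<bar> * \<bar>s\<bar>)"
        unfolding abs_divide abs_mult[of t s] by (intro divide_right_mono R0) auto
      also have "\<dots> = C * (\<bar>s\<bar> ^ 3 / \<bar>t\<bar>)" using s by simp
      also have "\<bar>s\<bar> ^ 3 / \<bar>t\<bar> \<le> \<bar>t\<bar> ^ 3 / \<bar>t\<bar>" using st by (intro divide_right_mono power_mono) auto
      also have "\<bar>t\<bar> ^ 3 / \<bar>t\<bar> = t\<^sup>2" using t by (simp add: power3_eq_cube power2_eq_square)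
      finally show ?thesis using C by simp
    qed
    \<comment> \<open>\<open>R (t - s)\<close> and \<open>R t\<close> are estimated together: only
      their difference contains the factor \<open>s\<close> that cancels the one in the
      denominator.\<close>
    have e: "\<bar>(R (t - s) - R t) / (t * s)\<bar> \<le> 27 * C * t\<^sup>2"
    proof -
      have "\<bar>(R (t - s) - R t) / (t * s)\<bar> \<le> (C * (\<bar>t - s\<bar> + \<bar>t\<bar>) ^ 3 * \<bar>s\<bar>) / (\<bar>t\<bar> * \<bar>s\<bar>)"
        unfolding abs_divide abs_mult[of t s] using R[of "t - s" t] by (intro divide_right_mono) auto
      also have "\<dots> = C * ((\<bar>t - s\<bar> + \<bar>t\<bar>) ^ 3 / \<bar>t\<bar>)" using s by simp
      also have "(\<bar>t - s\<bar> + \<bar>t\<bar>) ^ 3 / \<bar>t\<bar> \<le> (3 * \<bar>t\<bar>) ^ 3 / \<bar>t\<bar>" using st by (intro divide_right_mono power_mono) auto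
      also have "(3 * \<bar>t\<bar>) ^ 3 / \<bar>t\<bar> = 27 * t\<^sup>2" using t by (simp add: power3_eq_cube power2_eq_square)
      finally show ?thesis using C by simp
    qed
    \<comment> \<open>The quadratic parts contribute \<open>- 2 * B - 2 * B + 4 * B = 0\<close>, so
      only remainders of order four survive; their constants add up to
      \<open>2 + 2 + 54 + 2 = 60\<close>.\<close>
    have "2 * (imq_profile c l \<beta> 0 - imq_profile c l \<beta> t) / t\<^sup>2
     + 2 * (imq_profile c l \<beta> 0 - imq_profile c l \<beta> s) / s\<^sup>2
     - 2 * (imq_profile c l \<beta> (t - s) - imq_profile c l \<beta> t - imq_profile c l \<beta> s + imq_profile c l \<beta> 0) / (t * s)
     = - 2 * (R t / t\<^sup>2) - 2 * (R s / s\<^sup>2) - 2 * ((R (t - s) - R t) / (t * s)) + 2 * (R s / (t * s))"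
      unfolding \<kappa>[of t] \<kappa>[of s] \<kappa>[of "t - s"] using s t by (simp add: field_simps power2_eq_square)
    also have "\<dots> \<le> 60 * C * t\<^sup>2" using a[OF t] b d e by linarith
    finally show "2 * (imq_profile c l \<beta> 0 - imq_profile c l \<beta> t) / t\<^sup>2
     + 2 * (imq_profile c l \<beta> 0 - imq_profile c l \<beta> s) / s\<^sup>2
     - 2 * (imq_profile c l \<beta> (t - s) - imq_profile c l \<beta> t - imq_profile c l \<beta> s + imq_profile c l \<beta> 0) / (t * s)
     \<le> 60 * C * t\<^sup>2" .
  qed (use C in auto)
qed

definition partial_deriv :: "'d \<Rightarrow> (real ^ 'd \<Rightarrow> real) \<Rightarrow> real ^ 'd \<Rightarrow> real" where
  "partial_deriv i f x = deriv (\<lambda>t. f (x + t *\<^sub>R axis i 1)) 0"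

lemma partial_deriv_eqI: "((\<lambda>t. f (x + t *\<^sub>R axis i 1)) has_real_derivative D) (at 0) \<Longrightarrow> partial_deriv i f x = D"
  unfolding partial_deriv_def by (rule DERIV_imp_deriv)

locale imq_rkhs = rkhs "imq_kernel c l \<beta> :: real ^ 'd \<Rightarrow> real ^ 'd \<Rightarrow> real" H ip
  for c l \<beta> :: real and H :: "(real ^ 'd \<Rightarrow> real) set"
    and ip :: "(real ^ 'd \<Rightarrow> real) \<Rightarrow> (real ^ 'd \<Rightarrow> real) \<Rightarrow> real" +
  assumes c_pos: "c > 0" and l_pos: "l > 0" and \<beta>: "- 1 < \<beta>" "\<beta> < 0"
begin

abbreviation \<kappa> where "\<kappa> \<equiv> imq_profile c l \<beta>"

definition rkhs_norm :: "(real ^ 'd \<Rightarrow> real) \<Rightarrow> real" where "rkhs_norm f = sqrt (ip f f)"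

lemma rkhs_norm_nonneg: "f \<in> H \<Longrightarrow> rkhs_norm f \<ge> 0"
  by (simp add: rkhs_norm_def ip_nonneg)

lemma le_rkhs_norm: assumes "f \<in> H" "a\<^sup>2 \<le> ip f f * b\<^sup>2" "b \<ge> 0" shows "\<bar>a\<bar> \<le> rkhs_norm f * b"
  using real_sqrt_le_mono[OF assms(2)] assms(3) by (simp add: real_sqrt_mult rkhs_norm_def)

text \<open>One constant serves all members. The last clause prescribes a rate for the difference
  quotients, uniform on balls of \<open>H\<close>; it gives the partial derivatives a common modulus
  of continuity, with which a supremum over the unit ball can be controlled.\<close>

definition regular_bound :: "real \<Rightarrow> bool" where
  "regular_bound K \<longleftrightarrow> K > 0 \<and> (\<forall>f\<in>H. (\<forall>x. \<bar>f x\<bar> \<le> K * rkhs_norm f) \<and>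
    (\<forall>x y. \<bar>f x - f y\<bar> \<le> K * rkhs_norm f * norm (x - y)) \<and>
    (\<forall>x i. ((\<lambda>t. f (x + t *\<^sub>R axis i 1)) has_real_derivative partial_deriv i f x) (at 0)) \<and>
    (\<forall>x i t. t \<noteq> 0 \<longrightarrow> \<bar>(f (x + t *\<^sub>R axis i 1) - f x) / t - partial_deriv i f x\<bar> \<le> K * rkhs_norm f * \<bar>t\<bar>))"

text \<open>Values, increments and differences of difference quotients are combinations of at most
  four point evaluations, so \<open>sum_list_bound\<close> reduces each claim to an estimate of the
  kernel profile.\<close>

lemma regular_bound_exists: "\<exists>K. regular_bound K"
proof -
  obtain C B where C: "C > 0" and CB:
    "\<And>t s. \<bar>\<kappa> t - \<kappa> s\<bar> \<le> C * (\<bar>t\<bar> + \<bar>s\<bar>) * \<bar>t - s\<bar>"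
    using imq_profile_expansion[OF c_pos l_pos \<beta>(2)] by metis
  obtain K1 where K1: "K1 \<ge> 0" and quot: "\<And>s t. s \<noteq> 0 \<Longrightarrow> \<bar>s\<bar> \<le> \<bar>t\<bar> \<Longrightarrow>
     2 * (\<kappa> 0 - \<kappa> t) / t\<^sup>2 + 2 * (\<kappa> 0 - \<kappa> s) / s\<^sup>2 - 2 * (\<kappa> (t - s) - \<kappa> t - \<kappa> s + \<kappa> 0) / (t * s) \<le> K1 * t\<^sup>2"
    using imq_profile_quotient_bound[OF c_pos l_pos \<beta>(2)] by metis
  have \<kappa>0: "\<kappa> 0 \<ge> 0" by (simp add: imq_profile_def)
  define K where "K = sqrt (\<kappa> 0) + sqrt (2 * C) + sqrt K1 + 1"
  have Kpos: "K > 0" using \<kappa>0 C K1 by (simp add: K_def add_nonneg_pos)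
  have Kge: "sqrt (\<kappa> 0) \<le> K" "sqrt (2 * C) \<le> K" "sqrt K1 \<le> K"
    using \<kappa>0 C K1 by (auto simp: K_def)
  note ker = imq_kernel_eq_profile[OF l_pos]
  have bound: "\<bar>f x\<bar> \<le> K * rkhs_norm f" if f: "f \<in> H" for f x
  proof -
    have "\<bar>f x\<bar> \<le> rkhs_norm f * sqrt (\<kappa> 0)"
      by (rule le_rkhs_norm[OF f]) (use eval_bound[OF f, of x] \<kappa>0 in \<open>simp_all add: ker\<close>)
    also have "\<dots> \<le> rkhs_norm f * K" using Kge rkhs_norm_nonneg[OF f] by (intro mult_left_mono)
    finally show ?thesis by (simp add: mult.commute)
  qed
  have lip: "\<bar>f x - f y\<bar> \<le> K * rkhs_norm f * norm (x - y)" if f: "f \<in> H" for f x y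
  proof -
    have "(f x - f y)\<^sup>2 \<le> ip f f * (2 * (\<kappa> 0 - \<kappa> (norm (x - y))))"
      using sum_list_bound[OF f, of "[(x, 1), (y, -1)]"] by (simp add: ker norm_minus_commute[of y x] algebra_simps)
    also have "\<dots> \<le> ip f f * (sqrt (2 * C) * norm (x - y))\<^sup>2"
    proof (intro mult_left_mono ip_nonneg f)
      have "\<kappa> 0 - \<kappa> (norm (x - y)) \<le> C * norm (x - y) * norm (x - y)"
        using CB[of 0 "norm (x - y)"] by simp
      then show "2 * (\<kappa> 0 - \<kappa> (norm (x - y))) \<le> (sqrt (2 * C) * norm (x - y))\<^sup>2"
        using C by (simp add: power_mult_distrib) (simp add: power2_eq_square)
    qed
    finally have "\<bar>f x - f y\<bar> \<le> rkhs_norm f * (sqrt (2 * C) * norm (x - y))"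
      using C by (intro le_rkhs_norm[OF f]) auto
    also have "\<dots> \<le> rkhs_norm f * (K * norm (x - y))"
      using Kge rkhs_norm_nonneg[OF f] by (intro mult_left_mono mult_right_mono) auto
    finally show ?thesis by (simp add: mult_ac)
  qed
  have *: "\<exists>D. ((\<lambda>t. f (x + t *\<^sub>R axis i 1)) has_real_derivative D) (at 0) \<and>
      (\<forall>t. t \<noteq> 0 \<longrightarrow> \<bar>(f (x + t *\<^sub>R axis i 1) - f x) / t - D\<bar> \<le> K * rkhs_norm f * \<bar>t\<bar>)"
    if f: "f \<in> H" for f x i
  proof -
    define e where "e = (axis i 1 :: real ^ 'd)"
    have e: "norm e = 1" by (simp add: e_def norm_axis_1)
    define q where "q t = (f (x + t *\<^sub>R e) - f x) / t" for t
    have kxe: "imq_kernel c l \<beta> (x + t *\<^sub>R e) (x + s *\<^sub>R e) = \<kappa> (t - s)"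
      "imq_kernel c l \<beta> x (x + s *\<^sub>R e) = \<kappa> s"
      "imq_kernel c l \<beta> (x + s *\<^sub>R e) x = \<kappa> s" "imq_kernel c l \<beta> x x = \<kappa> 0" for s t
    proof -
      have "(x + t *\<^sub>R e) - (x + s *\<^sub>R e) = (t - s) *\<^sub>R e" by (simp add: algebra_simps)
      then show "imq_kernel c l \<beta> (x + t *\<^sub>R e) (x + s *\<^sub>R e) = \<kappa> (t - s)"
        by (simp add: ker e imq_profile_abs)
    qed (simp_all add: ker e imq_profile_abs)
    have qq: "\<bar>q t - q s\<bar> \<le> K * rkhs_norm f * \<bar>t\<bar>" if s: "s \<noteq> 0" and st: "\<bar>s\<bar> \<le> \<bar>t\<bar>" for s t
    proof -
      have t: "t \<noteq> 0" using s st by auto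
      define E where "E = 2 * (\<kappa> 0 - \<kappa> t) / t\<^sup>2 + 2 * (\<kappa> 0 - \<kappa> s) / s\<^sup>2 - 2 * (\<kappa> (t - s) - \<kappa> t - \<kappa> s + \<kappa> 0) / (t * s)"
      let ?xs = "[(x + t *\<^sub>R e, 1 / t), (x, - (1 / t)), (x + s *\<^sub>R e, - (1 / s)), (x, 1 / s)]"
      have 1: "(\<Sum>(y, a)\<leftarrow>?xs. a * f y) = q t - q s" by (simp add: q_def diff_divide_distrib)
      have ev: "\<kappa> (s - t) = \<kappa> (t - s)" using imq_profile_even[of c l \<beta> "t - s"] by simp
      have "(\<Sum>(y, a)\<leftarrow>?xs. a * (\<Sum>(z, b)\<leftarrow>?xs. b * imq_kernel c l \<beta> y z)) = E"
        by (simp add: kxe ev E_def) (use s t in \<open>simp add: field_simps power2_eq_square\<close>)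
      then have "(q t - q s)\<^sup>2 \<le> ip f f * E" using sum_list_bound[OF f, of ?xs] unfolding 1 by simp
      also have "\<dots> \<le> ip f f * (sqrt K1 * \<bar>t\<bar>)\<^sup>2"
        using quot[OF s st] K1 by (intro mult_left_mono ip_nonneg f) (simp add: E_def power_mult_distrib)
      finally have "\<bar>q t - q s\<bar> \<le> rkhs_norm f * (sqrt K1 * \<bar>t\<bar>)"
        using K1 by (intro le_rkhs_norm[OF f]) auto
      also have "\<dots> \<le> rkhs_norm f * (K * \<bar>t\<bar>)"
        using Kge rkhs_norm_nonneg[OF f] by (intro mult_left_mono mult_right_mono) auto
      finally show ?thesis by (simp add: mult_ac)
    qed
    define L where "L = K * rkhs_norm f"
    have L: "L \<ge> 0" using Kpos rkhs_norm_nonneg[OF f] by (simp add: L_def)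
    define r where "r n = 1 / real (Suc n)" for n
    have r: "r n > 0" for n by (simp add: r_def)
    have rlim: "r \<longlonglongrightarrow> 0" unfolding r_def[abs_def] using LIMSEQ_inverse_real_of_nat by (simp add: inverse_eq_divide)
    \<comment> \<open>By \<open>qq\<close> the quotients form a Cauchy family as the step shrinks.
      One sequence of steps produces the limit \<open>D\<close>, and letting \<open>s\<close> run
      through it in \<open>qq\<close> yields the rate for every \<open>t\<close>.\<close>
    have "Cauchy (\<lambda>n. q (r n))"
    proof (rule metric_CauchyI)
      fix \<epsilon> :: real assume eps: "\<epsilon> > 0"
      have "(\<lambda>n. L * r n) \<longlonglongrightarrow> 0" using tendsto_mult_right_zero[OF rlim] .
      then have "\<forall>\<^sub>F n in sequentially. L * r n < \<epsilon>" using eps by (rule order_tendstoD)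
      then obtain M where M: "\<And>n. n \<ge> M \<Longrightarrow> L * r n < \<epsilon>" by (auto simp: eventually_sequentially)
      have *: "dist (q (r m)) (q (r n)) < \<epsilon>" if "m \<ge> M" "n \<ge> m" for m n
      proof -
        have "r n \<le> r m" using that by (simp add: r_def frac_le)
        then have "\<bar>q (r m) - q (r n)\<bar> \<le> L * \<bar>r m\<bar>" unfolding L_def using r[of n] by (intro qq) auto
        then show ?thesis using M[OF that(1)] r[of m] by (simp add: dist_real_def)
      qed
      show "\<exists>M. \<forall>m\<ge>M. \<forall>n\<ge>M. dist (q (r m)) (q (r n)) < \<epsilon>"
        by (rule exI[of _ M]) (metis * dist_commute nle_le)
    qed
    then obtain D where D: "(\<lambda>n. q (r n)) \<longlonglongrightarrow> D" using real_Cauchy_convergent convergentD by blast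
    have qD: "\<bar>q t - D\<bar> \<le> L * \<bar>t\<bar>" if t: "t \<noteq> 0" for t
    proof (rule LIMSEQ_le_const2)
      show "(\<lambda>n. \<bar>q t - q (r n)\<bar>) \<longlonglongrightarrow> \<bar>q t - D\<bar>" by (intro tendsto_intros D)
      have "\<forall>\<^sub>F n in sequentially. r n < \<bar>t\<bar>" using t by (intro order_tendstoD[OF rlim]) auto
      then obtain M where M: "\<And>n. n \<ge> M \<Longrightarrow> r n < \<bar>t\<bar>" by (auto simp: eventually_sequentially)
      show "\<exists>M. \<forall>n\<ge>M. \<bar>q t - q (r n)\<bar> \<le> L * \<bar>t\<bar>"
      proof (intro exI allI impI)
        fix n assume "M \<le> n"
        from M[OF this] r[of n] show "\<bar>q t - q (r n)\<bar> \<le> L * \<bar>t\<bar>" unfolding L_def by (intro qq) auto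
      qed
    qed
    have "(q \<longlongrightarrow> D) (at 0)"
    proof -
      have "((\<lambda>t. q t - D) \<longlongrightarrow> 0) (at 0)"
      proof (rule Lim_null_comparison)
        show "\<forall>\<^sub>F t in at 0. norm (q t - D) \<le> L * \<bar>t\<bar>" using qD by (auto simp: eventually_at_filter)
        show "((\<lambda>t. L * \<bar>t\<bar>) \<longlongrightarrow> 0) (at 0)" by (intro tendsto_mult_right_zero tendsto_rabs_zero tendsto_ident_at)
      qed
      then show ?thesis by (simp add: LIM_zero_iff)
    qed
    then have "((\<lambda>t. f (x + t *\<^sub>R e)) has_real_derivative D) (at 0)"
      unfolding DERIV_def q_def by simp
    then show ?thesis using qD unfolding q_def L_def e_def by blast
  qed
  have pdD: "((\<lambda>t. f (x + t *\<^sub>R axis i 1)) has_real_derivative partial_deriv i f x) (at 0)"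
    "\<And>t. t \<noteq> 0 \<Longrightarrow> \<bar>(f (x + t *\<^sub>R axis i 1) - f x) / t - partial_deriv i f x\<bar> \<le> K * rkhs_norm f * \<bar>t\<bar>"
    if f: "f \<in> H" for f x i
    using *[OF f, of x i] partial_deriv_eqI by metis+
  show ?thesis unfolding regular_bound_def using Kpos bound lip pdD by blast
qed

end

section \<open>Translation invariance of Lebesgue measure\<close>

lemma integrable_lborel_shift:
  fixes f :: "'a::euclidean_space \<Rightarrow> 'b::{banach, second_countable_topology}"
  assumes "integrable lborel f"
  shows "integrable lborel (\<lambda>x. f (x + t))"
proof -
  have "integrable (distr lborel borel ((+) t)) f" using assms by (simp add: lborel_distr_plus)
  from integrable_distr[OF _ this] show ?thesis by (simp add: add.commute)
qed

lemma integral_lborel_shift: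
  fixes f :: "'a::euclidean_space \<Rightarrow> 'b::{banach, second_countable_topology}"
  assumes [measurable]: "f \<in> borel_measurable borel"
  shows "(\<integral>x. f (x + t) \<partial>lborel) = (\<integral>x. f x \<partial>lborel)"
proof -
  have "(\<integral>x. f x \<partial>lborel) = (\<integral>x. f x \<partial>distr lborel borel ((+) t))" by (simp add: lborel_distr_plus)
  also have "\<dots> = (\<integral>x. f (t + x) \<partial>lborel)" by (subst integral_distr) auto
  finally show ?thesis by (simp add: add.commute)
qed

lemma lborel_distr_uminus_euclidean:
  "distr lborel borel (uminus :: 'a \<Rightarrow> 'a) = (lborel :: 'a::euclidean_space measure)"
  by (subst lborel_affine[of "-1" 0]) (simp_all add: density_1)

lemma integral_lborel_reflect:
  fixes f :: "'a::euclidean_space \<Rightarrow> 'b::{banach, second_countable_topology}"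
  assumes [measurable]: "f \<in> borel_measurable borel"
  shows "(\<integral>x. f (t - x) \<partial>lborel) = (\<integral>x. f x \<partial>lborel)"
proof -
  have "(\<integral>x. f x \<partial>lborel) = (\<integral>x. f (x + t) \<partial>distr lborel borel uminus)"
    by (simp add: lborel_distr_uminus_euclidean integral_lborel_shift)
  also have "\<dots> = (\<integral>x. f (t - x) \<partial>lborel)" by (subst integral_distr) auto
  finally show ?thesis by simp
qed

section \<open>Gaussian integrals\<close>

text \<open>For positive \<open>s\<close> this is \<open>(pi / s) powr (d / 2)\<close> in dimension
  \<open>d\<close>; positivity, monotonicity and the effect of doubling \<open>s\<close> are the
  properties that enter. The \<open>itself\<close> argument fixes the space, which the value does
  not mention.\<close>

definition gauss_mass :: "'a::euclidean_space itself \<Rightarrow> real \<Rightarrow> real" where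
  "gauss_mass _ s = (\<integral>z. exp (- s * (norm (z::'a))\<^sup>2) \<partial>lborel)"

lemma integrable_gauss_real:
  assumes "s > 0"
  shows "integrable lborel (\<lambda>x::real. exp (- s * x\<^sup>2))"
proof -
  have "integrable lborel (\<lambda>x. sqrt (2 * pi * (sqrt (1 / (2 * s)))\<^sup>2) * normal_density 0 (sqrt (1 / (2 * s))) x)"
    using assms by (intro integrable_mult_right integrable_normal_density) auto
  also have "(\<lambda>x. sqrt (2 * pi * (sqrt (1 / (2 * s)))\<^sup>2) * normal_density 0 (sqrt (1 / (2 * s))) x)
     = (\<lambda>x. exp (- s * x\<^sup>2))"
    using assms by (auto simp: normal_density_def fun_eq_iff field_simps real_sqrt_mult real_sqrt_divide)
  finally show ?thesis .
qed

lemma integrable_gauss: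
  assumes "s > 0"
  shows "integrable lborel (\<lambda>x::'a::euclidean_space. exp (- s * (norm (x - y))\<^sup>2))"
proof -
  have "integrable lborel (\<lambda>x::'a. exp (- s * (norm x)\<^sup>2))"
  proof (rule integrableI_nonneg)
    have "(\<integral>\<^sup>+ x. ennreal (exp (- s * (norm (x::'a))\<^sup>2)) \<partial>lborel) =
        (\<integral>\<^sup>+ x. (\<Prod>b\<in>Basis. ennreal (exp (- s * (x \<bullet> b)\<^sup>2))) \<partial>(lborel :: 'a measure))"
    proof (intro nn_integral_cong)
      fix x :: 'a
      have "(norm x)\<^sup>2 = (\<Sum>b\<in>Basis. (x \<bullet> b)\<^sup>2)"
        unfolding power2_norm_eq_inner by (subst euclidean_inner) (simp add: power2_eq_square)
      then show "ennreal (exp (- s * (norm x)\<^sup>2)) = (\<Prod>b\<in>Basis. ennreal (exp (- s * (x \<bullet> b)\<^sup>2)))"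
        by (simp add: prod_ennreal exp_sum[symmetric] sum_distrib_left sum_negf)
    qed
    also have "\<dots> = (\<Prod>b\<in>(Basis::'a set). (\<integral>\<^sup>+ x. ennreal (exp (- s * x\<^sup>2)) \<partial>lborel))"
      by (subst nn_integral_lborel_prod) auto
    also have "\<dots> < \<infinity>"
    proof -
      have "(\<integral>\<^sup>+ x. ennreal (exp (- s * x\<^sup>2)) \<partial>(lborel::real measure)) < \<infinity>"
        using integrable_gauss_real[OF assms] by (subst (asm) integrable_iff_bounded) auto
      then show ?thesis by (simp add: power_less_top_ennreal)
    qed
    finally show "(\<integral>\<^sup>+ x. ennreal (exp (- s * (norm (x::'a))\<^sup>2)) \<partial>lborel) < \<infinity>" .
  qed auto
  from integrable_lborel_shift[OF this, of "- y"] show ?thesis by simp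
qed

lemma integral_gauss:
  "(\<integral>x. exp (- s * (norm (x - y :: 'a::euclidean_space))\<^sup>2) \<partial>lborel) = gauss_mass TYPE('a) s"
  using integral_lborel_shift[of "\<lambda>x::'a. exp (- s * (norm x)\<^sup>2)" "- y"] by (simp add: gauss_mass_def)

lemma gauss_mass_pos:
  assumes "s > 0"
  shows "gauss_mass TYPE('a::euclidean_space) s > 0"
proof -
  have "gauss_mass TYPE('a) s \<noteq> 0"
  proof
    assume "gauss_mass TYPE('a) s = 0"
    then have "AE x in lborel. exp (- s * (norm (x::'a))\<^sup>2) = 0"
      using integral_nonneg_eq_0_iff_AE[OF integrable_gauss[OF assms, of "0::'a"]]
      by (simp add: gauss_mass_def)
    then show False using ae_filter_eq_bot_iff[of "lborel :: 'a measure"]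
      by (simp add: trivial_limit_def[symmetric] eventually_False)
  qed
  moreover have "gauss_mass TYPE('a) s \<ge> 0" by (simp add: gauss_mass_def)
  ultimately show ?thesis by simp
qed

text \<open>Moment bounds absorb a polynomial factor by giving up half of the precision; this rule,
  from the substitution \<open>z = sqrt 2 *\<^sub>R x\<close>, turns the resulting mass back into
  the one at the original precision.\<close>

lemma gauss_mass_half:
  "gauss_mass TYPE('a::euclidean_space) s = sqrt 2 ^ DIM('a) * gauss_mass TYPE('a) (2 * s)"
proof -
  have "gauss_mass TYPE('a) s = (\<integral>z. exp (- s * (norm (z::'a))\<^sup>2)
      \<partial>density (distr lborel borel (\<lambda>x. 0 + sqrt 2 *\<^sub>R x)) (\<lambda>_. \<bar>sqrt 2\<bar> ^ DIM('a)))"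
    unfolding gauss_mass_def using lborel_affine[of "sqrt 2" "0::'a"] by simp
  also have "\<dots> = (\<integral>z. sqrt 2 ^ DIM('a) * exp (- (2 * s) * (norm (z::'a))\<^sup>2) \<partial>lborel)"
    by (subst integral_density)
       (simp_all add: integral_distr power_mult_distrib algebra_simps)
  finally show ?thesis by (simp add: gauss_mass_def)
qed

lemma measurable_gauss_mass [measurable]: "gauss_mass TYPE('a::euclidean_space) \<in> borel_measurable borel"
proof -
  have "(\<lambda>s. \<integral>z. exp (- s * (norm (z::'a))\<^sup>2) \<partial>lborel) \<in> borel_measurable borel"
    by measurable
  then show ?thesis by (simp add: gauss_mass_def[abs_def])
qed

lemma midpoint_identity:
  fixes x y z :: "'a::real_inner"
  shows "2 * (norm (x - z))\<^sup>2 + 2 * (norm (y - z))\<^sup>2 = 4 * (norm (z - (x + y) /\<^sub>R 2))\<^sup>2 + (norm (x - y))\<^sup>2"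
  unfolding power2_norm_eq_inner
  by (simp add: inner_diff_left inner_diff_right inner_add_left inner_add_right inner_commute algebra_simps)

text \<open>Completing the square in \<open>z\<close>. The factor without \<open>z\<close> has
  precision \<open>s\<close>, which is why a kernel of precision \<open>s\<close> is built from
  features of precision \<open>2 * s\<close>, normalised by \<open>gauss_mass\<close> at
  \<open>4 * s\<close>.\<close>

lemma gauss_mult:
  fixes x y z :: "'a::real_inner"
  shows "exp (- (2 * s) * (norm (x - z))\<^sup>2) * exp (- (2 * s) * (norm (y - z))\<^sup>2) =
    exp (- s * (norm (x - y))\<^sup>2) * exp (- (4 * s) * (norm (z - (x + y) /\<^sub>R 2))\<^sup>2)"
proof -
  have "- (2 * s) * (norm (x - z))\<^sup>2 + - (2 * s) * (norm (y - z))\<^sup>2 =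
    - s * (2 * (norm (x - z))\<^sup>2 + 2 * (norm (y - z))\<^sup>2)" by (simp add: algebra_simps)
  also have "\<dots> = - s * (norm (x - y))\<^sup>2 + - (4 * s) * (norm (z - (x + y) /\<^sub>R 2))\<^sup>2"
    unfolding midpoint_identity by (simp add: algebra_simps)
  finally show ?thesis by (simp add: exp_add[symmetric])
qed

lemma gauss_convolution:
  fixes x y :: "'a::euclidean_space"
  assumes "s > 0"
  shows "integrable lborel (\<lambda>z. exp (- (2 * s) * (norm (x - z))\<^sup>2) * exp (- (2 * s) * (norm (y - z))\<^sup>2))"
    "(\<integral>z. exp (- (2 * s) * (norm (x - z))\<^sup>2) * exp (- (2 * s) * (norm (y - z))\<^sup>2) \<partial>lborel) =
      exp (- s * (norm (x - y))\<^sup>2) * gauss_mass TYPE('a) (4 * s)"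
proof -
  show "integrable lborel (\<lambda>z. exp (- (2 * s) * (norm (x - z))\<^sup>2) * exp (- (2 * s) * (norm (y - z))\<^sup>2))"
    unfolding gauss_mult using integrable_gauss[of "4 * s"] assms by (intro integrable_mult_right) simp
  show "(\<integral>z. exp (- (2 * s) * (norm (x - z))\<^sup>2) * exp (- (2 * s) * (norm (y - z))\<^sup>2) \<partial>lborel) =
      exp (- s * (norm (x - y))\<^sup>2) * gauss_mass TYPE('a) (4 * s)"
    unfolding gauss_mult integral_mult_right_zero integral_gauss ..
qed

lemma norm_gauss_le:
  assumes "s > 0"
  shows "norm (w::'a::real_normed_vector) * exp (- (2 * s) * (norm w)\<^sup>2) \<le> exp (- s * (norm w)\<^sup>2) / sqrt s"
proof -
  define u where "u = sqrt s * norm w"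
  have u2: "u\<^sup>2 = s * (norm w)\<^sup>2" using assms by (simp add: u_def power_mult_distrib)
  have "u \<le> 1 + u\<^sup>2" using sum_power2_ge_zero[of "u - 1/2" 0] by (simp add: power2_eq_square algebra_simps)
  also have "\<dots> \<le> exp (u\<^sup>2)" by (rule exp_ge_add_one_self)
  finally have "u * exp (- u\<^sup>2) \<le> 1" by (simp add: exp_minus field_simps)
  then have "sqrt s * norm w * exp (- s * (norm w)\<^sup>2) \<le> 1" using u2 by (simp add: u_def)
  then have "norm w * exp (- s * (norm w)\<^sup>2) \<le> 1 / sqrt s" using assms by (simp add: field_simps)
  then have "norm w * exp (- s * (norm w)\<^sup>2) * exp (- s * (norm w)\<^sup>2) \<le> 1 / sqrt s * exp (- s * (norm w)\<^sup>2)"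
    by (intro mult_right_mono) auto
  then show ?thesis by (simp add: exp_add[symmetric] mult.assoc)
qed

text \<open>The factor \<open>1 / sqrt s\<close> makes mollifiers of high precision concentrate at
  the origin.\<close>

lemma gauss_first_moment:
  assumes "s > 0"
  shows "integrable lborel (\<lambda>w::'a::euclidean_space. norm w * exp (- (2 * s) * (norm w)\<^sup>2))"
    "(\<integral>w. norm (w::'a) * exp (- (2 * s) * (norm w)\<^sup>2) \<partial>lborel) \<le>
      sqrt 2 ^ DIM('a) * gauss_mass TYPE('a) (2 * s) / sqrt s"
proof -
  have i: "integrable lborel (\<lambda>w::'a. exp (- s * (norm w)\<^sup>2) / sqrt s)"
    using integrable_gauss[OF assms, of "0::'a"] by simp
  show 1: "integrable lborel (\<lambda>w::'a. norm w * exp (- (2 * s) * (norm w)\<^sup>2))"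
    by (rule Bochner_Integration.integrable_bound[OF i])
       (use norm_gauss_le[OF assms] assms in \<open>auto intro!: AE_I2\<close>)
  have "(\<integral>w. norm (w::'a) * exp (- (2 * s) * (norm w)\<^sup>2) \<partial>lborel) \<le> (\<integral>w. exp (- s * (norm (w::'a))\<^sup>2) / sqrt s \<partial>lborel)"
    by (rule integral_mono[OF 1 i]) (rule norm_gauss_le[OF assms])
  also have "\<dots> = gauss_mass TYPE('a) s / sqrt s" by (simp add: gauss_mass_def)
  finally show "(\<integral>w. norm (w::'a) * exp (- (2 * s) * (norm w)\<^sup>2) \<partial>lborel) \<le>
      sqrt 2 ^ DIM('a) * gauss_mass TYPE('a) (2 * s) / sqrt s" by (simp add: gauss_mass_half[of s])
qed

text \<open>Serves to bound the squared coefficient function in \<open>radial_mem\<close>, which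
  carries a linear factor.\<close>

lemma gauss_second_moment:
  assumes "s > 0"
  shows "(\<integral>\<^sup>+z. ennreal ((norm (z::'a::euclidean_space))\<^sup>2 * exp (- (4 * s) * (norm z)\<^sup>2)) \<partial>lborel) \<le>
      ennreal (sqrt 2 ^ DIM('a) * gauss_mass TYPE('a) (4 * s) / (2 * s))"
proof -
  have "(norm z)\<^sup>2 * exp (- (4 * s) * (norm z)\<^sup>2) \<le> exp (- (2 * s) * (norm z)\<^sup>2) / (2 * s)" for z :: 'a
  proof -
    define u where "u = 2 * s * (norm z)\<^sup>2"
    have "u \<le> exp u" using exp_ge_add_one_self[of u] by linarith
    then have "u * exp (- u) \<le> 1" by (simp add: exp_minus field_simps)
    then have "u * exp (- u) * exp (- u) \<le> 1 * exp (- u)" by (intro mult_right_mono) auto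
    then have "u * exp (- (4 * s) * (norm z)\<^sup>2) \<le> exp (- (2 * s) * (norm z)\<^sup>2)"
      by (simp add: exp_add[symmetric] mult.assoc u_def)
    then show ?thesis using assms by (simp add: u_def field_simps)
  qed
  then have "(\<integral>\<^sup>+z. ennreal ((norm (z::'a))\<^sup>2 * exp (- (4 * s) * (norm z)\<^sup>2)) \<partial>lborel) \<le>
      (\<integral>\<^sup>+z. ennreal (exp (- (2 * s) * (norm (z::'a))\<^sup>2) / (2 * s)) \<partial>lborel)"
    by (intro nn_integral_mono ennreal_leI)
  also have "\<dots> = ennreal (\<integral>z. exp (- (2 * s) * (norm (z::'a))\<^sup>2) / (2 * s) \<partial>lborel)"
    using integrable_gauss[of "2 * s" "0::'a"] assms by (intro nn_integral_eq_integral) auto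
  also have "(\<integral>z. exp (- (2 * s) * (norm (z::'a))\<^sup>2) / (2 * s) \<partial>lborel) = gauss_mass TYPE('a) (2 * s) / (2 * s)"
    by (simp add: gauss_mass_def)
  finally show ?thesis using gauss_mass_half[of "2 * s", where ?'a = 'a] by (simp add: mult.assoc)
qed

text \<open>The product is centred at \<open>x /\<^sub>R 2\<close>; after shifting there, the odd
  part integrates to zero and the centre remains. This creates the coordinate \<open>x $ i\<close>
  in the fields used for tightness.\<close>

lemma gauss_odd_moment:
  fixes x b :: "'a::euclidean_space"
  assumes "s > 0"
  shows "(\<integral>z. (z \<bullet> b) * (exp (- (2 * s) * (norm (x - z))\<^sup>2) * exp (- (2 * s) * (norm z)\<^sup>2)) \<partial>lborel) =
      (x \<bullet> b) / 2 * (exp (- s * (norm x)\<^sup>2) * gauss_mass TYPE('a) (4 * s))"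
proof -
  define G where "G = (\<lambda>z::'a. exp (- (4 * s) * (norm z)\<^sup>2))"
  have Gi: "integrable lborel G" using integrable_gauss[of "4 * s" "0::'a"] assms by (simp add: G_def)
  have [measurable]: "G \<in> borel_measurable borel" by (simp add: G_def)
  have Gb: "integrable lborel (\<lambda>z. (z \<bullet> b) * G z)"
  proof (rule Bochner_Integration.integrable_bound[OF integrable_mult_right[OF gauss_first_moment(1)[of "2 * s", where ?'a='a], of "norm b"]])
    show "AE z in lborel. norm ((z \<bullet> b) * G z) \<le> norm (norm b * (norm z * exp (- (2 * (2 * s)) * (norm z)\<^sup>2)))"
      using Cauchy_Schwarz_ineq2[of _ b]
      by (intro AE_I2) (auto simp: G_def abs_mult mult.assoc[symmetric] mult.commute[of "norm b"] intro!: mult_right_mono)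
  qed (use assms in auto)
  have odd: "(\<integral>z. (z \<bullet> b) * G z \<partial>lborel) = 0"
    using integral_lborel_reflect[of "\<lambda>z. (z \<bullet> b) * G z" 0] by (simp add: G_def)
  have "(\<integral>z. (z \<bullet> b) * (exp (- (2 * s) * (norm (x - z))\<^sup>2) * exp (- (2 * s) * (norm (0 - z))\<^sup>2)) \<partial>lborel) =
    (\<integral>z. exp (- s * (norm x)\<^sup>2) * ((z \<bullet> b) * G (z - x /\<^sub>R 2)) \<partial>lborel)"
    unfolding gauss_mult by (simp add: G_def mult_ac)
  also have "\<dots> = exp (- s * (norm x)\<^sup>2) * (\<integral>z. (z \<bullet> b) * G (z - x /\<^sub>R 2) \<partial>lborel)"
    by simp
  also have "(\<integral>z. (z \<bullet> b) * G (z - x /\<^sub>R 2) \<partial>lborel) = (\<integral>z. ((z + x /\<^sub>R 2) \<bullet> b) * G z \<partial>lborel)"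
    using integral_lborel_shift[of "\<lambda>z. (z \<bullet> b) * G (z - x /\<^sub>R 2)" "x /\<^sub>R 2"] by simp
  also have "\<dots> = (\<integral>z. (z \<bullet> b) * G z + (x \<bullet> b) / 2 * G z \<partial>lborel)"
    by (simp add: inner_add_left algebra_simps)
  also have "\<dots> = (x \<bullet> b) / 2 * gauss_mass TYPE('a) (4 * s)"
    using Gb Gi odd by (subst Bochner_Integration.integral_add) (auto simp: gauss_mass_def G_def)
  finally show ?thesis by (simp add: mult_ac)
qed

section \<open>Cauchy-Schwarz and membership through feature maps\<close>

lemma Cauchy_Schwarz_integral:
  fixes f g :: "'w \<Rightarrow> real"
  assumes [measurable]: "f \<in> borel_measurable M" "g \<in> borel_measurable M"
    and f2: "integrable M (\<lambda>w. (f w)\<^sup>2)" and g2: "integrable M (\<lambda>w. (g w)\<^sup>2)"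
  shows "integrable M (\<lambda>w. f w * g w)"
    "(\<integral>w. f w * g w \<partial>M)\<^sup>2 \<le> (\<integral>w. (f w)\<^sup>2 \<partial>M) * (\<integral>w. (g w)\<^sup>2 \<partial>M)"
proof -
  have le: "\<bar>f w * g w\<bar> \<le> (f w)\<^sup>2 + (g w)\<^sup>2" for w
  proof -
    have "2 * \<bar>f w * g w\<bar> \<le> (f w)\<^sup>2 + (g w)\<^sup>2"
      using sum_squares_bound[of "\<bar>f w\<bar>" "\<bar>g w\<bar>"] by (simp add: abs_mult mult.assoc)
    then show ?thesis using abs_ge_zero[of "f w * g w"] by linarith
  qed
  show fg: "integrable M (\<lambda>w. f w * g w)"
    by (rule Bochner_Integration.integrable_bound[OF Bochner_Integration.integrable_add[OF f2 g2]])
       (use le in auto)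
  define A B C where "A = (\<integral>w. (f w)\<^sup>2 \<partial>M)" and "B = (\<integral>w. f w * g w \<partial>M)" and "C = (\<integral>w. (g w)\<^sup>2 \<partial>M)"
  have quad: "0 \<le> a\<^sup>2 * A + 2 * a * b * B + b\<^sup>2 * C" for a b
  proof -
    have "0 \<le> (\<integral>w. (a * f w + b * g w)\<^sup>2 \<partial>M)" by simp
    also have "\<dots> = (\<integral>w. a\<^sup>2 * (f w)\<^sup>2 + 2 * a * b * (f w * g w) + b\<^sup>2 * (g w)\<^sup>2 \<partial>M)"
      by (intro Bochner_Integration.integral_cong refl) (simp add: power2_eq_square algebra_simps)
    also have "\<dots> = a\<^sup>2 * A + 2 * a * b * B + b\<^sup>2 * C"
      using f2 g2 fg by (simp add: A_def B_def C_def)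
    finally show ?thesis .
  qed
  have "B\<^sup>2 \<le> A * C"
  proof (cases "C = 0")
    case True
    have "B = 0"
    proof (rule ccontr)
      assume B: "B \<noteq> 0"
      \<comment> \<open>With \<open>C = 0\<close> the form is affine in \<open>b\<close>, and this
        choice of \<open>b\<close> gives it the value -1.\<close>
      have "0 \<le> A + 2 * (- (A + 1) / (2 * B)) * B" using quad[of 1 "- (A + 1) / (2 * B)"] True by simp
      also have "\<dots> = - 1" using B by (simp add: field_simps)
      finally show False by simp
    qed
    with True show ?thesis by simp
  next
    case False
    then have "C > 0" using quad[of 0 1] by simp
    moreover have "0 \<le> C * (A * C - B\<^sup>2)" using quad[of C "- B"] by (simp add: power2_eq_square algebra_simps)
    ultimately show ?thesis by (simp add: zero_le_mult_iff)
  qed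
  then show "(\<integral>w. f w * g w \<partial>M)\<^sup>2 \<le> (\<integral>w. (f w)\<^sup>2 \<partial>M) * (\<integral>w. (g w)\<^sup>2 \<partial>M)" by (simp add: A_def B_def C_def)
qed

text \<open>If the kernel is the Gram matrix of features in \<open>L\<^sup>2\<close>, integration
  against a square-integrable \<open>g\<close> lands in \<open>H\<close>: the quadratic form of the
  kernel is the squared norm of \<open>\<Psi> xs\<close>, so Cauchy-Schwarz supplies the bound
  demanded by \<open>mem_of_bound\<close>, with the norm of \<open>g\<close> as constant.\<close>

lemma (in rkhs) mem_of_feature_map:
  assumes \<Phi>[measurable]: "\<And>x. \<Phi> x \<in> borel_measurable M"
    and k: "\<And>x y. has_bochner_integral M (\<lambda>w. \<Phi> x w * \<Phi> y w) (k x y)"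
    and g[measurable]: "g \<in> borel_measurable M" and g2: "integrable M (\<lambda>w. (g w)\<^sup>2)"
  shows "integrable M (\<lambda>w. g w * \<Phi> x w)" "(\<lambda>x. \<integral>w. g w * \<Phi> x w \<partial>M) \<in> H"
proof -
  define \<Psi> where "\<Psi> xs w = (\<Sum>(y, a)\<leftarrow>xs. a * \<Phi> y w)" for xs :: "('b \<times> real) list" and w
  have [measurable]: "\<Psi> xs \<in> borel_measurable M" for xs
  proof (induction xs)
    case (Cons z xs)
    have "\<Psi> (z # xs) = (\<lambda>w. snd z * \<Phi> (fst z) w + \<Psi> xs w)" by (simp add: \<Psi>_def fun_eq_iff case_prod_beta)
    moreover have "(\<lambda>w. snd z * \<Phi> (fst z) w + \<Psi> xs w) \<in> borel_measurable M" using Cons by measurable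
    ultimately show ?case by simp
  qed (simp add: \<Psi>_def has_bochner_integral_zero)
  have \<Phi>2: "integrable M (\<lambda>w. (\<Phi> x w)\<^sup>2)" for x
    using k[of x x] by (simp add: has_bochner_integral_iff power2_eq_square)
  show g\<Phi>: "integrable M (\<lambda>w. g w * \<Phi> x w)" for x by (rule Cauchy_Schwarz_integral(1)) (use g2 \<Phi>2 in auto)
  have \<Phi>\<Psi>: "has_bochner_integral M (\<lambda>w. \<Phi> y w * \<Psi> xs w) (\<Sum>(z, b)\<leftarrow>xs. b * k y z)" for y xs
  proof (induction xs)
    case (Cons z xs)
    have "has_bochner_integral M (\<lambda>w. snd z * (\<Phi> y w * \<Phi> (fst z) w) + \<Phi> y w * \<Psi> xs w)
       (snd z * k y (fst z) + (\<Sum>(z, b)\<leftarrow>xs. b * k y z))"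
      by (intro has_bochner_integral_add has_bochner_integral_mult_right k Cons)
    then show ?case by (simp add: \<Psi>_def case_prod_unfold algebra_simps)
  qed (simp add: \<Psi>_def has_bochner_integral_zero)
  have \<Psi>\<Psi>: "has_bochner_integral M (\<lambda>w. \<Psi> xs w * \<Psi> ys w) (\<Sum>(y, a)\<leftarrow>xs. a * (\<Sum>(z, b)\<leftarrow>ys. b * k y z))" for xs ys
  proof (induction xs)
    case (Cons z xs)
    have "has_bochner_integral M (\<lambda>w. snd z * (\<Phi> (fst z) w * \<Psi> ys w) + \<Psi> xs w * \<Psi> ys w)
       (snd z * (\<Sum>(u, b)\<leftarrow>ys. b * k (fst z) u) + (\<Sum>(y, a)\<leftarrow>xs. a * (\<Sum>(z, b)\<leftarrow>ys. b * k y z)))"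
      by (intro has_bochner_integral_add has_bochner_integral_mult_right \<Phi>\<Psi> Cons)
    then show ?case by (simp add: \<Psi>_def case_prod_unfold algebra_simps)
  qed (simp add: \<Psi>_def has_bochner_integral_zero)
  have g\<Psi>: "has_bochner_integral M (\<lambda>w. g w * \<Psi> xs w) (\<Sum>(y, a)\<leftarrow>xs. a * (\<integral>w. g w * \<Phi> y w \<partial>M))" for xs
  proof (induction xs)
    case (Cons z xs)
    have "has_bochner_integral M (\<lambda>w. snd z * (g w * \<Phi> (fst z) w) + g w * \<Psi> xs w)
       (snd z * (\<integral>w. g w * \<Phi> (fst z) w \<partial>M) + (\<Sum>(y, a)\<leftarrow>xs. a * (\<integral>w. g w * \<Phi> y w \<partial>M)))"
      by (intro has_bochner_integral_add has_bochner_integral_mult_right Cons has_bochner_integral_integrable g\<Phi>)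
    then show ?case by (simp add: \<Psi>_def case_prod_unfold algebra_simps)
  qed (simp add: \<Psi>_def has_bochner_integral_zero)
  show "(\<lambda>x. \<integral>w. g w * \<Phi> x w \<partial>M) \<in> H"
  proof (rule mem_of_bound)
    fix xs
    have \<Psi>2: "integrable M (\<lambda>w. (\<Psi> xs w)\<^sup>2)" using \<Psi>\<Psi>[of xs xs] by (simp add: has_bochner_integral_iff power2_eq_square)
    have "(\<Sum>(y, a)\<leftarrow>xs. a * (\<integral>w. g w * \<Phi> y w \<partial>M))\<^sup>2 = (\<integral>w. g w * \<Psi> xs w \<partial>M)\<^sup>2"
      using g\<Psi>[of xs] by (simp add: has_bochner_integral_iff)
    also have "\<dots> \<le> (\<integral>w. (g w)\<^sup>2 \<partial>M) * (\<integral>w. (\<Psi> xs w)\<^sup>2 \<partial>M)"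
      by (rule Cauchy_Schwarz_integral(2)) (use g2 \<Psi>2 in auto)
    also have "(\<integral>w. (\<Psi> xs w)\<^sup>2 \<partial>M) = (\<Sum>(y, a)\<leftarrow>xs. a * (\<Sum>(z, b)\<leftarrow>xs. b * k y z))"
      using \<Psi>\<Psi>[of xs xs] by (simp add: has_bochner_integral_iff power2_eq_square)
    finally show "(\<Sum>(y, a)\<leftarrow>xs. a * (\<integral>w. g w * \<Phi> y w \<partial>M))\<^sup>2
       \<le> (sqrt (\<integral>w. (g w)\<^sup>2 \<partial>M))\<^sup>2 * (\<Sum>(y, a)\<leftarrow>xs. a * (\<Sum>(z, b)\<leftarrow>xs. b * k y z))" by simp
  qed simp
qed

section \<open>A feature map for the inverse multi-quadric kernel\<close>

text \<open>Euler's integral after the substitution \<open>t = b * s\<close>. It yields the mixture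
  representation of the kernel, the integrability of a squared coefficient and the function
  \<open>1 / (a + u)\<close>.\<close>

lemma nn_integral_powr_exp:
  fixes a b :: real
  assumes "a > 0" "b > 0"
  shows "(\<integral>\<^sup>+s. ennreal (indicator {0<..} s * (s powr (a - 1) * exp (- b * s))) \<partial>lborel) = ennreal (Gamma a * b powr (- a))"
proof -
  define h where "h s = indicator {0<..} s * (s powr (a - 1) * exp (- b * s))" for s :: real
  have "ennreal (Gamma a) = (\<integral>\<^sup>+t. ennreal (indicator {0..} t * t powr (a - 1) / exp t) \<partial>lborel)"
    by (rule Gamma_conv_nn_integral_real[OF assms(1)])
  also have "\<dots> = \<bar>b\<bar> * (\<integral>\<^sup>+s. ennreal (indicator {0..} (0 + b * s) * (0 + b * s) powr (a - 1) / exp (0 + b * s)) \<partial>lborel)"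
    using assms by (intro nn_integral_real_affine) auto
  also have "(\<lambda>s. ennreal (indicator {0..} (0 + b * s) * (0 + b * s) powr (a - 1) / exp (0 + b * s)))
      = (\<lambda>s. ennreal (b powr (a - 1)) * ennreal (h s))"
  proof
    fix s :: real
    have "indicator {0..} (0 + b * s) * (0 + b * s) powr (a - 1) / exp (0 + b * s) = b powr (a - 1) * h s"
      using assms by (cases "s > 0") (auto simp: h_def powr_mult exp_minus field_simps indicator_def mult_le_0_iff zero_le_mult_iff)
    then show "ennreal (indicator {0..} (0 + b * s) * (0 + b * s) powr (a - 1) / exp (0 + b * s)) = ennreal (b powr (a - 1)) * ennreal (h s)"
      by (simp add: ennreal_mult h_def)
  qed
  also have "(\<integral>\<^sup>+s. ennreal (b powr (a - 1)) * ennreal (h s) \<partial>lborel) = ennreal (b powr (a - 1)) * (\<integral>\<^sup>+s. ennreal (h s) \<partial>lborel)"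
    by (rule nn_integral_cmult) (simp add: h_def[abs_def])
  finally have "ennreal (Gamma a) = (ennreal \<bar>b\<bar> * ennreal (b powr (a - 1))) * (\<integral>\<^sup>+s. ennreal (h s) \<partial>lborel)"
    by (simp add: mult.assoc)
  also have "ennreal \<bar>b\<bar> * ennreal (b powr (a - 1)) = ennreal (b powr a)"
    using assms by (simp add: ennreal_mult[symmetric] powr_diff)
  finally have 1: "ennreal (Gamma a) = ennreal (b powr a) * (\<integral>\<^sup>+s. ennreal (h s) \<partial>lborel)" .
  have "ennreal (Gamma a * b powr (- a)) = ennreal (b powr (- a)) * ennreal (Gamma a)"
    using assms by (simp add: ennreal_mult[symmetric] mult.commute Gamma_real_pos less_imp_le)
  also have "\<dots> = (ennreal (b powr (- a)) * ennreal (b powr a)) * (\<integral>\<^sup>+s. ennreal (h s) \<partial>lborel)"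
    unfolding 1 by (simp add: mult.assoc)
  also have "ennreal (b powr (- a)) * ennreal (b powr a) = 1"
    using assms by (simp add: ennreal_mult[symmetric] powr_add[symmetric])
  finally show ?thesis by (simp add: h_def)
qed

context imq_rkhs
begin

text \<open>Up to the total mass \<open>(c\<^sup>2) powr \<beta>\<close> this is the Gamma density
  with shape \<open>- \<beta>\<close> and rate \<open>c\<^sup>2 * l\<^sup>2\<close>; its Laplace
  transform at \<open>(norm (x - y))\<^sup>2\<close> is the kernel.\<close>

definition mix_density :: "real \<Rightarrow> real" where
  "mix_density s = indicator {0<..} s * (l powr (- 2 * \<beta>) / Gamma (- \<beta>) * (s powr (- \<beta> - 1) * exp (- (c\<^sup>2 * l\<^sup>2) * s)))"

lemma mix_density_pos: "s > 0 \<Longrightarrow> mix_density s > 0" using l_pos \<beta> by (auto simp: mix_density_def Gamma_real_pos intro!: mult_pos_pos divide_pos_pos)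
lemma mix_density_nonneg: "mix_density s \<ge> 0" using mix_density_pos[of s] by (cases "s > 0") (auto simp: mix_density_def)
lemma mix_density_0: "s \<le> 0 \<Longrightarrow> mix_density s = 0" by (simp add: mix_density_def)
lemma measurable_mix_density[measurable]: "mix_density \<in> borel_measurable borel" unfolding mix_density_def[abs_def] by measurable

lemma nn_integral_mix_density:
  assumes "u \<ge> 0"
  shows "(\<integral>\<^sup>+s. ennreal (mix_density s * exp (- s * u)) \<partial>lborel) = ennreal ((c\<^sup>2 + u / l\<^sup>2) powr \<beta>)"
proof -
  define b where "b = c\<^sup>2 * l\<^sup>2 + u"
  have b: "b > 0" using assms c_pos l_pos by (simp add: b_def add_pos_nonneg)
  define K where "K = l powr (- 2 * \<beta>) / Gamma (- \<beta>)"
  have G: "Gamma (- \<beta>) > 0" using \<beta> by (simp add: Gamma_real_pos)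
  have K: "K \<ge> 0" using G by (simp add: K_def)
  have "(\<integral>\<^sup>+s. ennreal (mix_density s * exp (- s * u)) \<partial>lborel)
     = (\<integral>\<^sup>+s. ennreal K * ennreal (indicator {0<..} s * (s powr (- \<beta> - 1) * exp (- b * s))) \<partial>lborel)"
  proof (intro nn_integral_cong)
    fix s :: real
    have "exp (- (c\<^sup>2 * l\<^sup>2) * s) * exp (- s * u) = exp (- b * s)"
      by (simp add: exp_add[symmetric] b_def algebra_simps)
    then have "mix_density s * exp (- s * u) = K * (indicator {0<..} s * (s powr (- \<beta> - 1) * exp (- b * s)))"
      by (simp add: mix_density_def K_def mult.assoc)
    then show "ennreal (mix_density s * exp (- s * u)) = ennreal K * ennreal (indicator {0<..} s * (s powr (- \<beta> - 1) * exp (- b * s)))"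
      using K by (simp add: ennreal_mult)
  qed
  also have "\<dots> = ennreal K * ennreal (Gamma (- \<beta>) * b powr \<beta>)"
    using nn_integral_powr_exp[of "- \<beta>" b] b \<beta> by (subst nn_integral_cmult) auto
  also have "\<dots> = ennreal (K * (Gamma (- \<beta>) * b powr \<beta>))" using K by (simp add: ennreal_mult')
  also have "K * (Gamma (- \<beta>) * b powr \<beta>) = (l powr (- 2)) powr \<beta> * b powr \<beta>"
    using G by (simp add: K_def powr_powr)
  also have "\<dots> = (l powr (- 2) * b) powr \<beta>" using b by (simp add: powr_mult)
  also have "l powr (- 2) * b = c\<^sup>2 + u / l\<^sup>2"
    using l_pos by (simp add: b_def powr_minus powr_numeral field_simps)
  finally show ?thesis .
qed

text \<open>The square root splits the mixture weight evenly between the two features of a product,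
  and the division compensates the mass produced by their convolution.\<close>

definition feature_weight :: "real \<Rightarrow> real" where "feature_weight s = sqrt (mix_density s / gauss_mass TYPE(real ^ 'd) (4 * s))"

definition feature :: "real ^ 'd \<Rightarrow> real \<times> (real ^ 'd) \<Rightarrow> real" where
  "feature x w = feature_weight (fst w) * exp (- (2 * fst w) * (norm (x - snd w))\<^sup>2)"

abbreviation feature_measure :: "(real \<times> (real ^ 'd)) measure" where "feature_measure \<equiv> lborel \<Otimes>\<^sub>M lborel"

lemma measurable_feature_weight[measurable]: "feature_weight \<in> borel_measurable borel" unfolding feature_weight_def[abs_def] by measurable
lemma measurable_feature[measurable]: "feature x \<in> borel_measurable feature_measure" unfolding feature_def[abs_def] by measurable
lemma feature_weight_sq: "s > 0 \<Longrightarrow> (feature_weight s)\<^sup>2 = mix_density s / gauss_mass TYPE(real ^ 'd) (4 * s)"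
  using mix_density_nonneg[of s] gauss_mass_pos[of "4 * s", where ?'a = "real ^ 'd"] by (simp add: feature_weight_def less_imp_le)
lemma feature_weight_pos: "s > 0 \<Longrightarrow> feature_weight s > 0"
  using mix_density_pos[of s] gauss_mass_pos[of "4 * s", where ?'a = "real ^ 'd"] by (simp add: feature_weight_def)
lemma feature_weight_0: "s \<le> 0 \<Longrightarrow> feature_weight s = 0" by (simp add: feature_weight_def mix_density_0)
lemma feature_weight_nonneg: "feature_weight s \<ge> 0" using feature_weight_pos[of s] feature_weight_0[of s] by (cases "s > 0") auto

text \<open>By Tonelli: the integral over the centres \<open>z\<close> gives
  \<open>mix_density s\<close> times a Gaussian of precision \<open>s\<close>, and the integral over
  \<open>s\<close> is its Laplace transform.\<close>

lemma feature_kernel: "has_bochner_integral feature_measure (\<lambda>w. feature x w * feature y w) (imq_kernel c l \<beta> x y)"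
proof (rule has_bochner_integral_nn_integral)
  have "(\<integral>\<^sup>+w. ennreal (feature x w * feature y w) \<partial>feature_measure) = (\<integral>\<^sup>+s. \<integral>\<^sup>+z. ennreal (feature x (s, z) * feature y (s, z)) \<partial>lborel \<partial>lborel)"
    by (rule lborel.nn_integral_fst[symmetric]) measurable
  also have "\<dots> = (\<integral>\<^sup>+s. ennreal (mix_density s * exp (- s * (norm (x - y))\<^sup>2)) \<partial>lborel)"
  proof (intro nn_integral_cong)
    fix s :: real
    show "(\<integral>\<^sup>+z. ennreal (feature x (s, z) * feature y (s, z)) \<partial>lborel) = ennreal (mix_density s * exp (- s * (norm (x - y))\<^sup>2))"
    proof (cases "s > 0")
      case True
      have "(\<integral>\<^sup>+z. ennreal (feature x (s, z) * feature y (s, z)) \<partial>lborel) =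
        (\<integral>\<^sup>+z. ennreal ((feature_weight s)\<^sup>2 * (exp (- (2 * s) * (norm (x - z))\<^sup>2) * exp (- (2 * s) * (norm (y - z))\<^sup>2))) \<partial>lborel)"
        by (simp add: feature_def power2_eq_square mult_ac)
      also have "\<dots> = ennreal (\<integral>z. (feature_weight s)\<^sup>2 * (exp (- (2 * s) * (norm (x - z))\<^sup>2) * exp (- (2 * s) * (norm (y - z))\<^sup>2)) \<partial>lborel)"
        by (intro nn_integral_eq_integral integrable_mult_right gauss_convolution True) auto
      also have "(\<integral>z. (feature_weight s)\<^sup>2 * (exp (- (2 * s) * (norm (x - z))\<^sup>2) * exp (- (2 * s) * (norm (y - z))\<^sup>2)) \<partial>lborel)
          = (feature_weight s)\<^sup>2 * (exp (- s * (norm (x - y))\<^sup>2) * gauss_mass TYPE(real ^ 'd) (4 * s))"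
        unfolding integral_mult_right_zero gauss_convolution(2)[OF True] ..
      also have "\<dots> = mix_density s * exp (- s * (norm (x - y))\<^sup>2)"
        using True gauss_mass_pos[of "4 * s", where ?'a = "real ^ 'd"] by (simp add: feature_weight_sq)
      finally show ?thesis .
    qed (simp add: feature_def feature_weight_0 mix_density_0)
  qed
  also have "\<dots> = ennreal (imq_kernel c l \<beta> x y)"
    using l_pos by (subst nn_integral_mix_density) (simp_all add: imq_kernel_def power_mult_distrib divide_inverse power_inverse mult.commute)
  finally show "(\<integral>\<^sup>+w. ennreal (feature x w * feature y w) \<partial>feature_measure) = ennreal (imq_kernel c l \<beta> x y)" .
qed (use feature_weight_nonneg in \<open>auto simp: feature_def imq_kernel_def\<close>)

lemmas mem_of_feature = mem_of_feature_map[OF measurable_feature feature_kernel]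

lemma integrable_feature_measure_sq:
  assumes [measurable]: "g \<in> borel_measurable feature_measure"
    and le: "\<And>s. (\<integral>\<^sup>+z. ennreal ((g (s, z))\<^sup>2) \<partial>lborel) \<le> ennreal (B s)"
    and fin: "(\<integral>\<^sup>+s. ennreal (B s) \<partial>lborel) < \<infinity>"
  shows "integrable feature_measure (\<lambda>w. (g w)\<^sup>2)"
proof (rule integrableI_nonneg)
  have "(\<integral>\<^sup>+w. ennreal ((g w)\<^sup>2) \<partial>feature_measure) = (\<integral>\<^sup>+s. \<integral>\<^sup>+z. ennreal ((g (s, z))\<^sup>2) \<partial>lborel \<partial>lborel)"
    by (rule lborel.nn_integral_fst[symmetric]) measurable
  also have "\<dots> \<le> (\<integral>\<^sup>+s. ennreal (B s) \<partial>lborel)" by (intro nn_integral_mono le)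
  also note fin
  finally show "(\<integral>\<^sup>+w. ennreal ((g w)\<^sup>2) \<partial>feature_measure) < \<infinity>" .
qed auto

text \<open>Writing \<open>1 / (a + u)\<close> as the integral of \<open>exp (- s * (a + u))\<close> expresses this function
  through the features; \<open>\<beta> > -1\<close> makes the coefficient function square-integrable near \<open>s = 0\<close>.\<close>

lemma radial_mem:
  assumes a: "a \<ge> c\<^sup>2 * l\<^sup>2"
  shows "(\<lambda>x. x $ i / (a + (norm x)\<^sup>2)) \<in> H"
proof -
  have a0: "a > 0" using a c_pos l_pos by (smt (verit) mult_pos_pos zero_less_power)
  \<comment> \<open>Chosen so that the inner integral over \<open>z\<close> against
    \<open>feature x\<close> is \<open>x $ i * exp (- (a + (norm x)\<^sup>2) * s)\<close>: the
    divisors undo the normalisations, and the factor 2 undoes the half in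
    \<open>gauss_odd_moment\<close>.\<close>
  define g :: "real \<times> (real ^ 'd) \<Rightarrow> real" where
    "g w = indicator {0<..} (fst w) * (2 * exp (- a * fst w) / (gauss_mass TYPE(real ^ 'd) (4 * fst w) * feature_weight (fst w)) *
      (snd w $ i * exp (- (2 * fst w) * (norm (snd w))\<^sup>2)))" for w
  have [measurable]: "(\<lambda>x :: real ^ 'd. x $ i) \<in> borel_measurable borel"
    by (intro borel_measurable_continuous_onI continuous_intros)
  have [measurable]: "g \<in> borel_measurable feature_measure" unfolding g_def[abs_def] by measurable
  define D where "D = sqrt 2 ^ DIM(real ^ 'd)"
  have D: "D > 0" by (simp add: D_def)
  define C where "C = 2 * D * Gamma (- \<beta>) / l powr (- 2 * \<beta>)"
  have C: "C \<ge> 0" using D \<beta> l_pos by (simp add: C_def Gamma_real_pos less_imp_le)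
  \<comment> \<open>The factor \<open>s\<close> from the second moment and
    \<open>s powr (- \<beta> - 1)\<close> from \<open>mix_density\<close>, both in the denominator,
    leave \<open>s powr \<beta>\<close>, integrable at 0 because \<open>\<beta> > -1\<close>. The
    lower bound on \<open>a\<close> keeps the rate \<open>2 * a - c\<^sup>2 * l\<^sup>2\<close>
    positive.\<close>
  define B where "B s = C * (indicator {0<..} s * (s powr ((\<beta> + 1) - 1) * exp (- (2 * a - c\<^sup>2 * l\<^sup>2) * s)))" for s
  have g2: "integrable feature_measure (\<lambda>w. (g w)\<^sup>2)"
  proof (rule integrable_feature_measure_sq[where B = B])
    fix s :: real
    show "(\<integral>\<^sup>+z. ennreal ((g (s, z))\<^sup>2) \<partial>lborel) \<le> ennreal (B s)"
    proof (cases "s > 0")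
      case True
      have Zp: "gauss_mass TYPE(real ^ 'd) (4 * s) > 0" using True by (intro gauss_mass_pos) auto
      define e where "e = 4 * exp (- (2 * a) * s) / (gauss_mass TYPE(real ^ 'd) (4 * s) * mix_density s)"
      have e: "e \<ge> 0" using Zp mix_density_pos[OF True] by (simp add: e_def)
      have ge: "(g (s, z))\<^sup>2 \<le> e * ((norm z)\<^sup>2 * exp (- (4 * s) * (norm z)\<^sup>2))" for z
      proof -
        have "(g (s, z))\<^sup>2 = (2 * exp (- a * s))\<^sup>2 / ((gauss_mass TYPE(real ^ 'd) (4 * s))\<^sup>2 * (feature_weight s)\<^sup>2) * ((z $ i)\<^sup>2 * (exp (- (2 * s) * (norm z)\<^sup>2))\<^sup>2)"
          using True by (simp add: g_def power_mult_distrib power_divide)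
        also have "(2 * exp (- a * s))\<^sup>2 / ((gauss_mass TYPE(real ^ 'd) (4 * s))\<^sup>2 * (feature_weight s)\<^sup>2) = e"
          unfolding feature_weight_sq[OF True] using Zp mix_density_pos[OF True]
          by (simp add: e_def power2_eq_square exp_add[symmetric] field_simps)
        also have "(exp (- (2 * s) * (norm z)\<^sup>2))\<^sup>2 = exp (- (4 * s) * (norm z)\<^sup>2)"
          by (simp add: power2_eq_square exp_add[symmetric])
        also have "e * ((z $ i)\<^sup>2 * exp (- (4 * s) * (norm z)\<^sup>2)) \<le> e * ((norm z)\<^sup>2 * exp (- (4 * s) * (norm z)\<^sup>2))"
        proof (intro mult_left_mono mult_right_mono e)
          show "(z $ i)\<^sup>2 \<le> (norm z)\<^sup>2" using component_le_norm_cart[of z i] by (metis abs_ge_zero power2_abs power_mono)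
        qed simp
        finally show ?thesis .
      qed
      have "(\<integral>\<^sup>+z. ennreal ((g (s, z))\<^sup>2) \<partial>lborel) \<le> (\<integral>\<^sup>+z. ennreal e * ennreal ((norm z)\<^sup>2 * exp (- (4 * s) * (norm (z :: real ^ 'd))\<^sup>2)) \<partial>lborel)"
        using ge e by (intro nn_integral_mono) (simp add: ennreal_mult[symmetric] ennreal_leI)
      also have "\<dots> = ennreal e * (\<integral>\<^sup>+z. ennreal ((norm (z :: real ^ 'd))\<^sup>2 * exp (- (4 * s) * (norm z)\<^sup>2)) \<partial>lborel)"
        by (rule nn_integral_cmult) measurable
      also have "\<dots> \<le> ennreal e * ennreal (D * gauss_mass TYPE(real ^ 'd) (4 * s) / (2 * s))"
        unfolding D_def by (intro mult_left_mono gauss_second_moment True) simp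
      also have "\<dots> = ennreal (e * (D * gauss_mass TYPE(real ^ 'd) (4 * s) / (2 * s)))" using e by (simp only: ennreal_mult'[symmetric])
      also have "e * (D * gauss_mass TYPE(real ^ 'd) (4 * s) / (2 * s)) = B s"
      proof -
        have "s powr (- \<beta> - 1) * s powr (\<beta> + 1) = 1" using True by (simp add: powr_add[symmetric])
        then have p: "1 / (s powr (- \<beta> - 1) * s) = s powr \<beta>"
          using True by (simp add: powr_add field_simps)
        have "e * (D * gauss_mass TYPE(real ^ 'd) (4 * s) / (2 * s)) = 2 * D * exp (- (2 * a) * s) / (mix_density s * s)"
          using Zp True by (simp add: e_def field_simps)
        also have "\<dots> = C * (1 / (s powr (- \<beta> - 1) * s)) * (exp (- (2 * a) * s) / exp (- (c\<^sup>2 * l\<^sup>2) * s))"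
          using True by (simp add: mix_density_def C_def mult_ac)
        also have "\<dots> = B s" using True unfolding p by (simp add: B_def exp_diff[symmetric] algebra_simps)
        finally show ?thesis .
      qed
      finally show ?thesis .
    qed (simp add: g_def)
    have "(\<integral>\<^sup>+s. ennreal (B s) \<partial>lborel) = ennreal C * ennreal (Gamma (\<beta> + 1) * (2 * a - c\<^sup>2 * l\<^sup>2) powr (- (\<beta> + 1)))"
    proof -
      have b: "2 * a - c\<^sup>2 * l\<^sup>2 > 0" using a a0 by simp
      show ?thesis unfolding B_def using C \<beta> b
        by (subst nn_integral_powr_exp[symmetric]) (auto simp: ennreal_mult' nn_integral_cmult)
    qed
    then show "(\<integral>\<^sup>+s. ennreal (B s) \<partial>lborel) < \<infinity>" by (simp add: ennreal_mult_less_top)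
  qed measurable
  have "(\<integral>w. g w * feature x w \<partial>feature_measure) = x $ i / (a + (norm x)\<^sup>2)" for x
  proof -
    have "(\<integral>w. g w * feature x w \<partial>feature_measure) = (\<integral>s. \<integral>z. g (s, z) * feature x (s, z) \<partial>lborel \<partial>lborel)"
      by (rule lborel_pair.integral_fst'[symmetric]) (rule mem_of_feature(1), use g2 in auto)
    also have "\<dots> = (\<integral>s. x $ i * (indicator {0<..} s * (s powr (1 - 1) * exp (- (a + (norm x)\<^sup>2) * s))) \<partial>lborel)"
    proof (intro Bochner_Integration.integral_cong refl)
      fix s :: real
      show "(\<integral>z. g (s, z) * feature x (s, z) \<partial>lborel) = x $ i * (indicator {0<..} s * (s powr (1 - 1) * exp (- (a + (norm x)\<^sup>2) * s)))"
      proof (cases "s > 0")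
        case True
        have Zp: "gauss_mass TYPE(real ^ 'd) (4 * s) > 0" using True by (intro gauss_mass_pos) auto
        have "(\<integral>z. g (s, z) * feature x (s, z) \<partial>lborel) =
          (\<integral>z. 2 * exp (- a * s) / gauss_mass TYPE(real ^ 'd) (4 * s) * ((z \<bullet> axis i 1) * (exp (- (2 * s) * (norm (x - z))\<^sup>2) * exp (- (2 * s) * (norm z)\<^sup>2))) \<partial>lborel)"
          using True feature_weight_pos[OF True] by (simp add: g_def feature_def inner_axis mult_ac)
        also have "\<dots> = 2 * exp (- a * s) / gauss_mass TYPE(real ^ 'd) (4 * s) * ((x \<bullet> axis i 1) / 2 * (exp (- s * (norm x)\<^sup>2) * gauss_mass TYPE(real ^ 'd) (4 * s)))"
          unfolding integral_mult_right_zero gauss_odd_moment[OF True] ..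
        also have "\<dots> = x $ i * (exp (- a * s) * exp (- s * (norm x)\<^sup>2))" using Zp by (simp add: inner_axis)
        also have "exp (- a * s) * exp (- s * (norm x)\<^sup>2) = exp (- (a + (norm x)\<^sup>2) * s)"
          by (simp add: exp_add[symmetric] algebra_simps)
        finally show ?thesis using True by simp
      qed (simp add: g_def)
    qed
    also have "\<dots> = x $ i * (\<integral>s. indicator {0<..} s * (s powr (1 - 1) * exp (- (a + (norm x)\<^sup>2) * s)) \<partial>lborel)" by simp
    also have "(\<integral>s. indicator {0<..} s * (s powr (1 - 1) * exp (- (a + (norm x)\<^sup>2) * s)) \<partial>lborel) = 1 / (a + (norm x)\<^sup>2)"
    proof -
      have b: "a + (norm x)\<^sup>2 > 0" using a0 by (simp add: add_pos_nonneg)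
      show ?thesis
        using nn_integral_powr_exp[of 1 "a + (norm x)\<^sup>2"] b
        by (intro has_bochner_integral_integral_eq has_bochner_integral_nn_integral) (auto simp: powr_minus_divide)
    qed
    finally show ?thesis by simp
  qed
  then show ?thesis using mem_of_feature(2)[OF _ g2] by simp
qed

end

section \<open>Mollification within the space\<close>

lemma gauss_mass_antimono:
  assumes "0 < s" "s \<le> t"
  shows "gauss_mass TYPE('a::euclidean_space) t \<le> gauss_mass TYPE('a) s"
  unfolding gauss_mass_def
  using integrable_gauss[of s "0::'a"] integrable_gauss[of t "0::'a"] assms
  by (intro integral_mono) (auto intro: mult_right_mono)

context imq_rkhs
begin

text \<open>Mixtures of Gaussians with large precision \<open>s\<close> are the mollifiers for which the convolution
  with a square-integrable function is an integral against the features.\<close>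

lemma mollifier:
  assumes S: "S > 0"
  obtains N :: "(real ^ 'd) measure" where "prob_space N" "sets N = sets borel"
    "integrable N norm" "(\<integral>w. norm w \<partial>N) \<le> sqrt 2 ^ DIM(real ^ 'd) / sqrt S"
    "\<And>f B. f \<in> borel_measurable borel \<Longrightarrow> (\<And>x. \<bar>f x\<bar> \<le> B) \<Longrightarrow> integrable lborel (\<lambda>x. (f x)\<^sup>2) \<Longrightarrow>
       (\<lambda>x. \<integral>w. f (x - w) \<partial>N) \<in> H"
proof -
  define D where "D = sqrt 2 ^ DIM(real ^ 'd)"
  have D: "D > 0" by (simp add: D_def)
  \<comment> \<open>Unnormalised joint density of a precision of at least \<open>S\<close> and a
    displacement; the mollifier \<open>N\<close> is the law of the displacement.\<close>
  define u :: "real \<times> (real ^ 'd) \<Rightarrow> real" where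
    "u w = indicator {S..} (fst w) * (mix_density (fst w) * exp (- (2 * fst w) * (norm (snd w))\<^sup>2))" for w
  have [measurable]: "u \<in> borel_measurable feature_measure" unfolding u_def[abs_def] by measurable
  have u0: "u w \<ge> 0" for w by (simp add: u_def mix_density_nonneg)
  define zM where "zM s = indicator {S..} s * (mix_density s * gauss_mass TYPE(real ^ 'd) (2 * s))" for s
  have [measurable]: "zM \<in> borel_measurable borel" unfolding zM_def[abs_def] by measurable
  have Zp: "gauss_mass TYPE(real ^ 'd) s > 0" if "s > 0" for s using that by (rule gauss_mass_pos)
  have zM0: "zM s \<ge> 0" for s using Zp[of "2 * s"] S by (auto simp: zM_def mix_density_nonneg indicator_def)
  have mixn: "(\<integral>\<^sup>+s. ennreal (mix_density s) \<partial>lborel) < \<infinity>" using nn_integral_mix_density[of 0] by simp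
  have mixi: "integrable lborel mix_density" using mixn mix_density_nonneg by (intro integrableI_nonneg) auto
  have zMi: "integrable lborel zM"
  proof (rule Bochner_Integration.integrable_bound[OF integrable_mult_left[OF mixi, of "gauss_mass TYPE(real ^ 'd) (2 * S)"]])
    show "AE s in lborel. norm (zM s) \<le> norm (mix_density s * gauss_mass TYPE(real ^ 'd) (2 * S))"
    proof (rule AE_I2)
      fix s
      show "norm (zM s) \<le> norm (mix_density s * gauss_mass TYPE(real ^ 'd) (2 * S))"
        using zM0[of s] Zp[of "2 * S"] S mix_density_nonneg[of s] gauss_mass_antimono[of "2 * S" "2 * s", where ?'a = "real ^ 'd"]
        by (cases "s \<ge> S") (auto simp: zM_def intro!: mult_left_mono)
    qed
  qed simp
  define n where "n = (\<integral>s. zM s \<partial>lborel)"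
  have zMn: "(\<integral>\<^sup>+s. ennreal (zM s) \<partial>lborel) = ennreal n"
    unfolding n_def by (intro nn_integral_eq_integral zMi) (simp add: zM0)
  \<comment> \<open>\<open>mix_density\<close> is positive on the whole half-line, so mass remains
    beyond every \<open>S\<close>; the interval \<open>{S..S + 1}\<close> witnesses it.\<close>
  have n: "n > 0"
  proof -
    have "n \<noteq> 0"
    proof
      assume "n = 0"
      then have "AE s in lborel. zM s = 0"
        using integral_nonneg_eq_0_iff_AE[OF zMi] zM0 by (simp add: n_def)
      then have "AE s in lborel. s \<notin> {S..S + 1}"
      proof eventually_elim
        case (elim s)
        then show ?case using mix_density_pos[of s] Zp[of "2 * s"] S by (auto simp: zM_def)
      qed
      then have "emeasure lborel {S..S + 1} = 0" by (subst (asm) AE_iff_measurable[of "{S..S + 1}"]) auto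
      then show False by simp
    qed
    moreover have "n \<ge> 0" unfolding n_def by (intro integral_nonneg_AE AE_I2 zM0)
    ultimately show ?thesis by simp
  qed
  have inner: "(\<integral>\<^sup>+w. ennreal (u (s, w)) \<partial>lborel) = ennreal (zM s)" for s
  proof (cases "s \<ge> S")
    case True
    have "(\<integral>\<^sup>+w. ennreal (u (s, w)) \<partial>lborel) = (\<integral>\<^sup>+w. ennreal (mix_density s) * ennreal (exp (- (2 * s) * (norm (w :: real ^ 'd))\<^sup>2)) \<partial>lborel)"
      using True by (simp add: u_def ennreal_mult mix_density_nonneg)
    also have "\<dots> = ennreal (mix_density s) * (\<integral>\<^sup>+w. ennreal (exp (- (2 * s) * (norm (w :: real ^ 'd))\<^sup>2)) \<partial>lborel)"
      by (rule nn_integral_cmult) measurable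
    also have "(\<integral>\<^sup>+w. ennreal (exp (- (2 * s) * (norm (w :: real ^ 'd))\<^sup>2)) \<partial>lborel) = ennreal (gauss_mass TYPE(real ^ 'd) (2 * s))"
      unfolding gauss_mass_def using integrable_gauss[of "2 * s" "0 :: real ^ 'd"] True S by (intro nn_integral_eq_integral) auto
    finally show ?thesis using True by (simp add: zM_def ennreal_mult' mix_density_nonneg)
  qed (simp add: u_def zM_def)
  have un: "(\<integral>\<^sup>+w. ennreal (u w) \<partial>feature_measure) = ennreal n"
    unfolding zMn[symmetric] inner[symmetric] by (rule lborel.nn_integral_fst[symmetric]) measurable
  have ui: "integrable feature_measure u" using un u0 by (intro integrableI_nonneg) auto
  define M0 where "M0 = density feature_measure (\<lambda>w. ennreal (u w / n))"
  have [measurable_cong]: "sets M0 = sets feature_measure" by (simp add: M0_def)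
  have m0: "(\<integral>\<^sup>+w. ennreal (u w / n) \<partial>feature_measure) = 1"
  proof -
    have "(\<integral>\<^sup>+w. ennreal (u w / n) \<partial>feature_measure) = (\<integral>\<^sup>+w. ennreal (1 / n) * ennreal (u w) \<partial>feature_measure)"
      using n by (intro nn_integral_cong) (simp add: ennreal_mult'[symmetric])
    also have "\<dots> = ennreal (1 / n) * ennreal n" by (subst nn_integral_cmult) (simp_all add: un)
    also have "\<dots> = 1" using n by (simp add: ennreal_mult'[symmetric])
    finally show ?thesis .
  qed
  interpret M0: prob_space M0
  proof (rule prob_spaceI)
    have "emeasure M0 (space M0) = (\<integral>\<^sup>+w. ennreal (u w / n) * indicator (space feature_measure) w \<partial>feature_measure)"
      unfolding M0_def space_density by (rule emeasure_density[OF _ sets.top]) measurable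
    also have "\<dots> = (\<integral>\<^sup>+w. ennreal (u w / n) \<partial>feature_measure)" by (rule nn_integral_cong) auto
    finally show "emeasure M0 (space M0) = 1" using m0 by simp
  qed
  have snd_m[measurable]: "snd \<in> borel_measurable M0" by measurable
  define N where "N = distr M0 borel (snd :: real \<times> (real ^ 'd) \<Rightarrow> real ^ 'd)"
  have N: "prob_space N" unfolding N_def by (rule M0.prob_space_distr[OF snd_m])
  have sN[measurable_cong]: "sets N = sets borel" by (simp add: N_def)
  \<comment> \<open>At precision \<open>s\<close> the first moment is of order
    \<open>1 / sqrt s\<close>, hence at most \<open>D / sqrt S\<close> relative to the mass
    \<open>zM s\<close>.\<close>
  have mom: "(\<integral>\<^sup>+w. ennreal (norm w) \<partial>N) \<le> ennreal (D / sqrt S)"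
  proof -
    have "(\<integral>\<^sup>+w. ennreal (norm w) \<partial>N) = (\<integral>\<^sup>+w. ennreal (norm (snd w)) \<partial>M0)"
      unfolding N_def by (subst nn_integral_distr) auto
    also have "\<dots> = (\<integral>\<^sup>+w. ennreal (1 / n) * ennreal (u w * norm (snd w)) \<partial>feature_measure)"
      unfolding M0_def using n u0
      by (subst nn_integral_density) (auto intro!: nn_integral_cong simp: ennreal_mult[symmetric])
    also have "\<dots> = ennreal (1 / n) * (\<integral>\<^sup>+w. ennreal (u w * norm (snd w)) \<partial>feature_measure)"
      by (rule nn_integral_cmult) measurable
    also have "(\<integral>\<^sup>+w. ennreal (u w * norm (snd w)) \<partial>feature_measure) = (\<integral>\<^sup>+s. \<integral>\<^sup>+z. ennreal (u (s, z) * norm z) \<partial>lborel \<partial>lborel)"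
      by (subst lborel.nn_integral_fst[symmetric]) auto
    also have "\<dots> \<le> (\<integral>\<^sup>+s. ennreal (D / sqrt S) * ennreal (zM s) \<partial>lborel)"
    proof (intro nn_integral_mono)
      fix s
      show "(\<integral>\<^sup>+z. ennreal (u (s, z) * norm z) \<partial>lborel) \<le> ennreal (D / sqrt S) * ennreal (zM s)"
      proof (cases "s \<ge> S")
        case True
        then have s: "s > 0" using S by simp
        have "(\<integral>\<^sup>+z. ennreal (u (s, z) * norm z) \<partial>lborel) = (\<integral>\<^sup>+z. ennreal (mix_density s * (norm z * exp (- (2 * s) * (norm (z :: real ^ 'd))\<^sup>2))) \<partial>lborel)"
          using True by (simp add: u_def mult_ac)
        also have "\<dots> = ennreal (\<integral>z. mix_density s * (norm z * exp (- (2 * s) * (norm (z :: real ^ 'd))\<^sup>2)) \<partial>lborel)"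
          by (intro nn_integral_eq_integral integrable_mult_right gauss_first_moment s) (simp add: mix_density_nonneg)
        also have "(\<integral>z. mix_density s * (norm z * exp (- (2 * s) * (norm (z :: real ^ 'd))\<^sup>2)) \<partial>lborel)
            = mix_density s * (\<integral>z. norm z * exp (- (2 * s) * (norm (z :: real ^ 'd))\<^sup>2) \<partial>lborel)" by simp
        also have "\<dots> \<le> mix_density s * (D * gauss_mass TYPE(real ^ 'd) (2 * s) / sqrt s)"
          unfolding D_def by (intro mult_left_mono gauss_first_moment s mix_density_nonneg)
        also have "\<dots> = zM s * (D / sqrt s)" using True by (simp add: zM_def)
        also have "\<dots> \<le> zM s * (D / sqrt S)"
          using zM0 D S True by (intro mult_left_mono divide_left_mono) auto
        finally have "(\<integral>\<^sup>+z. ennreal (u (s, z) * norm z) \<partial>lborel) \<le> ennreal (zM s * (D / sqrt S))"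
          by (simp add: ennreal_leI)
        then show ?thesis using D S zM0 by (simp add: ennreal_mult[symmetric] mult.commute)
      qed (simp add: u_def)
    qed
    also have "\<dots> = ennreal (D / sqrt S) * ennreal n" by (subst nn_integral_cmult) (simp_all add: zMn)
    finally have "(\<integral>\<^sup>+w. ennreal (norm w) \<partial>N) \<le> ennreal (1 / n) * (ennreal (D / sqrt S) * ennreal n)"
      by (simp add: mult_left_mono)
    also have "\<dots> = ennreal (D / sqrt S)" using n D S by (simp add: ennreal_mult[symmetric])
    finally show ?thesis .
  qed
  show ?thesis
  proof (rule that[OF N sN])
    show "integrable N norm"
      using mom by (intro integrableI_nonneg) (auto simp: less_top[symmetric] top_unique)
    show "(\<integral>w. norm w \<partial>N) \<le> sqrt 2 ^ DIM(real ^ 'd) / sqrt S"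
      using mom D S unfolding D_def by (intro integral_real_bounded) auto
    fix f :: "real ^ 'd \<Rightarrow> real" and B
    assume f[measurable]: "f \<in> borel_measurable borel" and B: "\<And>x. \<bar>f x\<bar> \<le> B" and f2: "integrable lborel (\<lambda>x. (f x)\<^sup>2)"
    \<comment> \<open>Times the feature at \<open>x\<close> this equals
      \<open>f z * u (s, x - z) / n\<close>, the integrand of the convolution after
      reflection.\<close>
    define g where "g w = indicator {S..} (fst w) * (f (snd w) * (mix_density (fst w) / (feature_weight (fst w) * n)))" for w
    have [measurable]: "g \<in> borel_measurable feature_measure" unfolding g_def[abs_def] by measurable
    define F2 where "F2 = (\<integral>x. (f x)\<^sup>2 \<partial>lborel)"
    have F2: "F2 \<ge> 0" "(\<integral>\<^sup>+x. ennreal ((f x)\<^sup>2) \<partial>lborel) = ennreal F2"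
      using f2 by (auto simp: F2_def nn_integral_eq_integral)
    define Z4 where "Z4 = gauss_mass TYPE(real ^ 'd) (4 * S)"
    have Z4: "Z4 > 0" using S by (simp add: Z4_def Zp)
    have g2: "integrable feature_measure (\<lambda>w. (g w)\<^sup>2)"
    proof (rule integrable_feature_measure_sq[where B = "\<lambda>s. Z4 * F2 / n\<^sup>2 * mix_density s"])
      fix s
      show "(\<integral>\<^sup>+z. ennreal ((g (s, z))\<^sup>2) \<partial>lborel) \<le> ennreal (Z4 * F2 / n\<^sup>2 * mix_density s)"
      proof (cases "s \<ge> S")
        case True
        then have s: "s > 0" using S by simp
        \<comment> \<open>The square of the weight is \<open>mix_density s / n\<^sup>2\<close> times
          the Gaussian mass at \<open>4 * s\<close>. That mass is unbounded as \<open>s\<close>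
          tends to 0; the truncation at \<open>S\<close> is what bounds it by
          \<open>Z4\<close>.\<close>
        have e: "(mix_density s / (feature_weight s * n))\<^sup>2 \<le> Z4 / n\<^sup>2 * mix_density s"
        proof -
          have "(mix_density s / (feature_weight s * n))\<^sup>2 = mix_density s * gauss_mass TYPE(real ^ 'd) (4 * s) / n\<^sup>2"
            unfolding power_divide power_mult_distrib feature_weight_sq[OF s]
            using mix_density_pos[OF s] Zp[of "4 * s"] s n by (simp add: power2_eq_square field_simps)
          also have "\<dots> \<le> mix_density s * Z4 / n\<^sup>2"
            unfolding Z4_def using True S by (intro divide_right_mono mult_left_mono gauss_mass_antimono mix_density_nonneg) auto
          finally show ?thesis by (simp add: mult_ac)
        qed
        have "(\<integral>\<^sup>+z. ennreal ((g (s, z))\<^sup>2) \<partial>lborel) = (\<integral>\<^sup>+z. ennreal ((mix_density s / (feature_weight s * n))\<^sup>2) * ennreal ((f z)\<^sup>2) \<partial>lborel)"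
        proof (rule nn_integral_cong)
          fix z
          have "g (s, z) = (mix_density s / (feature_weight s * n)) * f z" using True by (simp add: g_def)
          then have "(g (s, z))\<^sup>2 = (mix_density s / (feature_weight s * n))\<^sup>2 * (f z)\<^sup>2" by (simp only: power_mult_distrib)
          then show "ennreal ((g (s, z))\<^sup>2) = ennreal ((mix_density s / (feature_weight s * n))\<^sup>2) * ennreal ((f z)\<^sup>2)"
            by (simp only: ennreal_mult[symmetric] zero_le_power2)
        qed
        also have "\<dots> = ennreal ((mix_density s / (feature_weight s * n))\<^sup>2) * ennreal F2" by (subst nn_integral_cmult) (simp_all add: F2)
        also have "\<dots> \<le> ennreal (Z4 / n\<^sup>2 * mix_density s) * ennreal F2" by (intro mult_right_mono ennreal_leI e) simp
        also have "\<dots> = ennreal (Z4 * F2 / n\<^sup>2 * mix_density s)" using F2 Z4 mix_density_nonneg[of s]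
          by (subst ennreal_mult[symmetric]) (auto simp: mult_ac)
        finally show ?thesis .
      qed (simp add: g_def)
      have "ennreal (Z4 * F2 / n\<^sup>2 * mix_density s) = ennreal (Z4 * F2 / n\<^sup>2) * ennreal (mix_density s)" for s
        by (rule ennreal_mult) (use Z4 F2 mix_density_nonneg in auto)
      then have "(\<integral>\<^sup>+s. ennreal (Z4 * F2 / n\<^sup>2 * mix_density s) \<partial>lborel) = ennreal (Z4 * F2 / n\<^sup>2) * (\<integral>\<^sup>+s. ennreal (mix_density s) \<partial>lborel)"
        by (simp only:) (rule nn_integral_cmult, measurable)
      then show "(\<integral>\<^sup>+s. ennreal (Z4 * F2 / n\<^sup>2 * mix_density s) \<partial>lborel) < \<infinity>"
        using mixn by (simp add: ennreal_mult_less_top)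
    qed measurable
    have "(\<integral>w. g w * feature x w \<partial>feature_measure) = (\<integral>w. f (x - w) \<partial>N)" for x
    proof -
      have fu: "integrable feature_measure (\<lambda>w. u w / n * f (x - snd w))"
        by (rule Bochner_Integration.integrable_bound[OF integrable_mult_right[OF ui, of "B / n"]])
           (use B u0 n in \<open>auto intro!: AE_I2 simp: abs_mult divide_right_mono mult.commute[of B] mult_left_mono
             order_trans[OF abs_ge_zero B]\<close>)
      have "(\<integral>w. f (x - w) \<partial>N) = (\<integral>w. f (x - snd w) \<partial>M0)" unfolding N_def by (subst integral_distr) auto
      also have "\<dots> = (\<integral>w. u w / n * f (x - snd w) \<partial>feature_measure)"
        unfolding M0_def using u0 n by (subst integral_density) auto
      also have "\<dots> = (\<integral>s. \<integral>z. u (s, z) / n * f (x - z) \<partial>lborel \<partial>lborel)"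
        by (subst lborel_pair.integral_fst'[OF fu, symmetric]) simp
      also have "\<dots> = (\<integral>s. \<integral>z. g (s, z) * feature x (s, z) \<partial>lborel \<partial>lborel)"
      proof (rule Bochner_Integration.integral_cong[OF refl])
        fix s
        have "(\<integral>z. u (s, z) / n * f (x - z) \<partial>lborel) = (\<integral>z. u (s, x - z) / n * f (x - (x - z)) \<partial>lborel)"
          by (rule integral_lborel_reflect[symmetric, of "\<lambda>z. u (s, z) / n * f (x - z)"]) measurable
        also have "\<dots> = (\<integral>z. g (s, z) * feature x (s, z) \<partial>lborel)"
          using feature_weight_pos[of s] S by (intro Bochner_Integration.integral_cong refl) (auto simp: u_def g_def feature_def indicator_def)
        finally show "(\<integral>z. u (s, z) / n * f (x - z) \<partial>lborel) = (\<integral>z. g (s, z) * feature x (s, z) \<partial>lborel)" .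
      qed
      also have "\<dots> = (\<integral>w. g w * feature x w \<partial>feature_measure)"
        by (rule lborel_pair.integral_fst') (rule mem_of_feature(1), use g2 in auto)
      finally show ?thesis by simp
    qed
    then show "(\<lambda>x. \<integral>w. f (x - w) \<partial>N) \<in> H" using mem_of_feature(2)[OF _ g2] by simp
  qed
qed

end

section \<open>Integration by parts on the whole space\<close>

text \<open>Integrate \<open>g (x + e) - g x\<close>, the integral of the derivative along the segment, over \<open>x\<close> and
  use translation invariance.\<close>

lemma integral_directional_derivative_zero:
  fixes g g' :: "'a::euclidean_space \<Rightarrow> real"
  assumes deriv: "\<And>x. ((\<lambda>t. g (x + t *\<^sub>R e)) has_real_derivative g' x) (at 0)"
    and cont: "continuous_on UNIV g'"
    and g: "integrable lborel g" and g': "integrable lborel g'"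
  shows "(\<integral>x. g' x \<partial>lborel) = 0"
proof -
  have [measurable]: "g' \<in> borel_measurable borel" by (rule borel_measurable_continuous_onI[OF cont])
  have [measurable]: "g \<in> borel_measurable borel" using g by auto
  have D: "((\<lambda>t. g (x + t *\<^sub>R e)) has_real_derivative g' (x + t *\<^sub>R e)) (at t)" for x t
  proof -
    have "((\<lambda>u. g ((x + t *\<^sub>R e) + u *\<^sub>R e)) has_real_derivative g' (x + t *\<^sub>R e)) (at 0)" by (rule deriv)
    then have "((\<lambda>u. g (x + (u + t) *\<^sub>R e)) has_real_derivative g' (x + t *\<^sub>R e)) (at 0)"
      by (simp add: algebra_simps)
    then show ?thesis using DERIV_shift[of "\<lambda>t. g (x + t *\<^sub>R e)" _ 0 t] by simp
  qed
  have ftc: "(\<integral>t. g' (x + t *\<^sub>R e) * indicator {0..1} t \<partial>lborel) = g (x + e) - g x" for x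
    using integral_FTC_Icc_real[of 0 1 "\<lambda>t. g (x + t *\<^sub>R e)" "\<lambda>t. g' (x + t *\<^sub>R e)"] D
      continuous_on_compose2[OF cont, of UNIV "\<lambda>t. x + t *\<^sub>R e"]
    by (auto simp: continuous_on_eq_continuous_at continuous_intros)
  define F where "F = (\<lambda>(t::real, x). indicator {0..1} t * g' (x + t *\<^sub>R e))"
  have [measurable]: "F \<in> borel_measurable (lborel \<Otimes>\<^sub>M lborel)" unfolding F_def by measurable
  have sh: "integrable lborel (\<lambda>x. g' (x + y))" for y by (rule integrable_lborel_shift[OF g'])
  have Fi: "integrable (lborel \<Otimes>\<^sub>M lborel) F"
  proof (rule lborel_pair.Fubini_integrable)
    have "(\<integral>y. norm (F (t, y)) \<partial>lborel) = indicator {0..1} t * (\<integral>x. \<bar>g' x\<bar> \<partial>lborel)" for t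
      using integral_lborel_shift[of "\<lambda>x. \<bar>g' x\<bar>" "t *\<^sub>R e"] by (simp add: F_def abs_mult)
    then show "integrable lborel (\<lambda>t. \<integral>y. norm (F (t, y)) \<partial>lborel)" by (simp add: integrable_indicator_iff)
    show "AE t in lborel. integrable lborel (\<lambda>y. F (t, y))" using sh by (simp add: F_def)
  qed measurable
  have "(\<integral>x. \<integral>t. F (t, x) \<partial>lborel \<partial>lborel) = (\<integral>t. \<integral>x. F (t, x) \<partial>lborel \<partial>lborel)"
    using lborel_pair.Fubini_integral[of "\<lambda>t x. F (t, x)"] Fi by simp
  also have "(\<integral>x. \<integral>t. F (t, x) \<partial>lborel \<partial>lborel) = (\<integral>x. g (x + e) - g x \<partial>lborel)"
    by (simp add: F_def ftc mult.commute[of "indicator _ _"])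
  also have "\<dots> = 0"
    using g integrable_lborel_shift[OF g, of e] by (simp add: integral_lborel_shift)
  also have "(\<integral>t. \<integral>x. F (t, x) \<partial>lborel \<partial>lborel) = (\<integral>t. indicator {0..1} t * (\<integral>x. g' x \<partial>lborel) \<partial>(lborel :: real measure))"
    by (simp add: F_def integral_lborel_shift)
  also have "\<dots> = (\<integral>x. g' x \<partial>lborel)" by simp
  finally show ?thesis by simp
qed

section \<open>The Stein operator on the product space\<close>

text \<open>\<open>grad\<close> is a definite description: a representing vector is assembled from
  the values of the derivative on the basis, and it is unique because the inner product separates
  vectors.\<close>

lemma GDERIV_grad:
  fixes f :: "'a::euclidean_space \<Rightarrow> real"
  assumes "f differentiable (at x)"
  shows "GDERIV f x :> grad f x"
proof -
  obtain D where D: "(f has_derivative D) (at x)" using assms by (auto simp: differentiable_def)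
  then have lin: "linear D" by (rule has_derivative_linear)
  define d where "d = (\<Sum>b\<in>Basis. D b *\<^sub>R b)"
  have "D h = h \<bullet> d" for h
  proof -
    have "D h = D (\<Sum>b\<in>Basis. (h \<bullet> b) *\<^sub>R b)" by (simp add: euclidean_representation)
    also have "\<dots> = h \<bullet> d"
      by (simp add: linear_sum[OF lin] linear_cmul[OF lin] d_def inner_sum_right mult.commute)
    finally show ?thesis .
  qed
  then have "D = (\<lambda>h. h \<bullet> d)" by (rule ext)
  with D have 1: "GDERIV f x :> d" by (simp add: gderiv_def)
  show ?thesis unfolding grad_def
  proof (rule theI[where P = "\<lambda>D. GDERIV f x :> D", OF 1])
    fix d' assume "GDERIV f x :> d'"
    then have "(\<lambda>h. h \<bullet> d') = (\<lambda>h. h \<bullet> d)"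
      using 1 has_derivative_unique unfolding gderiv_def by blast
    then have "h \<bullet> d' = h \<bullet> d" for h by (rule fun_cong)
    then show "d' = d" using vector_eq_ldot by metis
  qed
qed

lemma divergence_eq_partial_deriv: "divergence f x = (\<Sum>i\<in>UNIV. partial_deriv i (\<lambda>y. f y $ i) x)"
  by (simp add: divergence_def partial_deriv_def)

lemma norm_le_card_mult:
  fixes v :: "real ^ 'd"
  assumes "\<And>i. \<bar>v $ i\<bar> \<le> B"
  shows "norm v \<le> real CARD('d) * B"
  using order_trans[OF norm_le_l1_cart sum_mono[of UNIV "\<lambda>i. \<bar>v $ i\<bar>" "\<lambda>_. B"]] assms by simp

text \<open>Differentiability of \<open>ln (p x)\<close> is listed separately because
  \<open>grad\<close> is an unspecified value where no gradient exists, so conditions on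
  \<open>score p\<close> alone would not imply it.\<close>

locale stein_setting = imq_rkhs c l \<beta> H ip
  for c l \<beta> :: real and H :: "(real ^ 'd \<Rightarrow> real) set"
    and ip :: "(real ^ 'd \<Rightarrow> real) \<Rightarrow> (real ^ 'd \<Rightarrow> real) \<Rightarrow> real" +
  fixes p :: "real ^ 'd \<Rightarrow> real" and P :: "(real ^ 'd) measure"
  assumes prob_P: "prob_space P" and P_moment: "integrable P (\<lambda>x. (norm x)\<^sup>2)"
    and p_measurable[measurable]: "p \<in> borel_measurable borel" and p_pos: "\<And>x. p x > 0"
    and P_density: "P = density lborel (\<lambda>x. ennreal (p x))"
    and ln_p_diff: "\<And>x. (\<lambda>x. ln (p x)) differentiable (at x)"
    and score_lip: "\<exists>L. L-lipschitz_on UNIV (score p)"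
    and score_sq: "integrable P (\<lambda>x. (norm (score p x))\<^sup>2)"
begin

lemma sets_P[measurable_cong]: "sets P = sets borel" by (simp add: P_density)

lemma score_gderiv: "GDERIV (\<lambda>x. ln (p x)) x :> score p x"
  unfolding score_def by (rule GDERIV_grad[OF ln_p_diff])

lemma p_deriv: "((\<lambda>t. p (x + t *\<^sub>R axis i 1)) has_real_derivative p x * score p x $ i) (at 0)"
proof -
  have "((\<lambda>y. ln (p y)) has_derivative (\<lambda>h. h \<bullet> score p x)) (at (x + 0 *\<^sub>R axis i 1))"
    using score_gderiv[of x] by (simp add: gderiv_def)
  moreover have "((\<lambda>t. x + t *\<^sub>R axis i 1) has_derivative (\<lambda>t. t *\<^sub>R axis i 1)) (at 0)"
    by (auto intro!: derivative_eq_intros)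
  ultimately have "((\<lambda>t. ln (p (x + t *\<^sub>R axis i 1))) has_derivative (\<lambda>t. (t *\<^sub>R axis i 1) \<bullet> score p x)) (at 0)"
    using has_derivative_compose[of "\<lambda>t. x + t *\<^sub>R axis i 1" "\<lambda>t. t *\<^sub>R axis i 1" 0 UNIV
      "\<lambda>y. ln (p y)" "\<lambda>h. h \<bullet> score p x"] by blast
  then have "((\<lambda>t. ln (p (x + t *\<^sub>R axis i 1))) has_real_derivative score p x $ i) (at 0)"
    unfolding has_field_derivative_def by (simp add: inner_axis' mult_commute_abs)
  then have "((\<lambda>t. exp (ln (p (x + t *\<^sub>R axis i 1)))) has_real_derivative exp (ln (p (x + 0 *\<^sub>R axis i 1))) * score p x $ i) (at 0)"
    by (rule DERIV_fun_exp)
  then show ?thesis by (simp add: p_pos)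
qed

lemma p_cont: "continuous_on UNIV p"
proof -
  have "continuous_on UNIV (\<lambda>x. ln (p x))"
    using ln_p_diff by (intro differentiable_imp_continuous_on)
      (auto simp: differentiable_on_def intro: differentiable_at_withinI)
  from continuous_on_exp[OF this] show ?thesis by (simp add: p_pos)
qed

lemma score_cont: "continuous_on UNIV (score p)"
  using score_lip lipschitz_on_continuous_on by blast

lemma score_measurable[measurable]: "score p \<in> borel_measurable borel"
  by (rule borel_measurable_continuous_onI[OF score_cont])

definition score_Lip where "score_Lip = (SOME L. L-lipschitz_on UNIV (score p))"

lemma score_Lip: "norm (score p x - score p y) \<le> score_Lip * norm (x - y)" and score_Lip_nonneg: "score_Lip \<ge> 0"
proof -
  have *: "score_Lip-lipschitz_on UNIV (score p)" unfolding score_Lip_def by (rule someI_ex[OF score_lip])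
  show "norm (score p x - score p y) \<le> score_Lip * norm (x - y)" using lipschitz_onD[OF *, of x y] by (simp add: dist_norm)
  show "score_Lip \<ge> 0" using lipschitz_on_nonneg[OF *] .
qed

lemma score_growth: "norm (score p x) \<le> norm (score p 0) + score_Lip * norm x"
  using score_Lip[of x 0] norm_triangle_sub[of "score p x" "score p 0"] by simp

lemma P_norm: "integrable P norm"
proof -
  interpret P: prob_space P by (rule prob_P)
  have "norm (norm x) \<le> norm (1 + (norm x)\<^sup>2)" for x :: "real ^ 'd"
  proof -
    have "2 * norm x \<le> 1 + (norm x)\<^sup>2" using sum_squares_bound[of 1 "norm x"] by simp
    then have "norm x \<le> 1 + (norm x)\<^sup>2" using norm_ge_zero[of x] by linarith
    then show ?thesis by simp
  qed
  then show ?thesis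
    by (intro Bochner_Integration.integrable_bound[OF Bochner_Integration.integrable_add[OF P.integrable_const[of 1] P_moment]])
       auto
qed

section \<open>Fields with components in the space: bounds, moduli and the Stein identity\<close>

definition rkhs_fields :: "(real ^ 'd \<Rightarrow> real ^ 'd) set" where "rkhs_fields = {f. \<forall>i. (\<lambda>x. f x $ i) \<in> H}"

definition reg_const where "reg_const = (SOME K. regular_bound K)"

lemma reg_const: "reg_const > 0" "f \<in> H \<Longrightarrow> \<bar>f x\<bar> \<le> reg_const * rkhs_norm f"
    "f \<in> H \<Longrightarrow> \<bar>f x - f y\<bar> \<le> reg_const * rkhs_norm f * norm (x - y)"
    "f \<in> H \<Longrightarrow> ((\<lambda>t. f (x + t *\<^sub>R axis i 1)) has_real_derivative partial_deriv i f x) (at 0)"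
    "f \<in> H \<Longrightarrow> t \<noteq> 0 \<Longrightarrow> \<bar>(f (x + t *\<^sub>R axis i 1) - f x) / t - partial_deriv i f x\<bar> \<le> reg_const * rkhs_norm f * \<bar>t\<bar>"
proof -
  have R: "regular_bound reg_const" unfolding reg_const_def by (rule someI_ex[OF regular_bound_exists])
  then show "reg_const > 0" by (simp add: regular_bound_def)
  assume f: "f \<in> H"
  note * = R[unfolded regular_bound_def, THEN conjunct2, rule_format, OF f]
  show "\<bar>f x\<bar> \<le> reg_const * rkhs_norm f" "\<bar>f x - f y\<bar> \<le> reg_const * rkhs_norm f * norm (x - y)"
    "((\<lambda>t. f (x + t *\<^sub>R axis i 1)) has_real_derivative partial_deriv i f x) (at 0)"
    "t \<noteq> 0 \<Longrightarrow> \<bar>(f (x + t *\<^sub>R axis i 1) - f x) / t - partial_deriv i f x\<bar> \<le> reg_const * rkhs_norm f * \<bar>t\<bar>"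
    using * by blast+
qed

lemma member_continuous: "f \<in> H \<Longrightarrow> continuous_on UNIV f"
proof -
  assume f: "f \<in> H"
  have "(reg_const * rkhs_norm f)-lipschitz_on UNIV f"
    using reg_const(1) rkhs_norm_nonneg[OF f] reg_const(3)[OF f] by (intro lipschitz_onI) (auto simp: dist_real_def dist_norm)
  then show ?thesis by (rule lipschitz_on_continuous_on)
qed

lemma partial_deriv_bound: assumes f: "f \<in> H" shows "\<bar>partial_deriv i f x\<bar> \<le> reg_const * rkhs_norm f"
proof (rule LIMSEQ_le_const2)
  have "((\<lambda>t. (f (x + t *\<^sub>R axis i 1) - f x) / t) \<longlongrightarrow> partial_deriv i f x) (at 0)"
    using reg_const(4)[OF f, of x i] unfolding DERIV_def by simp
  then have "((\<lambda>t. \<bar>(f (x + t *\<^sub>R axis i 1) - f x) / t\<bar>) \<longlongrightarrow> \<bar>partial_deriv i f x\<bar>) (at 0)" by (rule tendsto_rabs)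
  moreover have "filterlim (\<lambda>n. 1 / real (Suc n)) (at 0) sequentially"
    unfolding filterlim_at using LIMSEQ_inverse_real_of_nat by (auto simp: inverse_eq_divide)
  ultimately show "(\<lambda>n. \<bar>(f (x + (1 / real (Suc n)) *\<^sub>R axis i 1) - f x) / (1 / real (Suc n))\<bar>) \<longlonglongrightarrow> \<bar>partial_deriv i f x\<bar>"
    by (rule filterlim_compose)
  have "\<bar>(f (x + t *\<^sub>R axis i 1) - f x) / t\<bar> \<le> reg_const * rkhs_norm f" if "t > 0" for t
    using reg_const(3)[OF f, of "x + t *\<^sub>R axis i 1" x] that by (simp add: norm_axis_1 divide_le_eq)
  then show "\<exists>N. \<forall>n\<ge>N. \<bar>(f (x + (1 / real (Suc n)) *\<^sub>R axis i 1) - f x) / (1 / real (Suc n))\<bar> \<le> reg_const * rkhs_norm f"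
    by (intro exI[of _ 0] allI impI) (simp only: zero_less_divide_1_iff of_nat_0_less_iff zero_less_Suc)
qed

text \<open>The derivative is within order \<open>t\<close> of a difference quotient of step
  \<open>t\<close>, and the quotient has \<open>2 / t\<close> times the Lipschitz constant of
  \<open>f\<close>. The step stays free: it is chosen only after \<open>norm (x - y)\<close> has
  been integrated.\<close>

lemma partial_deriv_modulus:
  assumes f: "f \<in> H" and t: "t > 0"
  shows "\<bar>partial_deriv i f x - partial_deriv i f y\<bar> \<le> 2 * reg_const * rkhs_norm f * (t + norm (x - y) / t)"
proof -
  define q where "q x = (f (x + t *\<^sub>R axis i 1) - f x) / t" for x
  have q: "\<bar>q x - partial_deriv i f x\<bar> \<le> reg_const * rkhs_norm f * t" for x using reg_const(5)[OF f, of t x i] t by (simp add: q_def)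
  have "\<bar>(f (x + t *\<^sub>R axis i 1) - f (y + t *\<^sub>R axis i 1)) - (f x - f y)\<bar> \<le> 2 * (reg_const * rkhs_norm f * norm (x - y))"
    using reg_const(3)[OF f, of "x + t *\<^sub>R axis i 1" "y + t *\<^sub>R axis i 1"] reg_const(3)[OF f, of x y] by simp
  then have "\<bar>(f (x + t *\<^sub>R axis i 1) - f (y + t *\<^sub>R axis i 1)) - (f x - f y)\<bar> / t \<le> 2 * (reg_const * rkhs_norm f * norm (x - y)) / t"
    using t by (intro divide_right_mono) auto
  moreover have "q x - q y = ((f (x + t *\<^sub>R axis i 1) - f (y + t *\<^sub>R axis i 1)) - (f x - f y)) / t"
    using t by (simp add: q_def field_simps)
  ultimately have "\<bar>q x - q y\<bar> \<le> 2 * (reg_const * rkhs_norm f * norm (x - y)) / t" using t by simp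
  then have "\<bar>partial_deriv i f x - partial_deriv i f y\<bar> \<le> 2 * (reg_const * rkhs_norm f * t) + 2 * (reg_const * rkhs_norm f * norm (x - y)) / t"
    using q[of x] q[of y] by linarith
  then show ?thesis by (simp add: algebra_simps)
qed

lemma partial_deriv_continuous: assumes f: "f \<in> H" shows "continuous_on UNIV (partial_deriv i f)"
proof (rule continuous_at_imp_continuous_on, rule ballI)
  fix x
  show "isCont (partial_deriv i f) x"
    unfolding continuous_at_eps_delta
  proof (intro allI impI)
    fix \<epsilon> :: real assume e: "\<epsilon> > 0"
    define M where "M = 2 * reg_const * rkhs_norm f + 1"
    have M: "M > 0" using reg_const(1) rkhs_norm_nonneg[OF f] by (simp add: M_def add_nonneg_pos)
    define t where "t = \<epsilon> / (4 * M)"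
    have t: "t > 0" using e M by (simp add: t_def)
    show "\<exists>\<delta>>0. \<forall>y. dist y x < \<delta> \<longrightarrow> dist (partial_deriv i f y) (partial_deriv i f x) < \<epsilon>"
    proof (intro exI[of _ "t * t"] conjI allI impI)
      show "t * t > 0" using t by simp
      fix y assume y: "dist y x < t * t"
      have "\<bar>partial_deriv i f y - partial_deriv i f x\<bar> \<le> 2 * reg_const * rkhs_norm f * (t + norm (y - x) / t)" by (rule partial_deriv_modulus[OF f t])
      also have "\<dots> \<le> M * (t + t)"
      proof (intro mult_mono add_left_mono)
        show "norm (y - x) / t \<le> t" using y t by (simp add: dist_norm divide_le_eq)
      qed (use M t in \<open>auto simp: M_def\<close>)
      also have "\<dots> < \<epsilon>" using M e by (simp add: t_def field_simps)
      finally show "dist (partial_deriv i f y) (partial_deriv i f x) < \<epsilon>" by (simp add: dist_real_def)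
    qed
  qed
qed

lemma stein_op_eq: "stein_op p f x = (\<Sum>i\<in>UNIV. f x $ i * score p x $ i + partial_deriv i (\<lambda>y. f y $ i) x)"
  by (simp add: stein_op_def divergence_eq_partial_deriv inner_vec_def sum.distrib)

lemma stein_op_cont: assumes "f \<in> rkhs_fields" shows "continuous_on UNIV (stein_op p f)"
proof -
  have "continuous_on UNIV (\<lambda>x. \<Sum>i\<in>UNIV. f x $ i * score p x $ i + partial_deriv i (\<lambda>y. f y $ i) x)"
    using assms score_cont
    by (intro continuous_on_sum continuous_on_add continuous_on_mult member_continuous partial_deriv_continuous
        continuous_on_component) (auto simp: rkhs_fields_def)
  then show ?thesis by (simp add: stein_op_eq[abs_def])
qed

lemma stein_op_scale:
  assumes f: "f \<in> rkhs_fields"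
  shows "stein_op p (\<lambda>x. r *\<^sub>R f x) x = r * stein_op p f x"
proof -
  have "partial_deriv i (\<lambda>y. r * f y $ i) x = r * partial_deriv i (\<lambda>y. f y $ i) x" for i
    using f by (intro partial_deriv_eqI DERIV_cmult reg_const(4)) (simp add: rkhs_fields_def)
  then show ?thesis by (simp add: stein_op_eq sum_distrib_left algebra_simps)
qed

lemma ballD:
  assumes f: "f \<in> rkhs_prod_unit_ball H ip"
  shows "f \<in> rkhs_fields" "(\<lambda>y. f y $ i) \<in> H" "rkhs_norm (\<lambda>y. f y $ i) \<le> 1"
proof -
  have m: "(\<lambda>y. f y $ i) \<in> H" for i using f by (simp add: rkhs_prod_unit_ball_def)
  then show "f \<in> rkhs_fields" "(\<lambda>y. f y $ i) \<in> H" by (auto simp: rkhs_fields_def)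
  have "ip (\<lambda>x. f x $ i) (\<lambda>x. f x $ i) \<le> (\<Sum>i\<in>UNIV. ip (\<lambda>x. f x $ i) (\<lambda>x. f x $ i))"
    by (rule member_le_sum[of i UNIV "\<lambda>i. ip (\<lambda>x. f x $ i) (\<lambda>x. f x $ i)"]) (use m ip_nonneg in auto)
  also have "\<dots> \<le> 1" using f by (simp add: rkhs_prod_unit_ball_def)
  finally show "rkhs_norm (\<lambda>y. f y $ i) \<le> 1" by (simp add: rkhs_norm_def)
qed

lemma rkhs_fields_to_ball:
  assumes f: "f \<in> rkhs_fields"
  obtains r where "r > 0" "(\<lambda>x. r *\<^sub>R f x) \<in> rkhs_prod_unit_ball H ip"
proof -
  have m: "(\<lambda>y. f y $ i) \<in> H" for i using f by (simp add: rkhs_fields_def)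
  define I where "I = (\<Sum>i\<in>UNIV. ip (\<lambda>x. f x $ i) (\<lambda>x. f x $ i))"
  have I: "I \<ge> 0" unfolding I_def by (intro sum_nonneg ip_nonneg m)
  \<comment> \<open>\<open>1 / (1 + I)\<close> rather than \<open>1 / sqrt I\<close> covers
    \<open>I = 0\<close> as well; both \<open>r\<close> and \<open>r * I\<close> are at most
    1.\<close>
  define r where "r = 1 / (1 + I)"
  have r: "r > 0" "r \<le> 1" using I by (auto simp: r_def)
  have "(\<Sum>i\<in>UNIV. ip (\<lambda>x. r * f x $ i) (\<lambda>x. r * f x $ i)) = r * (r * I)"
    unfolding I_def sum_distrib_left
    by (intro sum.cong refl) (simp add: ip_scale_left ip_scale_right m scale_mem)
  also have "\<dots> \<le> 1 * 1" using r I by (intro mult_mono) (auto simp: r_def)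
  finally have "(\<lambda>x. r *\<^sub>R f x) \<in> rkhs_prod_unit_ball H ip"
    using m scale_mem by (simp add: rkhs_prod_unit_ball_def)
  with r(1) show ?thesis by (rule that)
qed

lemma ball_bounds:
  assumes f: "f \<in> rkhs_prod_unit_ball H ip"
  shows "norm (f x) \<le> real CARD('d) * reg_const" "norm (f x - f y) \<le> real CARD('d) * (reg_const * norm (x - y))"
    "\<bar>divergence f x\<bar> \<le> real CARD('d) * reg_const"
    "t > 0 \<Longrightarrow> \<bar>divergence f x - divergence f y\<bar> \<le> real CARD('d) * (2 * reg_const * (t + norm (x - y) / t))"
proof -
  note m = ballD(2)[OF f] and h = ballD(3)[OF f]
  have KKh: "reg_const * rkhs_norm (\<lambda>y. f y $ i) \<le> reg_const" for i using reg_const(1) h[of i] by simp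
  show "norm (f x) \<le> real CARD('d) * reg_const"
    by (intro norm_le_card_mult order_trans[OF reg_const(2)[OF m] KKh])
  show "norm (f x - f y) \<le> real CARD('d) * (reg_const * norm (x - y))"
  proof (rule norm_le_card_mult)
    fix i
    show "\<bar>(f x - f y) $ i\<bar> \<le> reg_const * norm (x - y)"
      using order_trans[OF reg_const(3)[OF m] mult_right_mono[OF KKh]] by simp
  qed
  have "\<bar>divergence f x\<bar> \<le> (\<Sum>i\<in>UNIV. \<bar>partial_deriv i (\<lambda>y. f y $ i) x\<bar>)" unfolding divergence_eq_partial_deriv by (rule sum_abs)
  also have "\<dots> \<le> (\<Sum>i\<in>(UNIV::'d set). reg_const)" by (intro sum_mono order_trans[OF partial_deriv_bound[OF m] KKh])
  finally show "\<bar>divergence f x\<bar> \<le> real CARD('d) * reg_const" by simp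
  assume t: "t > 0"
  have "\<bar>divergence f x - divergence f y\<bar> \<le> (\<Sum>i\<in>UNIV. \<bar>partial_deriv i (\<lambda>y. f y $ i) x - partial_deriv i (\<lambda>y. f y $ i) y\<bar>)"
    unfolding divergence_eq_partial_deriv sum_subtractf[symmetric] by (rule sum_abs)
  also have "\<dots> \<le> (\<Sum>i\<in>(UNIV::'d set). 2 * reg_const * (t + norm (x - y) / t))"
  proof (rule sum_mono)
    fix i
    have "2 * reg_const * rkhs_norm (\<lambda>y. f y $ i) * (t + norm (x - y) / t) \<le> 2 * reg_const * (t + norm (x - y) / t)"
      using KKh[of i] t by (intro mult_right_mono) auto
    then show "\<bar>partial_deriv i (\<lambda>y. f y $ i) x - partial_deriv i (\<lambda>y. f y $ i) y\<bar> \<le> 2 * reg_const * (t + norm (x - y) / t)"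
      using partial_deriv_modulus[OF m[of i] t, of i x y] by linarith
  qed
  finally show "\<bar>divergence f x - divergence f y\<bar> \<le> real CARD('d) * (2 * reg_const * (t + norm (x - y) / t))" by simp
qed

text \<open>Members and their divergences are bounded, so only the score grows. Linear growth makes
  Stein integrals exist for every law with a first moment, which rules out the default value 0 of
  the Bochner integral.\<close>

lemma ball_stein_growth:
  assumes f: "f \<in> rkhs_prod_unit_ball H ip"
  shows "\<bar>stein_op p f x\<bar> \<le> real CARD('d) * reg_const * (norm (score p 0) + score_Lip * norm x + 1)"
proof -
  have "\<bar>stein_op p f x\<bar> \<le> norm (f x) * norm (score p x) + \<bar>divergence f x\<bar>"
    unfolding stein_op_def using Cauchy_Schwarz_ineq2[of "f x" "score p x"] by linarith
  also have "\<dots> \<le> (real CARD('d) * reg_const) * (norm (score p 0) + score_Lip * norm x) + real CARD('d) * reg_const"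
    using ball_bounds[OF f] reg_const(1) score_growth by (intro add_mono mult_mono) auto
  finally show ?thesis by (simp add: algebra_simps)
qed

text \<open>Product rule, with the increment of \<open>f\<close> paired with the score at
  \<open>y\<close>: later \<open>y\<close> is distributed according to \<open>P\<close>, under which
  the score is square-integrable. The bound is the same for all \<open>f\<close> in the
  ball.\<close>

lemma ball_stein_diff:
  assumes f: "f \<in> rkhs_prod_unit_ball H ip" and t: "t > 0"
  shows "\<bar>stein_op p f x - stein_op p f y\<bar> \<le> real CARD('d) * reg_const *
    (norm (x - y) * (score_Lip + norm (score p y)) + 2 * (t + norm (x - y) / t))"
proof -
  have "stein_op p f x - stein_op p f y = f x \<bullet> (score p x - score p y) + (f x - f y) \<bullet> score p y
      + (divergence f x - divergence f y)"
    by (simp add: stein_op_def inner_diff_left inner_diff_right)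
  also have "\<bar>\<dots>\<bar> \<le> norm (f x) * norm (score p x - score p y) + norm (f x - f y) * norm (score p y)
      + \<bar>divergence f x - divergence f y\<bar>"
    using Cauchy_Schwarz_ineq2[of "f x" "score p x - score p y"] Cauchy_Schwarz_ineq2[of "f x - f y" "score p y"]
    by linarith
  also have "\<dots> \<le> (real CARD('d) * reg_const) * (score_Lip * norm (x - y)) + (real CARD('d) * (reg_const * norm (x - y))) * norm (score p y)
      + real CARD('d) * (2 * reg_const * (t + norm (x - y) / t))"
    using ball_bounds[OF f] reg_const(1) t score_Lip by (intro add_mono mult_mono) auto
  finally show ?thesis by (simp add: algebra_simps)
qed

lemma rkhs_fields_stein_integrable:
  assumes f: "f \<in> rkhs_fields" and M: "prob_space M" "sets M = sets borel" "integrable M norm"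
  shows "integrable M (stein_op p f)"
proof -
  interpret M: prob_space M by fact
  obtain r where r: "r > 0" "(\<lambda>x. r *\<^sub>R f x) \<in> rkhs_prod_unit_ball H ip" by (rule rkhs_fields_to_ball[OF f])
  have [measurable_cong]: "sets M = sets borel" by fact
  have [measurable]: "stein_op p f \<in> borel_measurable borel"
    by (rule borel_measurable_continuous_onI[OF stein_op_cont[OF f]])
  have i: "integrable M (\<lambda>x. (real CARD('d) * reg_const * (norm (score p 0) + score_Lip * norm x + 1)) / r)"
    using M(3) by (intro integrable_divide_zero integrable_mult_right Bochner_Integration.integrable_add) auto
  show ?thesis
  proof (rule Bochner_Integration.integrable_bound[OF i])
    have "\<bar>stein_op p f x\<bar> \<le> real CARD('d) * reg_const * (norm (score p 0) + score_Lip * norm x + 1) / r" for x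
      using ball_stein_growth[OF r(2), of x] r(1) by (simp add: stein_op_scale[OF f] abs_mult le_divide_eq mult.commute)
    then have "norm (stein_op p f x) \<le> norm (real CARD('d) * reg_const * (norm (score p 0) + score_Lip * norm x + 1) / r)" for x
      using order_trans[OF _ abs_ge_self] unfolding real_norm_def by blast
    then show "AE x in M. norm (stein_op p f x) \<le> norm (real CARD('d) * reg_const * (norm (score p 0) + score_Lip * norm x + 1) / r)" by simp
  qed measurable
qed

text \<open>\<open>p\<close> times the Stein operator is the divergence of \<open>p\<close> times
  \<open>f\<close>. Each coordinate contributes the directional derivative of an integrable function
  and integrates to zero, so the decay of \<open>p\<close> enters only through
  integrability.\<close>

lemma stein_identity:
  assumes f: "f \<in> rkhs_prod_unit_ball H ip"
  shows "(\<integral>x. stein_op p f x \<partial>P) = 0"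
proof -
  note m = ballD(2)[OF f] and h = ballD(3)[OF f]
  interpret P: prob_space P by (rule prob_P)
  have pint: "integrable lborel (\<lambda>x. p x * g x)" if "integrable P g" for g
  proof -
    have "g \<in> borel_measurable borel"
      using borel_measurable_integrable[OF that] by (simp add: measurable_cong_sets[OF sets_P refl])
    then show ?thesis using that unfolding P_density
      by (subst (asm) integrable_density) (auto intro: less_imp_le[OF p_pos])
  qed
  have fc: "continuous_on UNIV (\<lambda>y. f y $ i)" "continuous_on UNIV (partial_deriv i (\<lambda>y. f y $ i))" for i
    using member_continuous partial_deriv_continuous m by auto
  have [measurable]: "(\<lambda>y. f y $ i) \<in> borel_measurable borel" "partial_deriv i (\<lambda>y. f y $ i) \<in> borel_measurable borel"
    "(\<lambda>y. score p y $ i) \<in> borel_measurable borel" for i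
    by (intro borel_measurable_continuous_onI fc continuous_on_component[OF score_cont])+
  have KKh: "reg_const * rkhs_norm (\<lambda>y. f y $ i) \<le> reg_const" for i using reg_const(1) h[of i] by simp
  have b: "\<bar>f x $ i\<bar> \<le> reg_const" "\<bar>partial_deriv i (\<lambda>y. f y $ i) x\<bar> \<le> reg_const" for x i
    using order_trans[OF reg_const(2)[OF m] KKh] order_trans[OF partial_deriv_bound[OF m] KKh] by auto
  have iP1: "integrable P (\<lambda>x. f x $ i)" for i
    by (rule P.integrable_const_bound[where B = reg_const]) (use b in auto)
  have iP2: "integrable P (\<lambda>x. f x $ i * score p x $ i + partial_deriv i (\<lambda>y. f y $ i) x)" for i
  proof -
    have iP: "integrable P (\<lambda>x. reg_const * (norm (score p 0) + score_Lip * norm x) + reg_const)"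
      using P_norm by auto
    show ?thesis
    proof (rule Bochner_Integration.integrable_bound[OF iP])
      show "AE x in P. norm (f x $ i * score p x $ i + partial_deriv i (\<lambda>y. f y $ i) x) \<le> norm (reg_const * (norm (score p 0) + score_Lip * norm x) + reg_const)"
      proof (rule AE_I2)
        fix x
        have "\<bar>f x $ i * score p x $ i\<bar> \<le> reg_const * (norm (score p 0) + score_Lip * norm x)"
          unfolding abs_mult using b reg_const(1) order_trans[OF component_le_norm_cart score_growth]
          by (intro mult_mono) auto
        then show "norm (f x $ i * score p x $ i + partial_deriv i (\<lambda>y. f y $ i) x) \<le> norm (reg_const * (norm (score p 0) + score_Lip * norm x) + reg_const)"
          using b(2)[of i x] by simp
      qed
    qed measurable
  qed
  have "(\<integral>x. p x * (f x $ i * score p x $ i + partial_deriv i (\<lambda>y. f y $ i) x) \<partial>lborel) = 0" for i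
  proof (rule integral_directional_derivative_zero[where e = "axis i 1" and g = "\<lambda>x. p x * f x $ i"])
    fix x
    have "((\<lambda>t. p (x + t *\<^sub>R axis i 1) * f (x + t *\<^sub>R axis i 1) $ i) has_real_derivative
       p x * score p x $ i * f (x + 0 *\<^sub>R axis i 1) $ i + partial_deriv i (\<lambda>y. f y $ i) x * p (x + 0 *\<^sub>R axis i 1)) (at 0)"
      by (intro DERIV_mult p_deriv reg_const(4) m)
    then show "((\<lambda>t. p (x + t *\<^sub>R axis i 1) * f (x + t *\<^sub>R axis i 1) $ i) has_real_derivative
       p x * (f x $ i * score p x $ i + partial_deriv i (\<lambda>y. f y $ i) x)) (at 0)"
      by (simp add: algebra_simps)
    show "continuous_on UNIV (\<lambda>x. p x * (f x $ i * score p x $ i + partial_deriv i (\<lambda>y. f y $ i) x))"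
      by (intro continuous_on_mult continuous_on_add p_cont fc continuous_on_component[OF score_cont])
  qed (intro pint iP1 iP2)+
  then have "(\<integral>x. f x $ i * score p x $ i + partial_deriv i (\<lambda>y. f y $ i) x \<partial>P) = 0" for i
    unfolding P_density by (subst integral_density) (auto intro: less_imp_le[OF p_pos])
  then show ?thesis
    unfolding stein_op_eq using iP2 by (subst Bochner_Integration.integral_sum) auto
qed

end

section \<open>Square-integrable maps and continuity of the discrepancy\<close>

lemma norm_vec_sq: "(norm (v :: real ^ 'd))\<^sup>2 = (\<Sum>i\<in>UNIV. (v $ i)\<^sup>2)"
  unfolding power2_norm_eq_inner inner_vec_def by (simp add: power2_eq_square)

lemma L2_prod_space_measurable:
  assumes "T \<in> L2_prod_space Q"
  shows "(T :: 'a \<Rightarrow> real ^ 'd) \<in> borel_measurable Q"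
proof (rule borel_measurable_euclidean_space[THEN iffD2], rule ballI)
  fix b :: "real ^ 'd" assume "b \<in> Basis"
  then obtain i where "b = axis i 1" by (auto simp: Basis_vec_def)
  then show "(\<lambda>x. T x \<bullet> b) \<in> borel_measurable Q"
    using assms by (simp add: L2_prod_space_def L2_space_def inner_axis)
qed

lemma L2_prod_space_integrable:
  assumes "T \<in> L2_prod_space Q"
  shows "integrable Q (\<lambda>x. (norm (T x :: real ^ 'd))\<^sup>2)"
  using assms unfolding norm_vec_sq by (intro Bochner_Integration.integrable_sum) (simp add: L2_prod_space_def L2_space_def)

lemma L2_prod_norm_eq:
  assumes "\<And>i. integrable Q (\<lambda>x. (T x $ i)\<^sup>2)"
  shows "L2_prod_norm Q T = sqrt (\<integral>x. (norm (T x :: real ^ 'd))\<^sup>2 \<partial>Q)"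
  unfolding norm_vec_sq L2_prod_norm_def L2_norm_def using assms
  by (subst Bochner_Integration.integral_sum) auto

lemma integrable_norm_diff_sq:
  fixes X S :: "'a \<Rightarrow> 'b::euclidean_space"
  assumes [measurable]: "X \<in> borel_measurable Q" "S \<in> borel_measurable Q"
    and "integrable Q (\<lambda>x. (norm (X x))\<^sup>2)" "integrable Q (\<lambda>x. (norm (S x))\<^sup>2)"
  shows "integrable Q (\<lambda>x. (norm (X x - S x))\<^sup>2)"
proof (rule Bochner_Integration.integrable_bound)
  show "integrable Q (\<lambda>x. 2 * (norm (X x))\<^sup>2 + 2 * (norm (S x))\<^sup>2)" using assms by simp
  have "(norm (a - b))\<^sup>2 \<le> 2 * (norm a)\<^sup>2 + 2 * (norm b)\<^sup>2" for a b :: 'b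
    using power_mono[OF norm_triangle_ineq4[of a b], of 2] sum_squares_bound[of "norm a" "norm b"]
    by (simp add: power2_sum)
  then show "AE x in Q. norm ((norm (X x - S x))\<^sup>2) \<le> norm (2 * (norm (X x))\<^sup>2 + 2 * (norm (S x))\<^sup>2)" by simp
qed measurable

context stein_setting
begin

abbreviation ksd where "ksd \<equiv> kernel_stein_discrepancy H ip p"

lemma zero_in_ball: "(\<lambda>x. 0) \<in> rkhs_prod_unit_ball H ip"
  using ip_scale_left[OF zero_mem zero_mem, of 0] zero_mem by (simp add: rkhs_prod_unit_ball_def)

lemma ksd_nonneg: "ksd M \<ge> 0"
  unfolding kernel_stein_discrepancy_def by (rule SUP_upper2[OF zero_in_ball]) simp

lemma ksd_upper: "f \<in> rkhs_prod_unit_ball H ip \<Longrightarrow> ereal \<bar>\<integral>y. stein_op p f y \<partial>M\<bar> \<le> ksd M"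
  unfolding kernel_stein_discrepancy_def by (rule SUP_upper)

text \<open>\<open>Q\<close> couples the law of \<open>X\<close> with \<open>P\<close> through the
  pair \<open>(X, S)\<close>. Since the Stein integral under \<open>P\<close> vanishes, the one
  under the law of \<open>X\<close> is an expected difference along this coupling, bounded by
  \<open>ball_stein_diff\<close> and Cauchy-Schwarz uniformly in \<open>f\<close>.\<close>

lemma ksd_le_L2_distance:
  fixes Q :: "'a measure" and X S :: "'a \<Rightarrow> real ^ 'd"
  assumes Q: "prob_space Q" and X[measurable]: "X \<in> borel_measurable Q" and S[measurable]: "S \<in> borel_measurable Q"
    and X2: "integrable Q (\<lambda>x. (norm (X x))\<^sup>2)" and S2: "integrable Q (\<lambda>x. (norm (S x))\<^sup>2)"
    and SP: "distr Q borel S = P" and t: "t > 0"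
  defines "\<delta> \<equiv> sqrt (\<integral>x. (norm (X x - S x))\<^sup>2 \<partial>Q)"
    and "\<sigma> \<equiv> sqrt (\<integral>x. (score_Lip + norm (score p x))\<^sup>2 \<partial>P)"
  shows "ksd (distr Q borel X) \<le> ereal (real CARD('d) * reg_const * (\<delta> * \<sigma> + 2 * (t + \<delta> / t)))"
  unfolding kernel_stein_discrepancy_def
proof (rule SUP_least)
  fix f :: "real ^ 'd \<Rightarrow> real ^ 'd" assume f: "f \<in> rkhs_prod_unit_ball H ip"
  interpret Q: prob_space Q by fact
  interpret P: prob_space P by (rule prob_P)
  have D2: "integrable Q (\<lambda>x. (norm (X x - S x))\<^sup>2)" by (rule integrable_norm_diff_sq[OF X S X2 S2])
  have L1: "integrable Q (\<lambda>x. norm (Y x))" "(\<integral>x. norm (Y x) \<partial>Q) \<le> sqrt (\<integral>x. (norm (Y x))\<^sup>2 \<partial>Q)"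
    if [measurable]: "Y \<in> borel_measurable Q" and Y2: "integrable Q (\<lambda>x. (norm (Y x))\<^sup>2)" for Y :: "'a \<Rightarrow> real ^ 'd"
  proof -
    show "integrable Q (\<lambda>x. norm (Y x))"
      using Cauchy_Schwarz_integral(1)[of "\<lambda>x. norm (Y x)" Q "\<lambda>x. 1"] Y2 by simp
    have "(\<integral>x. norm (Y x) \<partial>Q)\<^sup>2 \<le> (\<integral>x. (norm (Y x))\<^sup>2 \<partial>Q)"
      using Cauchy_Schwarz_integral(2)[of "\<lambda>x. norm (Y x)" Q "\<lambda>x. 1"] Y2 by (simp add: Q.prob_space)
    then show "(\<integral>x. norm (Y x) \<partial>Q) \<le> sqrt (\<integral>x. (norm (Y x))\<^sup>2 \<partial>Q)" by (rule real_le_rsqrt)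
  qed
  have sq: "integrable P (\<lambda>x. (score_Lip + norm (score p x))\<^sup>2)"
  proof (rule Bochner_Integration.integrable_bound)
    show "integrable P (\<lambda>x. 2 * score_Lip\<^sup>2 + 2 * (norm (score p x))\<^sup>2)" using score_sq by simp
    have "(score_Lip + b)\<^sup>2 \<le> 2 * score_Lip\<^sup>2 + 2 * b\<^sup>2" for b
      using sum_squares_bound[of score_Lip b] by (simp add: power2_sum)
    then show "AE x in P. norm ((score_Lip + norm (score p x))\<^sup>2) \<le> norm (2 * score_Lip\<^sup>2 + 2 * (norm (score p x))\<^sup>2)" by simp
  qed measurable
  have sqQ: "integrable Q (\<lambda>x. (score_Lip + norm (score p (S x)))\<^sup>2)"
    using sq unfolding SP[symmetric] by (subst (asm) integrable_distr_eq) auto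
  have \<sigma>: "\<sigma> = sqrt (\<integral>x. (score_Lip + norm (score p (S x)))\<^sup>2 \<partial>Q)"
    unfolding \<sigma>_def SP[symmetric] by (subst integral_distr) auto
  have cs: "integrable Q (\<lambda>x. norm (X x - S x) * (score_Lip + norm (score p (S x))))"
    by (rule Cauchy_Schwarz_integral(1)) (use D2 sqQ in auto)
  have csle: "(\<integral>x. norm (X x - S x) * (score_Lip + norm (score p (S x))) \<partial>Q) \<le> \<delta> * \<sigma>"
    unfolding \<delta>_def \<sigma> real_sqrt_mult[symmetric]
    by (rule real_le_rsqrt, rule Cauchy_Schwarz_integral(2)) (use D2 sqQ in auto)
  have [measurable]: "stein_op p f \<in> borel_measurable borel"
    by (rule borel_measurable_continuous_onI[OF stein_op_cont[OF ballD(1)[OF f]]])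
  have si: "integrable Q (\<lambda>x. stein_op p f (Y x))"
    if [measurable]: "Y \<in> borel_measurable Q" and Y2: "integrable Q (\<lambda>x. (norm (Y x))\<^sup>2)" for Y :: "'a \<Rightarrow> real ^ 'd"
  proof -
    have "integrable (distr Q borel Y) (stein_op p f)"
      using L1(1)[OF that] by (intro rkhs_fields_stein_integrable ballD(1)[OF f] Q.prob_space_distr) (auto simp: integrable_distr_eq)
    then show ?thesis by (subst (asm) integrable_distr_eq) auto
  qed
  have L1D: "integrable Q (\<lambda>x. norm (X x - S x))" "(\<integral>x. norm (X x - S x) \<partial>Q) \<le> \<delta>"
    using L1[of "\<lambda>x. X x - S x"] D2 by (auto simp: \<delta>_def)
  have z: "(\<integral>x. stein_op p f (S x) \<partial>Q) = 0"
    using stein_identity[OF f] unfolding SP[symmetric] by (subst (asm) integral_distr) auto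
  have "\<bar>\<integral>y. stein_op p f y \<partial>distr Q borel X\<bar> = \<bar>(\<integral>x. stein_op p f (X x) \<partial>Q) - (\<integral>x. stein_op p f (S x) \<partial>Q)\<bar>"
    unfolding z by (subst integral_distr) auto
  also have "\<dots> = \<bar>\<integral>x. stein_op p f (X x) - stein_op p f (S x) \<partial>Q\<bar>"
    using si[OF X X2] si[OF S S2] by simp
  also have "\<dots> \<le> (\<integral>x. \<bar>stein_op p f (X x) - stein_op p f (S x)\<bar> \<partial>Q)" by (rule integral_abs_bound)
  also have "\<dots> \<le> (\<integral>x. real CARD('d) * reg_const * (norm (X x - S x) * (score_Lip + norm (score p (S x))) + 2 * (t + norm (X x - S x) / t)) \<partial>Q)"
    using si[OF X X2] si[OF S S2] cs L1D t
    by (intro integral_mono ball_stein_diff[OF f t] integrable_mult_right Bochner_Integration.integrable_add) auto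
  also have "\<dots> = real CARD('d) * reg_const * ((\<integral>x. norm (X x - S x) * (score_Lip + norm (score p (S x))) \<partial>Q) + 2 * (t + (\<integral>x. norm (X x - S x) \<partial>Q) / t))"
    using cs L1D by (simp add: Q.prob_space)
  also have "\<dots> \<le> real CARD('d) * reg_const * (\<delta> * \<sigma> + 2 * (t + \<delta> / t))"
    using csle L1D t reg_const(1) by (intro mult_left_mono add_mono divide_right_mono) auto
  finally show "ereal \<bar>\<integral>y. stein_op p f y \<partial>distr Q borel X\<bar> \<le> ereal (real CARD('d) * reg_const * (\<delta> * \<sigma> + 2 * (t + \<delta> / t)))"
    by simp
qed

text \<open>Density puts a member \<open>S'\<close> of some \<open>\<T> m\<close> close to
  \<open>S\<close>, so its discrepancy is small; nestedness makes it a competitor for all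
  \<open>n \<ge> m\<close>. Hence the infima tend to zero, and the minimising property passes this
  on to \<open>T n\<close>. Rescaling into the unit ball then reaches every field.\<close>

lemma stein_integrals_tendsto_zero:
  fixes Q :: "'a::topological_space measure" and \<TT> :: "('a \<Rightarrow> real ^ 'd) set"
    and \<T> :: "nat \<Rightarrow> ('a \<Rightarrow> real ^ 'd) set"
  assumes Q: "prob_space Q"
    and \<TT>: "\<TT> \<subseteq> L2_prod_space Q" "\<exists>S\<in>\<TT>. distr Q borel S = P"
    and \<T>: "\<And>m n. n \<le> m \<Longrightarrow> \<T> n \<subseteq> \<T> m" "L2_prod_dense_in Q (\<Union>n. \<T> n) \<TT>"
    and minimising: "(\<lambda>n. ksd (distr Q borel (T n)) - (INF S\<in>\<T> n. ksd (distr Q borel S))) \<longlonglongrightarrow> 0"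
    and f: "f \<in> rkhs_fields"
  shows "(\<lambda>n. \<integral>x. stein_op p f x \<partial>distr Q borel (T n)) \<longlonglongrightarrow> 0"
proof -
  define D where "D n = ksd (distr Q borel (T n))" for n
  define I where "I n = (INF S\<in>\<T> n. ksd (distr Q borel S))" for n
  obtain S where S: "S \<in> \<TT>" "distr Q borel S = P" using \<TT>(2) by blast
  define \<sigma> where "\<sigma> = sqrt (\<integral>x. (score_Lip + norm (score p x))\<^sup>2 \<partial>P)"
  have \<sigma>: "\<sigma> \<ge> 0" by (simp add: \<sigma>_def)
  have Ismall: "\<forall>\<^sub>F n in sequentially. I n \<le> ereal \<epsilon>" if e: "\<epsilon> > 0" for \<epsilon> :: real
  proof -
    define A where "A = real CARD('d) * reg_const"
    have A: "A > 0" using reg_const(1) by (simp add: A_def)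
    \<comment> \<open>\<open>t\<close> is fixed before \<open>\<delta>\<close> because the bound
      contains \<open>\<delta> / t\<close>: the term \<open>2 * A * t\<close> becomes
      \<open>\<epsilon> / 4\<close>, then \<open>\<delta>\<close> makes the rest at most
      \<open>\<epsilon> / 4\<close>.\<close>
    define t where "t = \<epsilon> / (8 * A)"
    have t: "t > 0" using e A by (simp add: t_def)
    define \<delta> where "\<delta> = \<epsilon> / (4 * A * (\<sigma> + 2 / t))"
    have st: "\<sigma> + 2 / t > 0" using \<sigma> t by (simp add: add_nonneg_pos)
    have d: "\<delta> > 0" using e A st by (simp add: \<delta>_def)
    obtain S' where S': "S' \<in> (\<Union>n. \<T> n)" "L2_prod_norm Q (\<lambda>x. S x - S' x) < \<delta>"
      using \<T>(2) S(1) d unfolding L2_prod_dense_in_def by blast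
    then obtain m where m: "S' \<in> \<T> m" by blast
    have S'T: "S' \<in> \<TT>" using S'(1) \<T>(2) by (auto simp: L2_prod_dense_in_def)
    have mem: "S \<in> L2_prod_space Q" "S' \<in> L2_prod_space Q" using S(1) S'T \<TT>(1) by auto
    note meas = mem[THEN L2_prod_space_measurable] and int = mem[THEN L2_prod_space_integrable]
    define \<delta>' where "\<delta>' = sqrt (\<integral>x. (norm (S' x - S x))\<^sup>2 \<partial>Q)"
    have "integrable Q (\<lambda>x. ((S x - S' x) $ i)\<^sup>2)" for i
      using integrable_norm_diff_sq[of "\<lambda>x. S x $ i" Q "\<lambda>x. S' x $ i"] mem
      by (simp add: L2_prod_space_def L2_space_def)
    then have "\<delta>' < \<delta>" using S'(2) by (simp add: L2_prod_norm_eq \<delta>'_def norm_minus_commute)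
    have "ksd (distr Q borel S') \<le> ereal (A * (\<delta>' * \<sigma> + 2 * (t + \<delta>' / t)))"
      unfolding A_def \<delta>'_def \<sigma>_def using ksd_le_L2_distance[OF Q meas(2,1) int(2,1) S(2) t] .
    also have "A * (\<delta>' * \<sigma> + 2 * (t + \<delta>' / t)) = A * (\<sigma> + 2 / t) * \<delta>' + 2 * A * t" by (simp add: algebra_simps)
    also have "\<dots> \<le> A * (\<sigma> + 2 / t) * \<delta> + 2 * A * t"
      using \<open>\<delta>' < \<delta>\<close> A st by (intro add_right_mono mult_left_mono) auto
    also have "A * (\<sigma> + 2 / t) * \<delta> = \<epsilon> / 4" using A st unfolding \<delta>_def by (simp only: times_divide_eq_right) (simp add: divide_eq_eq)
    also have "2 * A * t = \<epsilon> / 4" using A by (simp add: t_def)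
    also have "\<epsilon> / 4 + \<epsilon> / 4 \<le> \<epsilon>" using e by simp
    finally have le: "ksd (distr Q borel S') \<le> ereal \<epsilon>" by simp
    show ?thesis
    proof (rule eventually_sequentiallyI[of m])
      fix n assume "n \<ge> m"
      then have "S' \<in> \<T> n" using m \<T>(1) by blast
      then have "I n \<le> ksd (distr Q borel S')" unfolding I_def by (rule INF_lower)
      with le show "I n \<le> ereal \<epsilon>" by simp
    qed
  qed
  have I0: "I n \<ge> 0" for n unfolding I_def by (rule INF_greatest) (rule ksd_nonneg)
  have Ilim: "I \<longlonglongrightarrow> 0"
  proof (rule order_tendstoI)
    fix a :: ereal assume "a < 0"
    then show "\<forall>\<^sub>F n in sequentially. a < I n" by (intro always_eventually allI) (rule less_le_trans[OF _ I0])
  next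
    fix a :: ereal assume "0 < a"
    then obtain r where r: "0 < ereal r" "ereal r < a" using ereal_dense2 by blast
    then have "\<forall>\<^sub>F n in sequentially. I n \<le> ereal r" by (intro Ismall) simp
    then show "\<forall>\<^sub>F n in sequentially. I n < a" by eventually_elim (use r in auto)
  qed
  have "(\<lambda>n. (D n - I n) + I n) \<longlonglongrightarrow> 0 + 0"
    using minimising Ilim unfolding D_def I_def by (intro tendsto_add_ereal) auto
  \<comment> \<open>In the extended reals a difference can be undone only if the subtrahend is
    finite; for \<open>I n\<close> this holds eventually.\<close>
  moreover have "\<forall>\<^sub>F n in sequentially. (D n - I n) + I n = D n"
    using Ismall[of 1]
  proof (rule eventually_mono)
    fix n assume "I n \<le> ereal 1"
    then obtain r where "I n = ereal r" using I0[of n] by (cases "I n") auto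
    then show "(D n - I n) + I n = D n" by (cases "D n") auto
  qed simp
  ultimately have Dlim: "D \<longlonglongrightarrow> 0" using Lim_transform_eventually by fastforce
  obtain r where r: "r > 0" "(\<lambda>x. r *\<^sub>R f x) \<in> rkhs_prod_unit_ball H ip" by (rule rkhs_fields_to_ball[OF f])
  have le: "ereal \<bar>r * (\<integral>x. stein_op p f x \<partial>distr Q borel (T n))\<bar> \<le> D n" for n
    using ksd_upper[OF r(2), of "distr Q borel (T n)"] by (simp add: D_def stein_op_scale[OF f])
  have "(\<lambda>n. ereal \<bar>r * (\<integral>x. stein_op p f x \<partial>distr Q borel (T n))\<bar>) \<longlonglongrightarrow> 0"
    by (rule tendsto_sandwich[OF _ _ tendsto_const Dlim]) (use le in auto)
  then have "(\<lambda>n. \<bar>r * (\<integral>x. stein_op p f x \<partial>distr Q borel (T n))\<bar>) \<longlonglongrightarrow> 0"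
    by (simp add: zero_ereal_def)
  then have "(\<lambda>n. r * (\<integral>x. stein_op p f x \<partial>distr Q borel (T n))) \<longlonglongrightarrow> 0"
    by (simp add: tendsto_rabs_zero_iff)
  then have "(\<lambda>n. (1 / r) * (r * (\<integral>x. stein_op p f x \<partial>distr Q borel (T n)))) \<longlonglongrightarrow> 0"
    by (rule tendsto_mult_right_zero)
  then show ?thesis using r(1) by simp
qed

text \<open>Taking the second point to be 0 at distance \<open>norm x\<close> bounds the inward
  drift from below by a quadratic minus a linear term; half of the quadratic absorbs the linear one.
  Small radii are left to the growth bound of the score.\<close>

lemma dissipative_bound:
  assumes "distantly_dissipative p"
  obtains \<kappa> C where "\<kappa> > 0" "C \<ge> 0" "\<And>x. \<kappa> * (norm x)\<^sup>2 - C \<le> - (score p x \<bullet> x)"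
proof -
  obtain A where A: "\<forall>\<^sub>F r in at_top. A r" "0 < (INF r\<in>{r. A r}. dissipativity_rate p r)"
    using assms unfolding distantly_dissipative_def Liminf_def less_SUP_iff by auto
  obtain k where k: "0 < ereal k" "ereal k < (INF r\<in>{r. A r}. dissipativity_rate p r)"
    using ereal_dense2[OF A(2)] by blast
  then have k0: "k > 0" by simp
  have Ak: "ereal k < dissipativity_rate p r" if "A r" for r
    using that by (intro less_le_trans[OF k(2)] INF_lower) simp
  obtain r0 where r0: "\<And>r. r \<ge> r0 \<Longrightarrow> ereal k < dissipativity_rate p r"
    using A(1) Ak unfolding eventually_at_top_linorder by blast
  define r1 where "r1 = max r0 1"
  define s0 where "s0 = norm (score p 0)"
  have r1: "r1 \<ge> 1" "r1 \<ge> r0" and s0: "s0 \<ge> 0" by (auto simp: r1_def s0_def)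
  \<comment> \<open>The first summand completes the square in
    \<open>k / 2 * r\<^sup>2 - s0 * r\<close>; the other two bound the quadratic term and the inner
    product for \<open>norm x < r1\<close>.\<close>
  define C where "C = s0\<^sup>2 / (2 * k) + (k / 2) * r1\<^sup>2 + (s0 + score_Lip * r1) * r1"
  have C1: "s0\<^sup>2 / (2 * k) \<ge> 0" "(k / 2) * r1\<^sup>2 \<ge> 0" "(s0 + score_Lip * r1) * r1 \<ge> 0"
    using k0 r1 s0 score_Lip_nonneg by auto
  show ?thesis
  proof (rule that[of "k / 2" C])
    show "k / 2 > 0" using k0 by simp
    show "C \<ge> 0" using C1 by (simp add: C_def)
    fix x
    show "k / 2 * (norm x)\<^sup>2 - C \<le> - (score p x \<bullet> x)"
    proof (cases "norm x \<ge> r1")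
      case True
      define r where "r = norm x"
      have r: "r \<ge> 1" "r \<ge> r0" using True r1 by (auto simp: r_def)
      define v where "v = - ((score p x - score p 0) \<bullet> x)"
      have "ereal k < dissipativity_rate p r" by (rule r0[OF r(2)])
      also have "\<dots> \<le> ereal (1 / r\<^sup>2) * ereal v"
        unfolding dissipativity_rate_def
        by (intro ereal_mult_left_mono INF_lower2[of "(x, 0)"]) (auto simp: r_def v_def)
      finally have "k < v / r\<^sup>2" by simp
      then have v: "k * r\<^sup>2 \<le> v" using r by (simp add: pos_less_divide_eq)
      have "score p 0 \<bullet> x \<le> s0 * r" unfolding s0_def r_def by (rule norm_cauchy_schwarz)
      moreover have "0 \<le> (k * r - s0)\<^sup>2 / (2 * k)" using k0 by simp
      moreover have "(k * r - s0)\<^sup>2 / (2 * k) = k / 2 * r\<^sup>2 - s0 * r + s0\<^sup>2 / (2 * k)"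
        using k0 by (simp add: power2_eq_square field_simps)
      moreover have "- (score p x \<bullet> x) = v - score p 0 \<bullet> x" by (simp add: v_def inner_diff_left)
      moreover have "k * r\<^sup>2 = k / 2 * r\<^sup>2 + k / 2 * r\<^sup>2" by simp
      ultimately show ?thesis using v C1 unfolding C_def r_def[symmetric] by linarith
    next
      case False
      have "score p x \<bullet> x \<le> norm (score p x) * norm x" by (rule norm_cauchy_schwarz)
      also have "\<dots> \<le> (s0 + score_Lip * r1) * r1"
        using False score_growth[of x] score_Lip_nonneg s0 r1
        by (intro mult_mono order_trans[OF score_growth]) (auto simp: s0_def intro!: mult_left_mono)
      finally have "score p x \<bullet> x \<le> (s0 + score_Lip * r1) * r1" .
      moreover have "k / 2 * (norm x)\<^sup>2 \<le> k / 2 * r1\<^sup>2"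
        using False k0 by (intro mult_left_mono power_mono) auto
      ultimately show ?thesis using C1 unfolding C_def by linarith
    qed
  qed
qed

end

section \<open>Tightness and uniform approximation of Stein operators\<close>

text \<open>Collects what the minimisation says about the laws; the maps, \<open>Q\<close> and the
  discrepancy itself have been eliminated.\<close>

locale stein_null_sequence = stein_setting c l \<beta> H ip p P
  for c l \<beta> :: real and H :: "(real ^ 'd \<Rightarrow> real) set"
    and ip :: "(real ^ 'd \<Rightarrow> real) \<Rightarrow> (real ^ 'd \<Rightarrow> real) \<Rightarrow> real" and p P +
  fixes \<mu> :: "nat \<Rightarrow> (real ^ 'd) measure"
  assumes prob_\<mu>: "\<And>n. prob_space (\<mu> n)" and sets_\<mu>[measurable_cong]: "\<And>n. sets (\<mu> n) = sets borel"
    and \<mu>_norm: "\<And>n. integrable (\<mu> n) norm"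
    and null: "\<And>f. f \<in> rkhs_fields \<Longrightarrow> (\<lambda>n. \<integral>x. stein_op p f x \<partial>\<mu> n) \<longlonglongrightarrow> 0"
begin

text \<open>A Markov inequality with the Stein operator in place of the norm. The gain
  \<open>\<kappa> / 2\<close> outside the ball does not depend on \<open>a\<close>, whereas the
  possible loss \<open>C' / a\<close> can be made small; only the radius pays for a large
  \<open>a\<close>.\<close>

lemma tight:
  assumes "distantly_dissipative p" and eps: "\<epsilon> > 0"
  obtains R where "R > 0" "\<forall>\<^sub>F n in sequentially. measure (\<mu> n) {x. norm x \<ge> R} \<le> \<epsilon>"
proof -
  obtain \<kappa> C where \<kappa>: "\<kappa> > 0" and C: "C \<ge> 0" and diss: "\<And>x. \<kappa> * (norm x)\<^sup>2 - C \<le> - (score p x \<bullet> x)"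
    by (rule dissipative_bound[OF assms(1)]) blast
  \<comment> \<open>The divergence is at least
    \<open>- (real CARD('d) / (a + (norm x)\<^sup>2))\<close>, as the other terms of the partial
    derivatives are nonnegative.\<close>
  define C' where "C' = C + real CARD('d)"
  have C': "C' > 0" using C by (simp add: C'_def add_nonneg_pos)
  \<comment> \<open>The first entry is what \<open>radial_mem\<close> demands; the second makes
    \<open>C' / a\<close> at most \<open>\<epsilon> * \<kappa> / 4\<close>, half of the budget after
    the factor \<open>2 / \<kappa>\<close>.\<close>
  define a where "a = max (c\<^sup>2 * l\<^sup>2) (4 * C' / (\<epsilon> * \<kappa>))"
  have a: "a \<ge> c\<^sup>2 * l\<^sup>2" "C' / a \<le> \<epsilon> * \<kappa> / 4" "a > 0"
  proof -
    have q: "4 * C' / (\<epsilon> * \<kappa>) > 0" using C' eps \<kappa> by simp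
    show "a \<ge> c\<^sup>2 * l\<^sup>2" by (simp add: a_def)
    show a0: "a > 0" using q by (simp add: a_def less_max_iff_disj)
    have "4 * C' / (\<epsilon> * \<kappa>) \<le> a" by (simp add: a_def)
    then show "C' / a \<le> \<epsilon> * \<kappa> / 4" using eps \<kappa> a0 by (simp add: field_simps)
  qed
  define f :: "real ^ 'd \<Rightarrow> real ^ 'd" where "f x = - (x /\<^sub>R (a + (norm x)\<^sup>2))" for x
  have A: "a + (norm x)\<^sup>2 > 0" for x :: "real ^ 'd" using a(3) by (simp add: add_pos_nonneg)
  have fi: "(\<lambda>x. f x $ i) = (\<lambda>x. (-1) * (x $ i / (a + (norm x)\<^sup>2)))" for i
    by (simp add: f_def fun_eq_iff divide_inverse mult.commute)
  have f: "f \<in> rkhs_fields" unfolding rkhs_fields_def mem_Collect_eq fi by (intro allI scale_mem radial_mem a(1))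
  have pdf: "partial_deriv i (\<lambda>x. f x $ i) x = - (1 / (a + (norm x)\<^sup>2)) + 2 * (x $ i)\<^sup>2 / (a + (norm x)\<^sup>2)\<^sup>2" for i x
    unfolding fi
  proof (rule partial_deriv_eqI)
    have e: "(norm (x + t *\<^sub>R axis i 1))\<^sup>2 = (norm x)\<^sup>2 + 2 * t * x $ i + t\<^sup>2" for t
      unfolding power2_norm_eq_inner
      by (simp add: inner_add_left inner_add_right inner_axis inner_axis' power2_eq_square algebra_simps)
    define q where "q t = a + ((norm x)\<^sup>2 + 2 * t * x $ i + t\<^sup>2)" for t
    have q0: "q 0 = a + (norm x)\<^sup>2" by (simp add: q_def)
    have "(q has_real_derivative 2 * x $ i) (at 0)"
      unfolding q_def[abs_def] by (auto intro!: derivative_eq_intros)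
    moreover have "((\<lambda>t. x $ i + t) has_real_derivative 1) (at 0)" by (auto intro!: derivative_eq_intros)
    ultimately have "((\<lambda>t. (-1) * ((x $ i + t) / q t)) has_real_derivative
       (-1) * ((1 * q 0 - (x $ i + 0) * (2 * x $ i)) / (q 0 * q 0))) (at 0)"
      using A[of x] by (intro DERIV_cmult DERIV_divide) (auto simp: q0)
    also have "(-1) * ((1 * q 0 - (x $ i + 0) * (2 * x $ i)) / (q 0 * q 0)) =
       - (1 / (a + (norm x)\<^sup>2)) + 2 * (x $ i)\<^sup>2 / (a + (norm x)\<^sup>2)\<^sup>2"
      using A[of x] unfolding q0 by (simp add: diff_divide_distrib power2_eq_square)
    finally have "((\<lambda>t. (-1) * ((x $ i + t) / (a + ((norm x)\<^sup>2 + 2 * t * x $ i + t\<^sup>2)))) has_real_derivative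
       - (1 / (a + (norm x)\<^sup>2)) + 2 * (x $ i)\<^sup>2 / (a + (norm x)\<^sup>2)\<^sup>2) (at 0)"
      unfolding q_def .
    then show "((\<lambda>t. (-1) * ((x + t *\<^sub>R axis i 1) $ i / (a + (norm (x + t *\<^sub>R axis i 1))\<^sup>2))) has_real_derivative
       - (1 / (a + (norm x)\<^sup>2)) + 2 * (x $ i)\<^sup>2 / (a + (norm x)\<^sup>2)\<^sup>2) (at 0)"
      unfolding e by simp
  qed
  have lower: "(\<kappa> * (norm x)\<^sup>2 - C') / (a + (norm x)\<^sup>2) \<le> stein_op p f x" for x
  proof -
    have "divergence f x \<ge> (\<Sum>i\<in>(UNIV::'d set). - (1 / (a + (norm x)\<^sup>2)))"
      unfolding divergence_eq_partial_deriv pdf by (intro sum_mono) (simp add: A less_imp_le)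
    then have "divergence f x \<ge> - (real CARD('d) / (a + (norm x)\<^sup>2))" by simp
    moreover have "f x \<bullet> score p x = - (score p x \<bullet> x) / (a + (norm x)\<^sup>2)"
      by (simp add: f_def inner_commute divide_inverse mult.commute)
    moreover have "(\<kappa> * (norm x)\<^sup>2 - C) / (a + (norm x)\<^sup>2) \<le> - (score p x \<bullet> x) / (a + (norm x)\<^sup>2)"
      using diss[of x] A[of x] by (intro divide_right_mono) auto
    moreover have "(\<kappa> * (norm x)\<^sup>2 - C') / (a + (norm x)\<^sup>2) = (\<kappa> * (norm x)\<^sup>2 - C) / (a + (norm x)\<^sup>2) - real CARD('d) / (a + (norm x)\<^sup>2)"
      by (simp add: C'_def diff_divide_distrib add_divide_distrib)
    ultimately show ?thesis by (simp add: stein_op_def)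
  qed
  \<comment> \<open>\<open>u = R\<^sup>2\<close> solves
    \<open>(\<kappa> * u - C') / (a + u) = \<kappa> / 2\<close>, and the quotient increases with
    \<open>u\<close>.\<close>
  define R where "R = sqrt (a + 2 * C' / \<kappa>)"
  have R2: "a + 2 * C' / \<kappa> > 0" using a(3) C' \<kappa> by (simp add: add_pos_pos)
  have R: "R > 0" using R2 by (simp add: R_def)
  have low2: "\<kappa> / 2 * indicator {x. norm x \<ge> R} x - C' / a \<le> stein_op p f x" for x
  proof -
    define u where "u = (norm x)\<^sup>2"
    have Au: "a + u > 0" "u \<ge> 0" using A[of x] by (auto simp: u_def)
    have f1: "- (C' / a) \<le> (\<kappa> * u - C') / (a + u)"
    proof -
      have "C' / (a + u) \<le> C' / a" using C' a(3) Au by (intro divide_left_mono) auto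
      moreover have "\<kappa> * u / (a + u) \<ge> 0" using \<kappa> Au by simp
      ultimately show ?thesis by (simp add: diff_divide_distrib)
    qed
    have f2: "\<kappa> / 2 \<le> (\<kappa> * u - C') / (a + u)" if "norm x \<ge> R"
    proof -
      have "R\<^sup>2 \<le> u" unfolding u_def using that R by (intro power_mono) auto
      then have "a + 2 * C' / \<kappa> \<le> u" using R2 by (simp add: R_def)
      then have "\<kappa> * (a + 2 * C' / \<kappa>) \<le> \<kappa> * u" using \<kappa> by (intro mult_left_mono) auto
      then have "\<kappa> * a + 2 * C' \<le> \<kappa> * u" using \<kappa> by (simp add: algebra_simps)
      then show ?thesis using Au by (simp add: field_simps)
    qed
    have f3: "C' / a > 0" using C' a(3) by simp
    have lo: "(\<kappa> * u - C') / (a + u) \<le> stein_op p f x" using lower[of x] by (simp only: u_def)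
    show ?thesis
    proof (cases "norm x \<ge> R")
      case True
      then have "\<kappa> / 2 * indicator {x. norm x \<ge> R} x = \<kappa> / 2" by simp
      then show ?thesis using f2[OF True] f3 lo by linarith
    next
      case False
      then have "\<kappa> / 2 * indicator {x. norm x \<ge> R} x = 0" by simp
      then show ?thesis using f1 lo by linarith
    qed
  qed
  have bound: "measure (\<mu> n) {x. norm x \<ge> R} \<le> (2 / \<kappa>) * (C' / a + (\<integral>x. stein_op p f x \<partial>\<mu> n))" for n
  proof -
    interpret \<mu>: prob_space "\<mu> n" by (rule prob_\<mu>)
    have m: "{x. norm x \<ge> R} \<in> sets (\<mu> n)" unfolding sets_\<mu> by measurable
    have i1: "integrable (\<mu> n) (\<lambda>x. \<kappa> / 2 * indicator {x. norm x \<ge> R} x)"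
      using m by (intro integrable_mult_right integrable_real_indicator) (auto simp: \<mu>.emeasure_eq_measure)
    have "\<kappa> / 2 * measure (\<mu> n) {x. norm x \<ge> R} - C' / a = (\<integral>x. \<kappa> / 2 * indicator {x. norm x \<ge> R} x - C' / a \<partial>\<mu> n)"
      using m by (subst Bochner_Integration.integral_diff[OF i1 \<mu>.integrable_const]) (simp add: \<mu>.prob_space)
    also have "\<dots> \<le> (\<integral>x. stein_op p f x \<partial>\<mu> n)"
      by (intro integral_mono low2 rkhs_fields_stein_integrable f prob_\<mu> sets_\<mu> \<mu>_norm
          Bochner_Integration.integrable_diff i1 \<mu>.integrable_const)
    finally show ?thesis using \<kappa> by (simp add: field_simps)
  qed
  have "\<forall>\<^sub>F n in sequentially. (\<integral>x. stein_op p f x \<partial>\<mu> n) < \<epsilon> * \<kappa> / 4"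
    using eps \<kappa> by (intro order_tendstoD[OF null[OF f]]) simp
  then have "\<forall>\<^sub>F n in sequentially. measure (\<mu> n) {x. norm x \<ge> R} \<le> \<epsilon>"
  proof eventually_elim
    case (elim n)
    have "(2 / \<kappa>) * (C' / a + (\<integral>x. stein_op p f x \<partial>\<mu> n)) \<le> (2 / \<kappa>) * (\<epsilon> * \<kappa> / 4 + \<epsilon> * \<kappa> / 4)"
 
    proof (rule mult_left_mono)
      show "C' / a + (\<integral>x. stein_op p f x \<partial>\<mu> n) \<le> \<epsilon> * \<kappa> / 4 + \<epsilon> * \<kappa> / 4" using elim a(2) by linarith
    qed (use \<kappa> in simp)
    also have "\<dots> = \<epsilon>" using \<kappa> by simp
    finally show ?case using bound[of n] by simp
  qed
  with R show ?thesis by (rule that)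
qed

text \<open>Mollifying \<open>f\<close> moves \<open>score p\<close> by at most \<open>score_Lip\<close> times the first moment of the mollifier,
  so the Stein operator of \<open>f\<close> in direction \<open>i\<close> is a uniform limit of Stein operators of members.\<close>

lemma test_function_null:
  fixes f f' :: "real ^ 'd \<Rightarrow> real" and i :: 'd
  defines "w \<equiv> \<lambda>x. f x * score p x $ i + f' x"
  assumes f[measurable]: "f \<in> borel_measurable borel" and B: "\<And>x. \<bar>f x\<bar> \<le> B" and f2: "integrable lborel (\<lambda>x. (f x)\<^sup>2)"
    and f': "\<And>x. ((\<lambda>t. f (x + t *\<^sub>R axis i 1)) has_real_derivative f' x) (at 0)"
    and f'_m[measurable]: "f' \<in> borel_measurable borel" and B': "\<And>x. \<bar>f' x\<bar> \<le> B'"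
    and W: "\<And>x. \<bar>w x\<bar> \<le> W" and uc: "uniformly_continuous_on UNIV w"
  shows "(\<lambda>n. \<integral>x. w x \<partial>\<mu> n) \<longlonglongrightarrow> 0"
proof (rule tendstoI)
  fix \<epsilon> :: real assume eps: "\<epsilon> > 0"
  have [measurable]: "(\<lambda>x. score p x $ i) \<in> borel_measurable borel"
    using score_cont by (intro borel_measurable_continuous_onI continuous_on_component)
  have [measurable]: "w \<in> borel_measurable borel" unfolding w_def by measurable
  have B0: "B \<ge> 0" "B' \<ge> 0" "W \<ge> 0" using order_trans[OF abs_ge_zero B] order_trans[OF abs_ge_zero B'] order_trans[OF abs_ge_zero W] by auto
  obtain \<delta> where \<delta>: "\<delta> > 0" and ucd: "\<And>x y. norm (x - y) < \<delta> \<Longrightarrow> \<bar>w x - w y\<bar> < \<epsilon> / 8"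
    using uc eps unfolding uniformly_continuous_on_def dist_norm real_norm_def
    by (metis UNIV_I zero_less_divide_iff zero_less_numeral)
  \<comment> \<open>Cost per unit of displacement: moving the score costs
    \<open>score_Lip * B\<close>; a displacement of at least \<open>\<delta>\<close>, beyond the
    reach of uniform continuity, changes \<open>w\<close> by at most \<open>2 * W\<close>, which is
    charged to \<open>norm v / \<delta>\<close>.\<close>
  define M where "M = score_Lip * B + 2 * W / \<delta>"
  have M: "M \<ge> 0" using score_Lip_nonneg B0 \<delta> by (simp add: M_def)
  define D where "D = sqrt 2 ^ DIM(real ^ 'd)"
  \<comment> \<open>The precision at which \<open>D / sqrt S\<close> equals
    \<open>\<epsilon> / (8 * (M + 1))\<close>; adding 1 covers \<open>M = 0\<close>.\<close>
  define S where "S = (8 * (M + 1) * D / \<epsilon>)\<^sup>2"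
  have D: "D > 0" by (simp add: D_def)
  have S: "S > 0" using M D eps by (simp add: S_def)
  obtain N :: "(real ^ 'd) measure" where N: "prob_space N" and sN[measurable_cong]: "sets N = sets borel"
    and N1: "integrable N norm" and Nm: "(\<integral>w. norm w \<partial>N) \<le> D / sqrt S"
    and NH: "\<And>f B. f \<in> borel_measurable borel \<Longrightarrow> (\<And>x. \<bar>f x\<bar> \<le> B) \<Longrightarrow> integrable lborel (\<lambda>x. (f x)\<^sup>2) \<Longrightarrow>
       (\<lambda>x. \<integral>w. f (x - w) \<partial>N) \<in> H"
    using mollifier[OF S] unfolding D_def by metis
  interpret N: prob_space N by (rule N)
  have m: "M * (\<integral>v. norm v \<partial>N) \<le> \<epsilon> / 8"
  proof -
    have "sqrt S = 8 * (M + 1) * D / \<epsilon>" using M D eps by (simp add: S_def)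
    then have "D / sqrt S = D / (D * (8 * (M + 1) / \<epsilon>))" by (simp add: mult_ac)
    also have "\<dots> = \<epsilon> / (8 * (M + 1))" using D by simp
    finally have "D / sqrt S = \<epsilon> / (8 * (M + 1))" .
    then have "M * (\<integral>v. norm v \<partial>N) \<le> M * (\<epsilon> / (8 * (M + 1)))" using Nm M by (intro mult_left_mono) auto
    also have "\<dots> \<le> \<epsilon> / 8" using M eps by (simp add: field_simps)
    finally show ?thesis .
  qed
  define F where "F x = (\<integral>v. f (x - v) \<partial>N)" for x
  have FH: "F \<in> H" unfolding F_def[abs_def] by (rule NH[OF f B f2])
  have fv: "integrable N (\<lambda>v. f (x - v))" for x by (rule N.integrable_const_bound[where B = B]) (use B in auto)
  have f'v: "integrable N (\<lambda>v. f' (x - v))" for x by (rule N.integrable_const_bound[where B = B']) (use B' in auto)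
  have wv: "integrable N (\<lambda>v. w (x - v))" for x by (rule N.integrable_const_bound[where B = W]) (use W in auto)
  have fD: "((\<lambda>t. f (x + t *\<^sub>R axis i 1)) has_real_derivative f' (x + t *\<^sub>R axis i 1)) (at t within A)" for x t A
  proof -
    have "((\<lambda>u. f ((x + t *\<^sub>R axis i 1) + u *\<^sub>R axis i 1)) has_real_derivative f' (x + t *\<^sub>R axis i 1)) (at 0)" by (rule f')
    then have "((\<lambda>u. f (x + (u + t) *\<^sub>R axis i 1)) has_real_derivative f' (x + t *\<^sub>R axis i 1)) (at 0)"
      by (simp add: algebra_simps)
    then show ?thesis using DERIV_shift[of "\<lambda>t. f (x + t *\<^sub>R axis i 1)" _ 0 t] has_field_derivative_at_within by fastforce
  qed
  have fL: "\<bar>f (x + t *\<^sub>R axis i 1) - f x\<bar> \<le> B' * \<bar>t\<bar>" for x t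
    using field_differentiable_bound[of UNIV "\<lambda>t. f (x + t *\<^sub>R axis i 1)" "\<lambda>t. f' (x + t *\<^sub>R axis i 1)" B' t 0] fD B'
    by auto
  \<comment> \<open>Membership in \<open>H\<close> already makes \<open>F\<close> differentiable
    along the axis; only the value is to be identified, for which dominated convergence along one
    sequence of steps suffices.\<close>
  have pdF: "partial_deriv i F x = (\<integral>v. f' (x - v) \<partial>N)" for x
  proof -
    define r where "r n = 1 / real (Suc n)" for n
    have r: "r n > 0" for n by (simp add: r_def)
    have rlim: "filterlim r (at 0) sequentially"
      unfolding filterlim_at r_def[abs_def] using LIMSEQ_inverse_real_of_nat by (auto simp: inverse_eq_divide)
    have q: "(\<lambda>n. (F (x + r n *\<^sub>R axis i 1) - F x) / r n) \<longlonglongrightarrow> partial_deriv i F x"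
      using filterlim_compose[OF reg_const(4)[OF FH, of x i, unfolded DERIV_def] rlim] by simp
    have "(\<lambda>n. \<integral>v. (f (x - v + r n *\<^sub>R axis i 1) - f (x - v)) / r n \<partial>N) \<longlonglongrightarrow> (\<integral>v. f' (x - v) \<partial>N)"
    proof (rule integral_dominated_convergence[where w = "\<lambda>_. B'"])
      show "AE v in N. (\<lambda>n. (f (x - v + r n *\<^sub>R axis i 1) - f (x - v)) / r n) \<longlonglongrightarrow> f' (x - v)"
        using filterlim_compose[OF f'[unfolded DERIV_def] rlim] by (intro AE_I2) simp
      show "AE v in N. norm ((f (x - v + r n *\<^sub>R axis i 1) - f (x - v)) / r n) \<le> B'" for n
      proof (rule AE_I2)
        fix v
        show "norm ((f (x - v + r n *\<^sub>R axis i 1) - f (x - v)) / r n) \<le> B'"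
          using fL[of "x - v" "r n"] r[of n] by (simp add: divide_le_eq)
      qed
    qed auto
    moreover have "(\<integral>v. (f (x - v + r n *\<^sub>R axis i 1) - f (x - v)) / r n \<partial>N) = (F (x + r n *\<^sub>R axis i 1) - F x) / r n" for n
    proof -
      have "(\<integral>v. (f (x - v + r n *\<^sub>R axis i 1) - f (x - v)) / r n \<partial>N) = (\<integral>v. f (x + r n *\<^sub>R axis i 1 - v) - f (x - v) \<partial>N) / r n"
        by (simp add: algebra_simps)
      also have "\<dots> = (F (x + r n *\<^sub>R axis i 1) - F x) / r n"
        unfolding F_def by (subst Bochner_Integration.integral_diff[OF fv fv]) (rule refl)
      finally show ?thesis .
    qed
    ultimately have "(\<lambda>n. (F (x + r n *\<^sub>R axis i 1) - F x) / r n) \<longlonglongrightarrow> (\<integral>v. f' (x - v) \<partial>N)" by (simp only:)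
    with q show ?thesis by (rule LIMSEQ_unique)
  qed
  define V where "V x = axis i (F x)" for x
  have Vj: "(\<lambda>x. V x $ j) = (if j = i then F else (\<lambda>x. 0))" for j
    by (auto simp: V_def axis_def)
  have V: "V \<in> rkhs_fields" unfolding rkhs_fields_def mem_Collect_eq Vj using FH zero_mem by simp
  have pd0: "partial_deriv j (\<lambda>x. 0) x = 0" for j x by (rule partial_deriv_eqI) simp
  have steinV: "stein_op p V x = F x * score p x $ i + partial_deriv i F x" for x
  proof -
    have "stein_op p V x = (\<Sum>j\<in>UNIV. if j = i then F x * score p x $ i + partial_deriv i F x else 0)"
      unfolding stein_op_eq Vj by (intro sum.cong refl) (auto simp: pd0 V_def axis_def)
    then show ?thesis by simp
  qed
  have close: "\<bar>stein_op p V x - w x\<bar> \<le> \<epsilon> / 4" for x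
  proof -
    have "stein_op p V x - w x = (\<integral>v. f (x - v) * score p x $ i \<partial>N) + (\<integral>v. f' (x - v) \<partial>N) - (\<integral>v. w x \<partial>N)"
      unfolding steinV pdF by (simp add: F_def N.prob_space)
    also have "\<dots> = (\<integral>v. f (x - v) * score p x $ i + f' (x - v) - w x \<partial>N)"
      using fv f'v by (simp add: N.prob_space)
    also have "\<bar>\<dots>\<bar> \<le> (\<integral>v. \<bar>f (x - v) * score p x $ i + f' (x - v) - w x\<bar> \<partial>N)" by (rule integral_abs_bound)
    also have "\<dots> \<le> (\<integral>v. M * norm v + \<epsilon> / 8 \<partial>N)"
    proof (intro integral_mono Bochner_Integration.integrable_add integrable_mult_right N1 N.integrable_const
        integrable_abs Bochner_Integration.integrable_diff integrable_mult_left fv f'v)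
      fix v
      \<comment> \<open>Regrouping around \<open>w (x - v)\<close> hides the derivative
        \<open>f'\<close> inside \<open>w\<close>, so that uniform continuity of \<open>w\<close>
        alone controls it.\<close>
      have "f (x - v) * score p x $ i + f' (x - v) - w x
         = f (x - v) * (score p x - score p (x - v)) $ i + (w (x - v) - w x)"
        by (simp add: w_def algebra_simps)
      moreover have "\<bar>f (x - v) * (score p x - score p (x - v)) $ i\<bar> \<le> B * (score_Lip * norm v)"
        unfolding abs_mult
        using B B0 score_Lip[of x "x - v"] order_trans[OF component_le_norm_cart score_Lip[of x "x - v"]]
        by (intro mult_mono) auto
      moreover have "\<bar>w (x - v) - w x\<bar> \<le> 2 * W / \<delta> * norm v + \<epsilon> / 8"
      proof (cases "norm v < \<delta>")
        case True
        then have "\<bar>w (x - v) - w x\<bar> < \<epsilon> / 8" by (intro ucd) simp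
        moreover have "2 * W / \<delta> * norm v \<ge> 0" using B0 \<delta> by simp
        ultimately show ?thesis by linarith
      next
        case False
        then have "2 * W \<le> 2 * W / \<delta> * norm v" using B0 \<delta> by (simp add: field_simps mult_left_mono)
        then show ?thesis using W[of "x - v"] W[of x] eps by linarith
      qed
      ultimately have "\<bar>f (x - v) * score p x $ i + f' (x - v) - w x\<bar> \<le> B * (score_Lip * norm v) + (2 * W / \<delta> * norm v + \<epsilon> / 8)"
        by linarith
      then show "\<bar>f (x - v) * score p x $ i + f' (x - v) - w x\<bar> \<le> M * norm v + \<epsilon> / 8"
        by (simp add: M_def algebra_simps)
    qed
    also have "\<dots> = M * (\<integral>v. norm v \<partial>N) + \<epsilon> / 8" using N1 by (simp add: N.prob_space)
    finally show ?thesis using m by linarith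
  qed
  have "\<forall>\<^sub>F n in sequentially. dist (\<integral>x. stein_op p V x \<partial>\<mu> n) 0 < \<epsilon> / 2"
    using eps by (intro tendstoD[OF null[OF V]]) simp
  then show "\<forall>\<^sub>F n in sequentially. dist (\<integral>x. w x \<partial>\<mu> n) 0 < \<epsilon>"
  proof eventually_elim
    case (elim n)
    interpret \<mu>: prob_space "\<mu> n" by (rule prob_\<mu>)
    have wi: "integrable (\<mu> n) w" by (rule \<mu>.integrable_const_bound[where B = W]) (use W in auto)
    have si: "integrable (\<mu> n) (stein_op p V)" by (intro rkhs_fields_stein_integrable V prob_\<mu> sets_\<mu> \<mu>_norm)
    have "\<bar>(\<integral>x. stein_op p V x \<partial>\<mu> n) - (\<integral>x. w x \<partial>\<mu> n)\<bar> = \<bar>\<integral>x. stein_op p V x - w x \<partial>\<mu> n\<bar>"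
      using wi si by simp
    also have "\<dots> \<le> (\<integral>x. \<bar>stein_op p V x - w x\<bar> \<partial>\<mu> n)" by (rule integral_abs_bound)
    also have "\<dots> \<le> (\<integral>x. \<epsilon> / 4 \<partial>\<mu> n)"
      using wi si by (intro integral_mono close) auto
    also have "\<dots> = \<epsilon> / 4" by (simp add: \<mu>.prob_space)
    finally have "\<bar>(\<integral>x. stein_op p V x \<partial>\<mu> n) - (\<integral>x. w x \<partial>\<mu> n)\<bar> \<le> \<epsilon> / 4" .
    with elim eps show ?case by (auto simp: dist_real_def abs_if split: if_splits)
  qed
qed

end

section \<open>Compactly supported test functions\<close>

lemma compact_support_bounded:
  fixes g :: "'a::euclidean_space \<Rightarrow> real"
  assumes cont: "continuous_on UNIV g" and supp: "\<And>x. norm x > R \<Longrightarrow> g x = 0"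
  obtains B where "B > 0" "\<And>x. \<bar>g x\<bar> \<le> B"
proof -
  have "compact (g ` cball 0 R)"
    by (intro compact_continuous_image continuous_on_subset[OF cont]) auto
  then obtain B where B: "B > 0" "\<And>x. x \<in> cball 0 R \<Longrightarrow> \<bar>g x\<bar> \<le> B"
    using compact_imp_bounded bounded_pos by (metis imageI real_norm_def)
  show ?thesis
  proof (rule that[OF B(1)])
    show "\<bar>g x\<bar> \<le> B" for x using B(1) B(2)[of x] supp[of x] by (cases "norm x \<le> R") auto
  qed
qed

lemma compact_support_uniformly_continuous:
  fixes g :: "'a::euclidean_space \<Rightarrow> real"
  assumes cont: "continuous_on UNIV g" and supp: "\<And>x. norm x > R \<Longrightarrow> g x = 0"
  shows "uniformly_continuous_on UNIV g"
  unfolding uniformly_continuous_on_def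
proof (intro allI impI)
  fix e :: real assume e: "e > 0"
  have "uniformly_continuous_on (cball 0 (R + 1)) g"
    by (intro compact_uniformly_continuous continuous_on_subset[OF cont]) auto
  then obtain d where d: "d > 0" "\<And>x y. x \<in> cball 0 (R + 1) \<Longrightarrow> y \<in> cball 0 (R + 1) \<Longrightarrow> dist y x < d \<Longrightarrow> dist (g y) (g x) < e"
    using e unfolding uniformly_continuous_on_def by meson
  have "dist (g y) (g x) < e" if xy: "dist y x < min d 1" for x y
  proof (cases "norm x \<le> R \<or> norm y \<le> R")
    case True
    have "norm x \<le> norm y + dist y x" "norm y \<le> norm x + dist y x"
      using norm_triangle_sub[of x y] norm_triangle_sub[of y x] by (auto simp: dist_norm norm_minus_commute)
    then show ?thesis using True xy by (intro d(2)) auto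
  qed (use e supp in auto)
  then show "\<exists>d>0. \<forall>x\<in>UNIV. \<forall>x'\<in>UNIV. dist x' x < d \<longrightarrow> dist (g x') (g x) < e"
    using d(1) by (intro exI[of _ "min d 1"]) auto
qed

lemma compact_support_integrable:
  fixes g :: "'a::euclidean_space \<Rightarrow> real"
  assumes cont: "continuous_on UNIV g" and supp: "\<And>x. norm x > R \<Longrightarrow> g x = 0"
  shows "integrable lborel g"
proof -
  have "integrable lborel (\<lambda>x. indicator (cball 0 R) x *\<^sub>R g x)"
    by (intro borel_integrable_compact continuous_on_subset[OF cont]) auto
  also have "(\<lambda>x. indicator (cball 0 R) x *\<^sub>R g x) = g" using supp by (auto simp: indicator_def fun_eq_iff)
  finally show ?thesis .
qed

text \<open>Squaring removes the kink: in every sign pattern of \<open>v\<close> and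
  \<open>v + h\<close> the first-order remainder is at most \<open>h\<^sup>2\<close>.\<close>

lemma DERIV_pos_part_sq: "((\<lambda>v::real. (max 0 v)\<^sup>2) has_real_derivative 2 * max 0 v) (at v)"
proof -
  define q where "q v = (max 0 v)\<^sup>2" for v :: real
  have le: "\<bar>(q (v + h) - q v) / h - 2 * max 0 v\<bar> \<le> \<bar>h\<bar>" if "h \<noteq> 0" for h
  proof -
    have "\<bar>q (v + h) - q v - 2 * max 0 v * h\<bar> \<le> h\<^sup>2"
    proof (cases "v \<ge> 0"; cases "v + h \<ge> 0")
      assume a: "v \<ge> 0" "v + h \<ge> 0"
      then show ?thesis by (simp add: q_def power2_eq_square algebra_simps)
    next
      assume a: "v \<ge> 0" "\<not> v + h \<ge> 0"
      have "0 \<le> v * (- 2 * h - v)" using a by (intro mult_nonneg_nonneg) auto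
      then have "v\<^sup>2 + 2 * v * h \<le> 0" by (simp add: power2_eq_square algebra_simps)
      then have "v\<^sup>2 + 2 * v * h \<le> h\<^sup>2" using zero_le_power2[of h] by linarith
      moreover have "- (v\<^sup>2 + 2 * v * h) \<le> h\<^sup>2"
        using zero_le_power2[of "v + h"] by (simp add: power2_eq_square algebra_simps)
      moreover have "q (v + h) - q v - 2 * max 0 v * h = - (v\<^sup>2 + 2 * v * h)" using a by (simp add: q_def)
      ultimately show ?thesis by (simp add: abs_le_iff)
    next
      assume a: "\<not> v \<ge> 0" "v + h \<ge> 0"
      then have "(v + h)\<^sup>2 \<le> h\<^sup>2" by (intro power_mono) auto
      with a show ?thesis by (simp add: q_def)
    next
      assume "\<not> v \<ge> 0" "\<not> v + h \<ge> 0"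
      then show ?thesis by (simp add: q_def)
    qed
    then have "\<bar>q (v + h) - q v - 2 * max 0 v * h\<bar> / \<bar>h\<bar> \<le> h\<^sup>2 / \<bar>h\<bar>" by (rule divide_right_mono) simp
    moreover have "\<bar>q (v + h) - q v - 2 * max 0 v * h\<bar> / \<bar>h\<bar> = \<bar>(q (v + h) - q v) / h - 2 * max 0 v\<bar>"
      using that by (simp add: abs_divide[symmetric] diff_divide_distrib)
    moreover have "h\<^sup>2 / \<bar>h\<bar> = \<bar>h\<bar>" by (simp add: power2_eq_square abs_if)
    ultimately show ?thesis by simp
  qed
  have "((\<lambda>h. (q (v + h) - q v) / h - 2 * max 0 v) \<longlongrightarrow> 0) (at 0)"
  proof (rule Lim_null_comparison)
    show "\<forall>\<^sub>F h in at 0. norm ((q (v + h) - q v) / h - 2 * max 0 v) \<le> \<bar>h\<bar>"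
      using le by (auto simp: eventually_at_filter)
    show "((\<lambda>h::real. \<bar>h\<bar>) \<longlongrightarrow> 0) (at 0)" by (intro tendsto_rabs_zero tendsto_ident_at)
  qed
  then have "((\<lambda>h. (q (v + h) - q v) / h) \<longlongrightarrow> 2 * max 0 v) (at 0)" by (simp add: LIM_zero_iff)
  then show ?thesis unfolding DERIV_def q_def .
qed

text \<open>A parabolic cap. For positive \<open>r\<close> its square is an elementary bump
  function: it has compact support in Euclidean space, and its gradient,
  \<open>- (4 / r\<^sup>2) * hat r w\<close> times \<open>w\<close>, is explicit and
  continuous.\<close>

definition hat :: "real \<Rightarrow> 'a::real_inner \<Rightarrow> real" where "hat r w = max 0 (1 - (norm w)\<^sup>2 / r\<^sup>2)"

lemma hat_nonneg: "hat r w \<ge> 0" by (simp add: hat_def)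
lemma hat_le_1: "hat r w \<le> 1" by (simp add: hat_def)
lemma hat_cont: "continuous_on S (\<lambda>x. hat r (g x))" if "continuous_on S g"
  unfolding hat_def divide_inverse by (intro continuous_intros that)
lemma hat_support: assumes "r > 0" "norm w \<ge> r" shows "hat r w = 0"
proof -
  have "r\<^sup>2 \<le> (norm w)\<^sup>2" using assms by (intro power_mono) auto
  then show ?thesis using assms by (simp add: hat_def)
qed

lemma DERIV_hat_sq:
  fixes w e :: "'a::real_inner"
  shows "((\<lambda>t. (hat r (w + t *\<^sub>R e))\<^sup>2) has_real_derivative
    - (4 / r\<^sup>2) * (hat r (w + t *\<^sub>R e) * ((w + t *\<^sub>R e) \<bullet> e))) (at t)"
proof -
  have "(norm (w + t *\<^sub>R e))\<^sup>2 = w \<bullet> w + 2 * t * (w \<bullet> e) + t\<^sup>2 * (e \<bullet> e)" for t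
    unfolding power2_norm_eq_inner
    by (simp add: inner_add_left inner_add_right inner_commute[of e w] power2_eq_square algebra_simps)
  moreover have "((\<lambda>t. w \<bullet> w + 2 * t * (w \<bullet> e) + t\<^sup>2 * (e \<bullet> e)) has_real_derivative 2 * ((w + t *\<^sub>R e) \<bullet> e)) (at t)"
    by (auto intro!: derivative_eq_intros simp: inner_add_left)
  ultimately have "((\<lambda>t. (norm (w + t *\<^sub>R e))\<^sup>2) has_real_derivative 2 * ((w + t *\<^sub>R e) \<bullet> e)) (at t)" by simp
  from DERIV_diff[OF DERIV_const[of 1] DERIV_cdivide[OF this, of "r\<^sup>2"]]
  have "((\<lambda>t. 1 - (norm (w + t *\<^sub>R e))\<^sup>2 / r\<^sup>2) has_real_derivative 0 - 2 * ((w + t *\<^sub>R e) \<bullet> e) / r\<^sup>2) (at t)" .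
  from DERIV_chain2[OF DERIV_pos_part_sq this] show ?thesis
    unfolding hat_def by (rule DERIV_cong) simp
qed

section \<open>Asymptotic translation invariance of \<open>\<mu> n / p\<close>\<close>

context stein_null_sequence
begin

lemma inverse_density_bound:
  obtains C where "C > 0" "\<And>x. norm x \<le> R \<Longrightarrow> 1 / p x \<le> C"
proof -
  have "compact ((\<lambda>x. 1 / p x) ` cball 0 R)"
    using p_pos by (intro compact_continuous_image continuous_intros continuous_on_subset[OF p_cont]) (auto simp: less_imp_neq[OF p_pos, symmetric])
  then obtain C where "C > 0" "\<And>x. x \<in> cball 0 R \<Longrightarrow> norm (1 / p x) \<le> C"
    using compact_imp_bounded bounded_pos by (metis (no_types, lifting) imageI)
  then show ?thesis using that[of C] p_pos by (simp add: less_imp_le)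
qed

lemma p_nonzero: "p x \<noteq> 0" using p_pos[of x] by simp

text \<open>For \<open>f = \<psi> / p\<close> the Stein operator in direction \<open>i\<close> is the partial derivative of \<open>\<psi>\<close> divided
  by \<open>p\<close>; here \<open>\<psi>\<close> is a translate of a squared hat function.\<close>

lemma hat_gradient_null:
  assumes r: "r > 0"
  shows "(\<lambda>n. \<integral>x. hat r (x - z) * ((x - z) \<bullet> e) / p x \<partial>\<mu> n) \<longlonglongrightarrow> 0"
proof -
  define R where "R = norm z + r"
  have supp: "hat r (x - z) = 0" if "norm x > R" for x
    using that norm_triangle_sub[of x z] by (intro hat_support r) (simp add: R_def)
  have hc: "continuous_on UNIV (\<lambda>x. hat r (x - z))" by (intro hat_cont continuous_intros)
  have comp: "(\<lambda>n. \<integral>x. - (4 / r\<^sup>2) * (hat r (x - z) * ((x - z) $ i) / p x) \<partial>\<mu> n) \<longlonglongrightarrow> 0" for i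
  proof -
    define f where "f x = (hat r (x - z))\<^sup>2 / p x" for x
    define w where "w x = - (4 / r\<^sup>2) * (hat r (x - z) * ((x - z) $ i) / p x)" for x
    \<comment> \<open>Solved for \<open>f'\<close> so that the Stein expression is \<open>w\<close>
      by construction; \<open>der\<close> then confirms that it is the partial derivative of
      \<open>f\<close>, the score arising from the quotient rule.\<close>
    define f' where "f' x = w x - f x * score p x $ i" for x
    have fc: "continuous_on UNIV f" unfolding f_def[abs_def]
      by (intro continuous_on_divide continuous_on_power hc p_cont) (simp add: p_nonzero)
    have wc: "continuous_on UNIV w" unfolding w_def[abs_def]
      by (intro continuous_on_divide continuous_on_mult continuous_on_const hc p_cont continuous_on_component continuous_on_diff continuous_on_id) (simp add: p_nonzero)
    have f'c: "continuous_on UNIV f'" unfolding f'_def[abs_def]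
      by (intro continuous_on_diff continuous_on_mult fc wc continuous_on_component score_cont)
    have s: "f x = 0" "w x = 0" "f' x = 0" if "norm x > R" for x
      using supp[OF that] by (auto simp: f_def w_def f'_def)
    obtain B where B: "\<And>x. \<bar>f x\<bar> \<le> B" using compact_support_bounded[OF fc s(1)] by metis
    obtain B' where B': "\<And>x. \<bar>f' x\<bar> \<le> B'" using compact_support_bounded[OF f'c s(3)] by metis
    obtain W where W: "\<And>x. \<bar>w x\<bar> \<le> W" using compact_support_bounded[OF wc s(2)] by metis
    have fw: "f x * score p x $ i + f' x = w x" for x by (simp add: f'_def)
    have der: "((\<lambda>t. f (x + t *\<^sub>R axis i 1)) has_real_derivative f' x) (at 0)" for x
    proof -
      have "((\<lambda>t. (hat r ((x - z) + t *\<^sub>R axis i 1))\<^sup>2) has_real_derivative - (4 / r\<^sup>2) * (hat r (x - z) * ((x - z) $ i))) (at 0)"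
        using DERIV_hat_sq[of r "x - z" "axis i 1" 0] by (simp add: inner_axis)
      from DERIV_divide[OF this p_deriv[of x i]]
      have "((\<lambda>t. f (x + t *\<^sub>R axis i 1)) has_real_derivative
         ((- (4 / r\<^sup>2) * (hat r (x - z) * ((x - z) $ i))) * p x - (hat r (x - z))\<^sup>2 * (p x * score p x $ i)) / (p x * p x)) (at 0)"
        by (simp add: p_nonzero f_def algebra_simps)
      also have "((- (4 / r\<^sup>2) * (hat r (x - z) * ((x - z) $ i))) * p x - (hat r (x - z))\<^sup>2 * (p x * score p x $ i)) / (p x * p x) = f' x"
        unfolding f'_def w_def f_def by (simp add: diff_divide_distrib p_nonzero)
      finally show ?thesis .
    qed
    have "(\<lambda>n. \<integral>x. f x * score p x $ i + f' x \<partial>\<mu> n) \<longlonglongrightarrow> 0"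
    proof (rule test_function_null[where B = B and B' = B' and W = W])
      show "integrable lborel (\<lambda>x. (f x)\<^sup>2)"
        by (rule compact_support_integrable[where R = R]) (use s in \<open>auto intro!: continuous_on_power fc\<close>)
      show "uniformly_continuous_on UNIV (\<lambda>x. f x * score p x $ i + f' x)"
        unfolding fw by (rule compact_support_uniformly_continuous[OF wc s(2)])
    qed (use B B' W der fc f'c in \<open>auto simp: fw intro!: borel_measurable_continuous_onI\<close>)
    then show ?thesis unfolding fw w_def .
  qed
  define g where "g i x = hat r (x - z) * ((x - z) $ i) / p x" for i x
  have g0: "(\<lambda>n. \<integral>x. g i x \<partial>\<mu> n) \<longlonglongrightarrow> 0" for i
  proof -
    have "(\<lambda>n. (- (r\<^sup>2 / 4)) * (\<integral>x. - (4 / r\<^sup>2) * g i x \<partial>\<mu> n)) \<longlonglongrightarrow> 0"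
      using tendsto_mult_right_zero[OF comp[of i]] unfolding g_def .
    then show ?thesis using r by simp
  qed
  have gint: "integrable (\<mu> n) (g i)" for i n
  proof -
    interpret \<mu>: prob_space "\<mu> n" by (rule prob_\<mu>)
    have gc: "continuous_on UNIV (g i)" unfolding g_def[abs_def]
      by (intro continuous_on_divide continuous_on_mult hc p_cont continuous_on_component continuous_on_diff continuous_on_id continuous_on_const) (simp add: p_nonzero)
    have gs: "g i x = 0" if "norm x > R" for x using supp[OF that] by (simp add: g_def)
    obtain B where B: "\<And>x. \<bar>g i x\<bar> \<le> B" using compact_support_bounded[OF gc gs] by metis
    show ?thesis by (rule \<mu>.integrable_const_bound[where B = B])
      (use B gc in \<open>auto simp: measurable_cong_sets[OF sets_\<mu> refl] intro!: borel_measurable_continuous_onI\<close>)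
  qed
  have "hat r (x - z) * ((x - z) \<bullet> e) / p x = (\<Sum>i\<in>UNIV. e $ i * g i x)" for x
    by (simp add: inner_vec_def g_def sum_distrib_left sum_divide_distrib mult_ac)
  then have "(\<integral>x. hat r (x - z) * ((x - z) \<bullet> e) / p x \<partial>\<mu> n) = (\<Sum>i\<in>UNIV. e $ i * (\<integral>x. g i x \<partial>\<mu> n))" for n
    using gint by (simp add: Bochner_Integration.integral_sum)
  moreover have "(\<lambda>n. \<Sum>i\<in>UNIV. e $ i * (\<integral>x. g i x \<partial>\<mu> n)) \<longlonglongrightarrow> 0"
    by (intro tendsto_null_sum tendsto_mult_right_zero g0)
  ultimately show ?thesis by simp
qed

text \<open>If \<open>\<phi>\<close> has mean zero, its convolution with \<open>\<eta> = (hat r)\<^sup>2\<close> is the integral of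
  \<open>\<phi> y * (\<eta> (x - y) - \<eta> x)\<close>, and \<open>\<eta> (x - y) - \<eta> x\<close> is an integral of directional derivatives.\<close>

lemma convolution_null:
  fixes \<phi> :: "real ^ 'd \<Rightarrow> real"
  assumes r: "r > 0" and \<phi>: "continuous_on UNIV \<phi>" and supp: "\<And>x. norm x > R \<Longrightarrow> \<phi> x = 0" and R: "R > 0"
    and mean: "(\<integral>x. \<phi> x \<partial>lborel) = 0"
  shows "(\<lambda>n. \<integral>x. (\<integral>y. \<phi> y * (hat r (x - y))\<^sup>2 \<partial>lborel) / p x \<partial>\<mu> n) \<longlonglongrightarrow> 0"
proof -
  have [measurable]: "\<phi> \<in> borel_measurable borel" by (rule borel_measurable_continuous_onI[OF \<phi>])
  have \<phi>i: "integrable lborel \<phi>" by (rule compact_support_integrable[OF \<phi> supp])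
  have [measurable]: "hat r \<in> borel_measurable (borel :: (real ^ 'd) measure)"
    by (intro borel_measurable_continuous_onI hat_cont continuous_on_id)
  have [measurable]: "(fst :: (real ^ 'd) \<times> real \<Rightarrow> real ^ 'd) \<in> borel_measurable borel"
    "(snd :: (real ^ 'd) \<times> real \<Rightarrow> real) \<in> borel_measurable borel"
    by (intro borel_measurable_continuous_onI continuous_intros)+
  \<comment> \<open>With \<open>v = (y, t)\<close>, integration over \<open>t\<close> gives
    \<open>\<phi> y * ((hat r (x - y))\<^sup>2 - (hat r x)\<^sup>2) / p x\<close>; the segment runs
    in direction \<open>- y\<close>, which turns the sign of the gradient. Up to a factor depending
    on \<open>v\<close> alone, \<open>K\<close> is the integrand of \<open>hat_gradient_null\<close>
    with centre \<open>t *\<^sub>R y\<close>.\<close>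
  define K :: "(real ^ 'd) \<times> real \<Rightarrow> real ^ 'd \<Rightarrow> real" where
    "K v x = \<phi> (fst v) * indicator {0..1} (snd v) * ((4 / r\<^sup>2) *
      (hat r (x - snd v *\<^sub>R fst v) * ((x - snd v *\<^sub>R fst v) \<bullet> fst v) / p x))" for v x
  obtain C where C: "C > 0" "\<And>x. norm x \<le> R + r \<Longrightarrow> 1 / p x \<le> C" using inverse_density_bound by metis
  \<comment> \<open>Where \<open>K v x\<close> does not vanish, \<open>norm y \<le> R\<close> and
    \<open>norm (x - t *\<^sub>R y) \<le> r\<close>; hence \<open>norm x \<le> R + r\<close>, so
    that \<open>1 / p x \<le> C\<close>, and the inner product is at most
    \<open>r * R\<close>.\<close>
  define E where "E = (4 / r\<^sup>2) * (r * R * C)"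
  have E: "E > 0" using r R C by (simp add: E_def)
  define dom :: "(real ^ 'd) \<times> real \<Rightarrow> real" where "dom v = E * (\<bar>\<phi> (fst v)\<bar> * indicator {0..1} (snd v))" for v
  have Kb: "\<bar>K v x\<bar> \<le> dom v" for v x
  proof (cases "\<phi> (fst v) = 0 \<or> snd v \<notin> {0..1} \<or> hat r (x - snd v *\<^sub>R fst v) = 0")
    case True
    then show ?thesis using E by (auto simp: K_def dom_def)
  next
    case False
    obtain y t where v: "v = (y, t)" by (cases v)
    have y: "norm y \<le> R" and t: "0 \<le> t" "t \<le> 1" and h: "norm (x - t *\<^sub>R y) \<le> r"
      using False supp[of y] hat_support[OF r, of "x - t *\<^sub>R y"] by (force simp: v)+
    have "norm (t *\<^sub>R y) \<le> 1 * R" unfolding norm_scaleR using t y R by (intro mult_mono) auto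
    then have "norm x \<le> R + r" using h norm_triangle_sub[of x "t *\<^sub>R y"] by simp
    then have px: "1 / p x \<le> C" by (rule C(2))
    have "\<bar>(x - t *\<^sub>R y) \<bullet> y\<bar> \<le> r * R"
      using Cauchy_Schwarz_ineq2[of "x - t *\<^sub>R y" y] h y r by (intro order_trans[OF Cauchy_Schwarz_ineq2 mult_mono]) auto
    then have "\<bar>hat r (x - t *\<^sub>R y) * ((x - t *\<^sub>R y) \<bullet> y)\<bar> * (1 / p x) \<le> (1 * (r * R)) * C"
      unfolding abs_mult using hat_le_1[of r "x - t *\<^sub>R y"] hat_nonneg[of r "x - t *\<^sub>R y"] px p_pos[of x] r R
      by (intro mult_mono) (auto simp: less_imp_le)
    then have "(4 / r\<^sup>2) * (\<bar>hat r (x - t *\<^sub>R y) * ((x - t *\<^sub>R y) \<bullet> y)\<bar> * (1 / p x)) \<le> E"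
      unfolding E_def by (intro mult_left_mono) auto
    then have "\<bar>\<phi> y\<bar> * ((4 / r\<^sup>2) * (\<bar>hat r (x - t *\<^sub>R y) * ((x - t *\<^sub>R y) \<bullet> y)\<bar> * (1 / p x))) \<le> \<bar>\<phi> y\<bar> * E"
      by (rule mult_left_mono) simp
    moreover have "\<bar>K v x\<bar> = \<bar>\<phi> y\<bar> * ((4 / r\<^sup>2) * (\<bar>hat r (x - t *\<^sub>R y) * ((x - t *\<^sub>R y) \<bullet> y)\<bar> * (1 / p x)))"
      using t p_pos[of x] by (simp add: K_def v abs_mult)
    moreover have "dom v = \<bar>\<phi> y\<bar> * E" using t by (simp add: dom_def v)
    ultimately show ?thesis by (simp only:)
  qed
  have domi: "integrable lborel dom"
  proof -
    have "integrable (lborel \<Otimes>\<^sub>M lborel) (\<lambda>v. \<bar>\<phi> (fst v)\<bar> * indicator {0..1::real} (snd v))"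
    proof (rule lborel_pair.Fubini_integrable)
      have "(\<integral>t. norm (\<bar>\<phi> (fst (y, t))\<bar> * indicator {0..1::real} (snd (y, t))) \<partial>lborel) = \<bar>\<phi> y\<bar>" for y
        by (simp add: abs_mult)
      then show "integrable lborel (\<lambda>y. \<integral>t. norm (\<bar>\<phi> (fst (y, t))\<bar> * indicator {0..1::real} (snd (y, t))) \<partial>lborel)"
        using \<phi>i by simp
    qed (simp_all add: integrable_indicator_iff)
    then show ?thesis unfolding dom_def[abs_def] lborel_prod by simp
  qed
  have inner: "(\<integral>v. K v x \<partial>lborel) = (\<integral>y. \<phi> y * (hat r (x - y))\<^sup>2 \<partial>lborel) / p x" for x
  proof -
    have Ki: "integrable (lborel \<Otimes>\<^sub>M lborel) (\<lambda>v. K v x)"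
      unfolding lborel_prod
      by (rule Bochner_Integration.integrable_bound[OF domi])
         (use Kb[of _ x] in \<open>auto intro!: order_trans[OF _ abs_ge_self], auto simp: K_def\<close>)
    have ftc: "(\<integral>t. K (y, t) x \<partial>lborel) = \<phi> y * ((hat r (x - y))\<^sup>2 - (hat r x)\<^sup>2) / p x" for y
    proof -
      define G where "G t = (4 / r\<^sup>2) * (hat r (x - t *\<^sub>R y) * ((x - t *\<^sub>R y) \<bullet> y))" for t
      have Gc: "continuous_on UNIV G" unfolding G_def[abs_def]
        by (intro continuous_intros hat_cont)
      have "((\<lambda>t. (hat r (x + t *\<^sub>R (- y)))\<^sup>2) has_real_derivative G t) (at t)" for t
        using DERIV_hat_sq[of r x "- y" t] by (simp add: G_def)
      then have "(\<integral>t. G t * indicator {0..1} t \<partial>lborel) = (hat r (x + 1 *\<^sub>R (- y)))\<^sup>2 - (hat r (x + 0 *\<^sub>R (- y)))\<^sup>2"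
        using Gc by (intro integral_FTC_Icc_real) (auto simp: continuous_on_eq_continuous_at)
      moreover have "K (y, t) x = \<phi> y / p x * (G t * indicator {0..1} t)" for t by (simp add: K_def G_def mult_ac)
      ultimately show ?thesis by simp
    qed
    have i1: "integrable lborel (\<lambda>y. \<phi> y * (hat r (x - y))\<^sup>2)"
    proof (rule Bochner_Integration.integrable_bound[OF \<phi>i])
      show "AE y in lborel. norm (\<phi> y * (hat r (x - y))\<^sup>2) \<le> norm (\<phi> y)"
        using power_le_one[OF hat_nonneg hat_le_1, of r _ 2] by (intro AE_I2) (auto simp: abs_mult intro!: mult_left_le)
    qed measurable
    have "(\<integral>v. K v x \<partial>lborel) = (\<integral>y. \<integral>t. K (y, t) x \<partial>lborel \<partial>lborel)"
      unfolding lborel_prod[symmetric] by (rule lborel_pair.integral_fst'[OF Ki, symmetric])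
    also have "\<dots> = (\<integral>y. \<phi> y * (hat r (x - y))\<^sup>2 - (hat r x)\<^sup>2 * \<phi> y \<partial>lborel) / p x"
      unfolding ftc by (simp add: algebra_simps)
    also have "(\<integral>y. \<phi> y * (hat r (x - y))\<^sup>2 - (hat r x)\<^sup>2 * \<phi> y \<partial>lborel) = (\<integral>y. \<phi> y * (hat r (x - y))\<^sup>2 \<partial>lborel)"
      using mean i1 \<phi>i by simp
    finally show ?thesis .
  qed
  have swap: "(\<integral>x. \<integral>v. K v x \<partial>lborel \<partial>\<mu> n) = (\<integral>v. \<integral>x. K v x \<partial>\<mu> n \<partial>lborel)"
    and meas: "(\<lambda>v. \<integral>x. K v x \<partial>\<mu> n) \<in> borel_measurable lborel"
    and bnd: "\<bar>\<integral>x. K v x \<partial>\<mu> n\<bar> \<le> dom v" for n v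
  proof -
    interpret \<mu>: prob_space "\<mu> n" by (rule prob_\<mu>)
    interpret pr: pair_sigma_finite "lborel :: ((real ^ 'd) \<times> real) measure" "\<mu> n" ..
    have Km[measurable]: "(\<lambda>(v, x). K v x) \<in> borel_measurable (lborel \<Otimes>\<^sub>M \<mu> n)"
      unfolding K_def by (simp add: case_prod_unfold) measurable
    have Kx: "integrable (\<mu> n) (K v)" for v
      by (rule \<mu>.integrable_const_bound[where B = "dom v"]) (use Kb in \<open>auto simp: K_def\<close>)
    show "\<bar>\<integral>x. K v x \<partial>\<mu> n\<bar> \<le> dom v" for v
    proof -
      have "\<bar>\<integral>x. K v x \<partial>\<mu> n\<bar> \<le> (\<integral>x. \<bar>K v x\<bar> \<partial>\<mu> n)" by (rule integral_abs_bound)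
      also have "\<dots> \<le> (\<integral>x. dom v \<partial>\<mu> n)" using Kx Kb by (intro integral_mono) auto
      finally show ?thesis by (simp add: \<mu>.prob_space)
    qed
    show "(\<lambda>v. \<integral>x. K v x \<partial>\<mu> n) \<in> borel_measurable lborel" by measurable
    have "integrable (lborel \<Otimes>\<^sub>M \<mu> n) (\<lambda>(v, x). K v x)"
    proof (rule pr.Fubini_integrable)
      have "(\<integral>x. \<bar>K v x\<bar> \<partial>\<mu> n) \<le> dom v" for v
      proof -
        have "(\<integral>x. \<bar>K v x\<bar> \<partial>\<mu> n) \<le> (\<integral>x. dom v \<partial>\<mu> n)" using Kx Kb by (intro integral_mono) auto
        then show ?thesis by (simp add: \<mu>.prob_space)
      qed
      then show "integrable lborel (\<lambda>v. \<integral>x. norm (case (v, x) of (v, x) \<Rightarrow> K v x) \<partial>\<mu> n)"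
        by (intro Bochner_Integration.integrable_bound[OF domi]) (auto intro!: AE_I2 order_trans[OF _ abs_ge_self])
    qed (use Kx in auto)
    then show "(\<integral>x. \<integral>v. K v x \<partial>lborel \<partial>\<mu> n) = (\<integral>v. \<integral>x. K v x \<partial>\<mu> n \<partial>lborel)"
      by (rule pr.Fubini_integral)
  qed
  \<comment> \<open>For fixed \<open>v\<close> the inner integral tends to zero, and
    \<open>dom\<close> does not depend on \<open>n\<close>, so dominated convergence needs no rate
    uniform in \<open>v\<close>.\<close>
  have "(\<lambda>n. \<integral>v. \<integral>x. K v x \<partial>\<mu> n \<partial>lborel) \<longlonglongrightarrow> (\<integral>v. 0 \<partial>(lborel :: ((real ^ 'd) \<times> real) measure))"
  proof (rule integral_dominated_convergence[OF _ meas domi])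
    show "AE v in lborel. (\<lambda>n. \<integral>x. K v x \<partial>\<mu> n) \<longlonglongrightarrow> 0"
    proof (rule AE_I2)
      fix v
      have "(\<lambda>n. (\<phi> (fst v) * indicator {0..1} (snd v) * (4 / r\<^sup>2)) *
          (\<integral>x. hat r (x - snd v *\<^sub>R fst v) * ((x - snd v *\<^sub>R fst v) \<bullet> fst v) / p x \<partial>\<mu> n)) \<longlonglongrightarrow> 0"
        by (intro tendsto_mult_right_zero hat_gradient_null r)
      moreover have "K v x = (\<phi> (fst v) * indicator {0..1} (snd v) * (4 / r\<^sup>2)) *
          (hat r (x - snd v *\<^sub>R fst v) * ((x - snd v *\<^sub>R fst v) \<bullet> fst v) / p x)" for x
        by (simp add: K_def)
      ultimately show "(\<lambda>n. \<integral>x. K v x \<partial>\<mu> n) \<longlonglongrightarrow> 0" by (simp only: integral_mult_right_zero)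
    qed
    show "AE v in lborel. norm (\<integral>x. K v x \<partial>\<mu> n) \<le> dom v" for n using bnd by simp
  qed simp
  then show ?thesis unfolding swap[symmetric] inner by simp
qed

text \<open>Convolution with a narrow normalised kernel changes \<open>\<phi>\<close> little,
  uniformly. As its width is at most 1, both functions vanish outside the ball of radius
  \<open>R + 1\<close>, where \<open>1 / p\<close> is at most \<open>C\<close>; so closeness
  survives the division by \<open>p\<close>, and \<open>convolution_null\<close> applies to the
  mollified function.\<close>

lemma mean_zero_null:
  fixes \<phi> :: "real ^ 'd \<Rightarrow> real"
  assumes \<phi>: "continuous_on UNIV \<phi>" and supp: "\<And>x. norm x > R \<Longrightarrow> \<phi> x = 0" and R: "R > 0"
    and mean: "(\<integral>x. \<phi> x \<partial>lborel) = 0"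
  shows "(\<lambda>n. \<integral>x. \<phi> x / p x \<partial>\<mu> n) \<longlonglongrightarrow> 0"
proof (rule tendstoI)
  fix \<epsilon> :: real assume eps: "\<epsilon> > 0"
  have [measurable]: "\<phi> \<in> borel_measurable borel" by (rule borel_measurable_continuous_onI[OF \<phi>])
  obtain C where C: "C > 0" "\<And>x. norm x \<le> R + 1 \<Longrightarrow> 1 / p x \<le> C" using inverse_density_bound by metis
  have "uniformly_continuous_on UNIV \<phi>" by (rule compact_support_uniformly_continuous[OF \<phi> supp])
  moreover have "\<epsilon> / (2 * C) > 0" using eps C by simp
  ultimately obtain \<delta> where \<delta>: "\<delta> > 0" "\<And>x y. norm (x - y) < \<delta> \<Longrightarrow> \<bar>\<phi> x - \<phi> y\<bar> < \<epsilon> / (2 * C)"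
    unfolding uniformly_continuous_on_def dist_norm real_norm_def by (metis UNIV_I)
  define r where "r = min \<delta> 1"
  have r: "r > 0" "r \<le> \<delta>" "r \<le> 1" using \<delta> by (auto simp: r_def)
  define \<eta> :: "real ^ 'd \<Rightarrow> real" where "\<eta> w = (hat r w)\<^sup>2" for w
  have \<eta>c: "continuous_on UNIV \<eta>" unfolding \<eta>_def[abs_def] by (intro continuous_on_power hat_cont continuous_on_id)
  have [measurable]: "\<eta> \<in> borel_measurable borel" by (rule borel_measurable_continuous_onI[OF \<eta>c])
  have \<eta>s: "\<eta> w = 0" if "norm w \<ge> r" for w using hat_support[OF r(1) that] by (simp add: \<eta>_def)
  have \<eta>i: "integrable lborel \<eta>" by (rule compact_support_integrable[OF \<eta>c, of r]) (use \<eta>s in auto)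
  have \<eta>0: "\<eta> w \<ge> 0" "\<eta> w \<le> 1" for w using hat_nonneg[of r w] hat_le_1[of r w] by (auto simp: \<eta>_def power_le_one)
  define I where "I = (\<integral>w. \<eta> w \<partial>lborel)"
  have I: "I > 0"
  proof -
    have "I \<noteq> 0"
    proof
      assume "I = 0"
      then have "AE w in lborel. \<eta> w = 0" using integral_nonneg_eq_0_iff_AE[OF \<eta>i] \<eta>0 by (simp add: I_def)
      then have "AE w in lborel. w \<notin> ball (0 :: real ^ 'd) r"
      proof eventually_elim
        case (elim w)
        show ?case
        proof
          assume "w \<in> ball (0 :: real ^ 'd) r"
          then have "(norm w)\<^sup>2 < r\<^sup>2" using r by (intro power_strict_mono) auto
          then have "hat r w > 0" using r by (simp add: hat_def)
          then show False using elim by (simp add: \<eta>_def)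
        qed
      qed
      then have "emeasure lborel (ball (0 :: real ^ 'd) r) = 0" by (subst (asm) AE_iff_measurable[of "ball (0 :: real ^ 'd) r"]) auto
      then show False using content_ball_pos[OF r(1), of "0 :: real ^ 'd"] by (simp add: measure_def)
    qed
    moreover have "I \<ge> 0" unfolding I_def using \<eta>0 by simp
    ultimately show ?thesis by simp
  qed
  define \<psi> where "\<psi> x = (\<integral>y. \<phi> y * (hat r (x - y))\<^sup>2 \<partial>lborel) / I" for x
  have [measurable]: "\<psi> \<in> borel_measurable borel"
    unfolding \<psi>_def[abs_def] \<eta>_def[symmetric] by measurable
  have \<psi>_alt: "\<psi> x = (\<integral>v. \<phi> (x - v) * \<eta> v \<partial>lborel) / I" for x
    using integral_lborel_reflect[of "\<lambda>y. \<phi> y * \<eta> (x - y)" x] by (simp add: \<psi>_def \<eta>_def[symmetric])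
  obtain B where B: "B > 0" "\<And>x. \<bar>\<phi> x\<bar> \<le> B" using compact_support_bounded[OF \<phi> supp] by metis
  have pi: "integrable lborel (\<lambda>v. \<phi> (x - v) * \<eta> v)" for x
    by (rule Bochner_Integration.integrable_bound[OF integrable_mult_right[OF \<eta>i, of B]])
       (use B \<eta>0 in \<open>auto simp: abs_mult intro!: mult_right_mono\<close>)
  have close: "\<bar>\<phi> x - \<psi> x\<bar> \<le> \<epsilon> / (2 * C)" for x
  proof -
    have "\<bar>I * \<phi> x - (\<integral>v. \<phi> (x - v) * \<eta> v \<partial>lborel)\<bar> = \<bar>\<integral>v. (\<phi> x - \<phi> (x - v)) * \<eta> v \<partial>lborel\<bar>"
      using pi \<eta>i by (simp add: left_diff_distrib I_def mult.commute[of "integral\<^sup>L lborel \<eta>"])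
    also have "\<dots> \<le> (\<integral>v. \<bar>(\<phi> x - \<phi> (x - v)) * \<eta> v\<bar> \<partial>lborel)" by (rule integral_abs_bound)
    also have "\<dots> \<le> (\<integral>v. \<epsilon> / (2 * C) * \<eta> v \<partial>lborel)"
    proof (rule integral_mono)
      show "integrable lborel (\<lambda>v. \<bar>(\<phi> x - \<phi> (x - v)) * \<eta> v\<bar>)"
        using pi \<eta>i by (simp add: left_diff_distrib)
      show "\<bar>(\<phi> x - \<phi> (x - v)) * \<eta> v\<bar> \<le> \<epsilon> / (2 * C) * \<eta> v" for v
      proof (cases "norm v < r")
        case True
        then have "\<bar>\<phi> x - \<phi> (x - v)\<bar> < \<epsilon> / (2 * C)" using r by (intro \<delta>(2)) simp
        then show ?thesis using \<eta>0[of v] unfolding abs_mult abs_of_nonneg[OF \<eta>0(1)] by (intro mult_right_mono) auto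
      qed (simp add: \<eta>s)
    qed (use \<eta>i in auto)
    also have "\<dots> = \<epsilon> / (2 * C) * I" by (simp add: I_def)
    finally have le: "\<bar>I * \<phi> x - (\<integral>v. \<phi> (x - v) * \<eta> v \<partial>lborel)\<bar> \<le> \<epsilon> / (2 * C) * I" .
    have "I * (\<phi> x - \<psi> x) = I * \<phi> x - (\<integral>v. \<phi> (x - v) * \<eta> v \<partial>lborel)"
      using I by (simp add: \<psi>_alt algebra_simps)
    with le have "\<bar>I * (\<phi> x - \<psi> x)\<bar> \<le> \<epsilon> / (2 * C) * I" by (simp only:)
    then have "I * \<bar>\<phi> x - \<psi> x\<bar> \<le> I * (\<epsilon> / (2 * C))"
      unfolding abs_mult abs_of_pos[OF I] by (simp only: mult.commute)
    then show ?thesis using I by (rule mult_left_le_imp_le)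
  qed
  have \<psi>s: "\<psi> x = 0" if "norm x > R + 1" for x
  proof -
    have z: "\<phi> (x - v) * \<eta> v = 0" for v
    proof (cases "norm v < r")
      case True
      then have "norm (x - v) > R" using that r norm_triangle_ineq2[of x v] by linarith
      then show ?thesis using supp by simp
    qed (simp add: \<eta>s)
    show ?thesis unfolding \<psi>_alt z by simp
  qed
  have close2: "\<bar>\<phi> x / p x - \<psi> x / p x\<bar> \<le> \<epsilon> / 2" for x
  proof (cases "norm x \<le> R + 1")
    case True
    have "\<bar>\<phi> x / p x - \<psi> x / p x\<bar> = \<bar>\<phi> x - \<psi> x\<bar> * (1 / p x)"
      using p_pos[of x] by (simp add: diff_divide_distrib[symmetric])
    also have "\<dots> \<le> \<epsilon> / (2 * C) * C"
      using close[of x] C(2)[OF True] C(1) p_pos[of x] eps by (intro mult_mono) (auto simp: less_imp_le)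
    also have "\<dots> = \<epsilon> / 2" using C by simp
    finally show ?thesis .
  next
    case False
    then show ?thesis using \<psi>s[of x] supp[of x] eps by simp
  qed
  have phip: "\<bar>\<phi> x / p x\<bar> \<le> B * C" for x
  proof (cases "norm x \<le> R")
    case True
    have "\<bar>\<phi> x / p x\<bar> = \<bar>\<phi> x\<bar> * (1 / p x)" using p_pos[of x] by simp
    also have "\<dots> \<le> B * C" using B C(1) C(2)[of x] True p_pos[of x] by (intro mult_mono) (auto simp: less_imp_le)
    finally show ?thesis .
  qed (use supp B C in auto)
  have "(\<lambda>n. (1 / I) * (\<integral>x. (\<integral>y. \<phi> y * (hat r (x - y))\<^sup>2 \<partial>lborel) / p x \<partial>\<mu> n)) \<longlonglongrightarrow> 0"
    by (intro tendsto_mult_right_zero convolution_null[OF r(1) \<phi> supp R mean])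
  then have "(\<lambda>n. \<integral>x. \<psi> x / p x \<partial>\<mu> n) \<longlonglongrightarrow> 0"
    unfolding integral_mult_right_zero[symmetric] by (simp add: \<psi>_def mult_ac)
  from tendstoD[OF this, of "\<epsilon> / 2"] eps
  have "\<forall>\<^sub>F n in sequentially. dist (\<integral>x. \<psi> x / p x \<partial>\<mu> n) 0 < \<epsilon> / 2" by simp
  then show "\<forall>\<^sub>F n in sequentially. dist (\<integral>x. \<phi> x / p x \<partial>\<mu> n) 0 < \<epsilon>"
  proof eventually_elim
    case (elim n)
    interpret \<mu>: prob_space "\<mu> n" by (rule prob_\<mu>)
    have i1: "integrable (\<mu> n) (\<lambda>x. \<phi> x / p x)" by (rule \<mu>.integrable_const_bound[where B = "B * C"]) (use phip in auto)
    have psp: "\<bar>\<psi> x / p x\<bar> \<le> B * C + \<epsilon> / 2" for x using phip[of x] close2[of x] by linarith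
    have i2: "integrable (\<mu> n) (\<lambda>x. \<psi> x / p x)" by (rule \<mu>.integrable_const_bound[where B = "B * C + \<epsilon> / 2"]) (use psp in auto)
    have "\<bar>(\<integral>x. \<phi> x / p x \<partial>\<mu> n) - (\<integral>x. \<psi> x / p x \<partial>\<mu> n)\<bar> = \<bar>\<integral>x. \<phi> x / p x - \<psi> x / p x \<partial>\<mu> n\<bar>"
      using i1 i2 by simp
    also have "\<dots> \<le> (\<integral>x. \<bar>\<phi> x / p x - \<psi> x / p x\<bar> \<partial>\<mu> n)" by (rule integral_abs_bound)
    also have "\<dots> \<le> (\<integral>x. \<epsilon> / 2 \<partial>\<mu> n)" using i1 i2 by (intro integral_mono close2) auto
    also have "\<dots> = \<epsilon> / 2" by (simp add: \<mu>.prob_space)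
    finally show ?case using elim by (auto simp: dist_real_def abs_if split: if_splits)
  qed
qed


text \<open>A bounded \<open>f\<close> is cut off by \<open>\<theta>\<close> and centred by a
  multiple of \<open>\<theta>\<close>; multiplied by \<open>p\<close>, this is an admissible
  function of mean zero. So the averages of \<open>f\<close> with weight \<open>\<theta>\<close>
  under \<open>\<mu> n\<close> and under \<open>P\<close> agree in the limit, and tightness makes
  the total weight nearly 1 on both sides.\<close>

theorem weakly_converges_to_target:
  assumes diss: "distantly_dissipative p"
  shows "weakly_converges \<mu> P"
  unfolding weakly_converges_def
proof (intro allI impI)
  fix f :: "real ^ 'd \<Rightarrow> real"
  assume fc: "continuous_on UNIV f" and fb: "bounded (range f)"
  interpret P: prob_space P by (rule prob_P)
  have [measurable]: "f \<in> borel_measurable borel" by (rule borel_measurable_continuous_onI[OF fc])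
  obtain B where B: "B > 0" "\<And>x. \<bar>f x\<bar> \<le> B" using fb unfolding bounded_pos by auto
  show "(\<lambda>n. \<integral>x. f x \<partial>\<mu> n) \<longlonglongrightarrow> (\<integral>x. f x \<partial>P)"
  proof (rule tendstoI)
    fix e :: real assume e: "e > 0"
    \<comment> \<open>Three errors of size \<open>B * \<epsilon>\<close> (two tails and the change
      of total weight) and one of size \<open>e / 5\<close> must stay within \<open>e\<close>;
      \<open>\<epsilon> \<le> 1 / 2\<close> keeps the weight \<open>q\<close> away from 0.\<close>
    define \<epsilon> where "\<epsilon> = min (e / (5 * B)) (1 / 2)"
    have eps: "\<epsilon> > 0" "\<epsilon> \<le> 1 / 2" "\<epsilon> * B \<le> e / 5" using e B by (auto simp: \<epsilon>_def min_def field_simps)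
    obtain R1 where R1: "R1 > 0" "\<forall>\<^sub>F n in sequentially. measure (\<mu> n) {x. norm x \<ge> R1} \<le> \<epsilon>"
      using tight[OF diss eps(1)] by blast
    obtain R2 where R2: "measure P {x. norm x \<ge> R2} \<le> \<epsilon>"
    proof -
      have "(\<lambda>n. measure P {x. norm x \<ge> real n}) \<longlonglongrightarrow> measure P (\<Inter>n. {x. norm x \<ge> real n})"
        by (intro P.finite_Lim_measure_decseq) (auto simp: decseq_def sets_P)
      moreover have "(\<Inter>n. {x :: real ^ 'd. norm x \<ge> real n}) = {}"
        using reals_Archimedean2 by (fastforce simp: not_le[symmetric])
      ultimately have "(\<lambda>n. measure P {x. norm x \<ge> real n}) \<longlonglongrightarrow> 0" by simp
      then have "\<forall>\<^sub>F n in sequentially. measure P {x. norm x \<ge> real n} < \<epsilon>" using eps(1) by (rule order_tendstoD)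
      then obtain n where "measure P {x. norm x \<ge> real n} < \<epsilon>" by (auto simp: eventually_sequentially)
      then show ?thesis by (intro that[of "real n"]) simp
    qed
    define R where "R = max R1 R2"
    have R: "R > 0" "R \<ge> R1" "R \<ge> R2" using R1(1) by (auto simp: R_def)
    define \<theta> :: "real ^ 'd \<Rightarrow> real" where "\<theta> x = max 0 (min 1 (R + 1 - norm x))" for x
    have \<theta>c: "continuous_on UNIV \<theta>" unfolding \<theta>_def[abs_def] by (intro continuous_intros)
    have [measurable]: "\<theta> \<in> borel_measurable borel" by (rule borel_measurable_continuous_onI[OF \<theta>c])
    have \<theta>: "0 \<le> \<theta> x" "\<theta> x \<le> 1" for x by (auto simp: \<theta>_def)
    have \<theta>s: "\<theta> x = 0" if "norm x > R + 1" for x using that by (simp add: \<theta>_def)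
    have cut: "\<bar>(\<integral>x. g x \<partial>M) - (\<integral>x. g x * \<theta> x \<partial>M)\<bar> \<le> b * \<epsilon>"
      if M: "prob_space M" "sets M = sets borel" "measure M {x. norm x \<ge> R} \<le> \<epsilon>"
        and g: "g \<in> borel_measurable borel" "\<And>x. \<bar>g x\<bar> \<le> b" for M b and g :: "real ^ 'd \<Rightarrow> real"
    proof -
      interpret M: prob_space M by fact
      have [measurable_cong]: "sets M = sets borel" by fact
      have [measurable]: "g \<in> borel_measurable borel" by fact
      have b0: "b \<ge> 0" using order_trans[OF abs_ge_zero g(2)] .
      have A: "{x. norm x \<ge> R} \<in> sets M" unfolding M(2) by measurable
      have gx: "\<bar>g x * \<theta> x\<bar> \<le> b" for x
        unfolding abs_mult using mult_mono[OF g(2)[of x] \<theta>(2)[of x]] \<theta>(1)[of x] b0 by simp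
      have i: "integrable M g" "integrable M (\<lambda>x. g x * \<theta> x)"
        by (rule M.integrable_const_bound[where B = b]; use g gx in auto)+
      have iA: "integrable M (\<lambda>x. b * indicator {x. norm x \<ge> R} x)"
        using A by (intro integrable_mult_right integrable_real_indicator) (auto simp: M.emeasure_eq_measure)
      have "\<bar>(\<integral>x. g x \<partial>M) - (\<integral>x. g x * \<theta> x \<partial>M)\<bar> = \<bar>\<integral>x. g x - g x * \<theta> x \<partial>M\<bar>" using i by simp
      also have "\<dots> \<le> (\<integral>x. \<bar>g x - g x * \<theta> x\<bar> \<partial>M)" by (rule integral_abs_bound)
      also have "\<dots> \<le> (\<integral>x. b * indicator {x. norm x \<ge> R} x \<partial>M)"
      proof (rule integral_mono)
        fix x
        have eq: "g x - g x * \<theta> x = g x * (1 - \<theta> x)" by (simp add: algebra_simps)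
        show "\<bar>g x - g x * \<theta> x\<bar> \<le> b * indicator {x. norm x \<ge> R} x"
        proof (cases "norm x \<ge> R")
          case True
          have "\<bar>g x\<bar> * \<bar>1 - \<theta> x\<bar> \<le> b * 1" using g(2)[of x] \<theta>[of x] b0 by (intro mult_mono) auto
          then show ?thesis using True unfolding eq abs_mult by simp
        next
          case False
          then have "\<theta> x = 1" by (simp add: \<theta>_def)
          then show ?thesis using False by simp
        qed
      qed (use i iA in auto)
      also have "\<dots> = b * measure M {x. norm x \<ge> R}" using A by simp
      also have "\<dots> \<le> b * \<epsilon>" using M(3) b0 by (rule mult_left_mono)
      finally show ?thesis .
    qed
    have mono: "measure M {x. norm x \<ge> R} \<le> \<epsilon>"
      if "prob_space M" "sets M = sets borel" "measure M {x. norm x \<ge> r} \<le> \<epsilon>" "r \<le> R" for M :: "(real ^ 'd) measure" and r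
    proof -
      interpret M: prob_space M by fact
      have "measure M {x. norm x \<ge> R} \<le> measure M {x. norm x \<ge> r}"
        using that(4) by (intro M.finite_measure_mono) (auto simp: that(2))
      then show ?thesis using that(3) by simp
    qed
    have PR: "measure P {x. norm x \<ge> R} \<le> \<epsilon>" by (rule mono[OF prob_P sets_P R2 R(3)])
    define m where "m = (\<integral>x. f x * \<theta> x \<partial>P)"
    define q where "q = (\<integral>x. \<theta> x \<partial>P)"
    have fm: "\<bar>(\<integral>x. f x \<partial>P) - m\<bar> \<le> B * \<epsilon>" unfolding m_def by (rule cut[OF prob_P sets_P PR _ B(2)]) simp
    have q: "\<bar>1 - q\<bar> \<le> \<epsilon>" using cut[OF prob_P sets_P PR, of "\<lambda>_. 1" 1] by (simp add: q_def P.prob_space)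
    then have q0: "q \<ge> 1 / 2" using eps by linarith
    have i\<theta>: "integrable M \<theta>" "integrable M (\<lambda>x. f x * \<theta> x)"
      if "prob_space M" and [measurable_cong]: "sets M = sets borel" for M
    proof -
      interpret M: prob_space M by fact
      have "\<bar>f x * \<theta> x\<bar> \<le> B" for x
        unfolding abs_mult using mult_mono[OF B(2)[of x] \<theta>(2)[of x]] \<theta>(1)[of x] B(1) by simp
      then show "integrable M (\<lambda>x. f x * \<theta> x)" by (intro M.integrable_const_bound[where B = B]) auto
      show "integrable M \<theta>" by (rule M.integrable_const_bound[where B = 1]) (use \<theta> in auto)
    qed
    \<comment> \<open>\<open>m / q\<close> is the average of \<open>f\<close> with weight
      \<open>\<theta>\<close> under \<open>P\<close>, so it inherits the bound of
      \<open>f\<close>.\<close>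
    have mq: "\<bar>m / q\<bar> \<le> B"
    proof -
      have "\<bar>m\<bar> \<le> (\<integral>x. \<bar>f x * \<theta> x\<bar> \<partial>P)" unfolding m_def by (rule integral_abs_bound)
      also have "\<dots> \<le> (\<integral>x. B * \<theta> x \<partial>P)"
        using B \<theta>
        by (intro integral_mono integrable_abs integrable_mult_right i\<theta> prob_P sets_P)
           (auto simp: abs_mult intro!: mult_right_mono)
      finally have "\<bar>m\<bar> \<le> B * q" by (simp add: q_def)
      then show ?thesis using q0 by (simp add: divide_le_eq)
    qed
    \<comment> \<open>Subtracting \<open>m / q * \<theta>\<close> gives mean zero under
      \<open>P\<close> without leaving the compact support; the factor \<open>p\<close> turns
      integrals over \<open>P\<close> into Lebesgue integrals.\<close>
    define \<phi> where "\<phi> x = (f x * \<theta> x - m / q * \<theta> x) * p x" for x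
    have \<phi>p: "\<phi> x / p x = f x * \<theta> x - m / q * \<theta> x" for x by (simp add: \<phi>_def p_nonzero)
    have \<phi>c: "continuous_on UNIV \<phi>" unfolding \<phi>_def[abs_def] by (intro continuous_intros fc \<theta>c p_cont)
    have "(\<integral>x. \<phi> x \<partial>lborel) = (\<integral>x. f x * \<theta> x - m / q * \<theta> x \<partial>P)"
      unfolding P_density \<phi>_def by (subst integral_density) (auto simp: less_imp_le[OF p_pos] mult.commute)
    also have "\<dots> = m - m / q * q" using i\<theta>[OF prob_P sets_P] by (simp add: m_def q_def)
    also have "\<dots> = 0" using q0 by simp
    finally have mean: "(\<integral>x. \<phi> x \<partial>lborel) = 0" .
    have "(\<lambda>n. \<integral>x. \<phi> x / p x \<partial>\<mu> n) \<longlonglongrightarrow> 0"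
      by (rule mean_zero_null[OF \<phi>c _ _ mean, of "R + 1"]) (use R in \<open>auto simp: \<phi>_def \<theta>s\<close>)
    then have "\<forall>\<^sub>F n in sequentially. dist (\<integral>x. \<phi> x / p x \<partial>\<mu> n) 0 < e / 5" using e by (intro tendstoD) auto
    then show "\<forall>\<^sub>F n in sequentially. dist (\<integral>x. f x \<partial>\<mu> n) (\<integral>x. f x \<partial>P) < e"
      using R1(2)
    proof eventually_elim
      case (elim n)
      interpret \<mu>: prob_space "\<mu> n" by (rule prob_\<mu>)
      have \<mu>R: "measure (\<mu> n) {x. norm x \<ge> R} \<le> \<epsilon>" by (rule mono[OF prob_\<mu> sets_\<mu> elim(2) R(2)])
      define X where "X = (\<integral>x. \<theta> x \<partial>\<mu> n)"
      define Y where "Y = (\<integral>x. f x * \<theta> x \<partial>\<mu> n)"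
      have 1: "\<bar>(\<integral>x. f x \<partial>\<mu> n) - Y\<bar> \<le> B * \<epsilon>" unfolding Y_def by (rule cut[OF prob_\<mu> sets_\<mu> \<mu>R _ B(2)]) simp
      have 2: "\<bar>1 - X\<bar> \<le> \<epsilon>" using cut[OF prob_\<mu> sets_\<mu> \<mu>R, of "\<lambda>_. 1" 1] by (simp add: X_def \<mu>.prob_space)
      have "(\<integral>x. \<phi> x / p x \<partial>\<mu> n) = Y - m / q * X"
        unfolding \<phi>p using i\<theta>[OF prob_\<mu> sets_\<mu>] by (simp add: X_def Y_def)
      then have 3: "\<bar>Y - m / q * X\<bar> < e / 5" using elim(1) by (simp add: dist_real_def)
      \<comment> \<open>Both weights lie between \<open>1 - \<epsilon>\<close> and 1, so they differ
        by at most \<open>\<epsilon>\<close>.\<close>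
      have "X - q \<le> \<epsilon>" "q - X \<le> \<epsilon>"
      proof -
        have "X \<le> 1" "q \<le> 1"
          using integral_mono[OF i\<theta>(1)[OF prob_\<mu> sets_\<mu>] \<mu>.integrable_const[of 1] \<theta>(2)]
            integral_mono[OF i\<theta>(1)[OF prob_P sets_P] P.integrable_const[of 1] \<theta>(2)]
          by (simp_all add: X_def q_def \<mu>.prob_space P.prob_space)
        then show "X - q \<le> \<epsilon>" "q - X \<le> \<epsilon>" using q 2 by linarith+
      qed
      then have "\<bar>m / q\<bar> * \<bar>X - q\<bar> \<le> B * \<epsilon>" using mq B(1) by (intro mult_mono) auto
      moreover have "m / q * X - m = m / q * (X - q)" using q0 by (simp add: right_diff_distrib)
      ultimately have 4: "\<bar>m / q * X - m\<bar> \<le> B * \<epsilon>" by (simp only: abs_mult)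
      have "\<bar>(\<integral>x. f x \<partial>\<mu> n) - (\<integral>x. f x \<partial>P)\<bar> < e / 5 + 3 * (B * \<epsilon>)"
        using 1 3 4 fm unfolding abs_le_iff abs_less_iff by linarith
      also have "\<dots> \<le> e" using eps(3) e by (simp add: mult.commute)
      finally show ?case by (simp add: dist_real_def)
    qed
  qed
qed

end

theorem theorem2:
  fixes Q :: "'a::polish_space measure"
    and P :: "(real ^ 'd) measure"
    and p :: "real ^ 'd \<Rightarrow> real"
    and \<TT> :: "('a \<Rightarrow> real ^ 'd) set"
    and \<T> :: "nat \<Rightarrow> ('a \<Rightarrow> real ^ 'd) set"
    and T :: "nat \<Rightarrow> 'a \<Rightarrow> real ^ 'd"
    and c l \<beta> :: real
    and H :: "(real ^ 'd \<Rightarrow> real) set"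
    and ip :: "(real ^ 'd \<Rightarrow> real) \<Rightarrow> (real ^ 'd \<Rightarrow> real) \<Rightarrow> real"
  assumes Q: "prob_space Q" "sets Q = sets borel"
    and Q_atomless: "\<And>x. measure Q {x} = 0"
    and P: "prob_space P" "integrable P (\<lambda>x. (norm x)\<^sup>2)"
    and p: "p \<in> borel_measurable borel" "\<And>x. p x > 0" "P = density lborel (\<lambda>x. ennreal (p x))"
    and \<TT>: "\<TT> \<subseteq> L2_prod_space Q" "\<exists>S\<in>\<TT>. distr Q borel S = P"
    and \<T>: "\<And>n. \<T> n \<subseteq> \<TT>" "\<And>m n. n \<le> m \<Longrightarrow> \<T> n \<subseteq> \<T> m" "L2_prod_dense_in Q (\<Union>n. \<T> n) \<TT>"
    and dissipative: "distantly_dissipative p"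
    and score_exists: "\<And>x. (\<lambda>x. ln (p x)) differentiable (at x)"
    and score_lipschitz: "\<exists>L. L-lipschitz_on UNIV (score p)"
    and score_integrable: "integrable P (\<lambda>x. (norm (score p x))\<^sup>2)"
    and kernel_params: "c > 0" "l > 0" "\<beta> \<in> {-1<..<0}"
    and rkhs: "rkhs (imq_kernel c l \<beta>) H ip"
    and T_mem: "\<And>n. T n \<in> \<T> n"
    and T_minimising:
      "(\<lambda>n. kernel_stein_discrepancy H ip p (distr Q borel (T n)) -
             (INF S\<in>\<T> n. kernel_stein_discrepancy H ip p (distr Q borel S))) \<longlonglongrightarrow> 0"
  shows "weakly_converges (\<lambda>n. distr Q borel (T n)) P"
proof -
  interpret stein_setting c l \<beta> H ip p P
    using rkhs kernel_params P p score_exists score_lipschitz score_integrable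
    by (auto simp: stein_setting_def imq_rkhs_def imq_rkhs_axioms_def stein_setting_axioms_def)
  have mem: "T n \<in> L2_prod_space Q" for n using T_mem \<T>(1) \<TT>(1) by blast
  note Tm[measurable] = L2_prod_space_measurable[OF mem]
  interpret Q: prob_space Q by (rule Q(1))
  have "stein_null_sequence c l \<beta> H ip p P (\<lambda>n. distr Q borel (T n))"
  proof (intro stein_null_sequence.intro stein_setting_axioms stein_null_sequence_axioms.intro)
    show "prob_space (distr Q borel (T n))" for n by (rule Q.prob_space_distr[OF Tm])
    show "sets (distr Q borel (T n)) = sets borel" for n by simp
    show "integrable (distr Q borel (T n)) norm" for n
      using Cauchy_Schwarz_integral(1)[of "\<lambda>x. norm (T n x)" Q "\<lambda>x. 1"] L2_prod_space_integrable[OF mem, of n]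
      by (simp add: integrable_distr_eq)
    show "(\<lambda>n. \<integral>x. stein_op p f x \<partial>distr Q borel (T n)) \<longlonglongrightarrow> 0" if "f \<in> rkhs_fields" for f
      by (rule stein_integrals_tendsto_zero[OF Q(1) \<TT> \<T>(2,3) T_minimising that])
  qed
  then interpret stein_null_sequence c l \<beta> H ip p P "\<lambda>n. distr Q borel (T n)" .
  show ?thesis by (rule weakly_converges_to_target[OF dissipative])
qed

end
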